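(* Let $\mathbb{F}$ be a field, $R=\mathbb{F}[t]$, $K=\mathbb{F}(t)$, and let $V$ be an $R$-module. Let $T$ be the torsion submodule of $V$, $W=V/T$, and let $Z$ be the center of ${\rm L}(V^* )_R$ and $Z_0$ the center of ${\rm L}_R(V)$. Denote by $P_W$ the set of all primes $p\in R$ such that $pW\neq W$, by $Q_T$ the set of all primes $q\in R$ such that the $q$-primary part $T_q$ of $T$ is nonzero, and by $S$ the set of all $q\in Q_T\setminus P_W$ such that $T_q$ is a direct sum of cyclic modules of orders bounded by some $n_q$ (that is, $q^{n_q}T_q=0$ for some $n_q\in\mathbb{N}$, and we choose the minimal such $n_q$). Suppose that $W\neq 0$. Then for each $b\in Z$ there exist a finite subset $S_b$ of $S$ and a submodule $W_b$ of $V$ such that $$V=T_b\oplus W_b,\qquad T_b=\bigoplus_{q\in S_b}T_q,$$ $b$ acts on $W_b$ as the multiplication by a rational function $r\in K$, and $b$ acts on each summand $T_q$ ($q\in S_b$) of $T_b$ as the multiplication by a polynomial $f_q\in R$; that is, $b=c^*$ for an operator $c$ on $V$ which leaves $W_b$ and all $T_q$ ($q\in S_b$) invariant and acts on them in this way. Conversely, if $c$ is a map on $V$ for which there exist such a decomposition (a finite subset $S_b\subseteq S$, a submodule $W_b$ with $V=(\bigoplus_{q\in S_b}T_q)\oplus W_b$, such that $c$ acts on $W_b$ as multiplication by a rational function $r\in K$ and on each $T_q$, $q\in S_b$, as multiplication by a polynomial $f_q$), then $c^*\in Z$ and $c\in Z_0$.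
   Context: A prime in $R=\mathbb{F}[t]$ is a monic irreducible polynomial. $V^*$ is the vector space dual of $V$ (all linear functionals), regarded as a (right) $R$-module by $\langle\rho p,\xi\rangle=\langle\rho,p\xi\rangle$ for $\rho\in V^*$, $p\in R$, $\xi\in V$. ${\rm L}_R(V)$ denotes the algebra of $R$-module endomorphisms of $V$, and ${\rm L}(V^* )_R$ the algebra of $R$-module endomorphisms of $V^*$. For a linear operator $c$ on $V$, $c^*$ is its adjoint on $V^*$, $c^*(\rho)=\rho\circ c$. The torsion submodule of $V$ is the set of all $\xi\in V$ with $p\xi=0$ for some nonzero $p\in R$; the $q$-primary part is $T_q=\{\xi\in T: q^k\xi=0\text{ for some }k\in\mathbb{N}\}$. Multiplication by a rational function $r=u/v$ ($u,v\in R$ relatively prime) on a module makes sense when multiplication by $v$ is invertible on that module, and then it is the multiplication by $v^{-1}u$; saying that an operator acts as multiplication by $r$ includes this invertibility. *)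

theory Defs
  imports
    "HOL-Computational_Algebra.Polynomial"
    "HOL-Computational_Algebra.Fraction_Field"
    "HOL-Library.FuncSet"
begin

text \<open>
  The module \<open>V\<close> over \<open>R = F[t]\<close> is given by a scalar multiplication
  \<open>scale :: 'a poly \<Rightarrow> 'v \<Rightarrow> 'v\<close> satisfying the library predicate
  \<^const>\<open>module\<close>; its carrier is the whole type \<open>'v\<close>. The field of rational
  functions is \<open>'a poly fract\<close>.
\<close>

definition prime_poly :: "'a::field poly \<Rightarrow> bool" where
  "prime_poly p \<longleftrightarrow> lead_coeff p = 1 \<and> irreducible p"

subsection \<open>Torsion, primary parts and the torsion-free quotient\<close>

definition torsion :: "('a::field poly \<Rightarrow> 'v::ab_group_add \<Rightarrow> 'v) \<Rightarrow> 'v set" where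
  "torsion scale = {x. \<exists>p. p \<noteq> 0 \<and> scale p x = 0}"

definition primary_part ::
  "('a::field poly \<Rightarrow> 'v::ab_group_add \<Rightarrow> 'v) \<Rightarrow> 'a poly \<Rightarrow> 'v set" where
  "primary_part scale q = {x \<in> torsion scale. \<exists>k::nat. scale (q ^ k) x = 0}"

definition torsion_coset ::
  "('a::field poly \<Rightarrow> 'v::ab_group_add \<Rightarrow> 'v) \<Rightarrow> 'v \<Rightarrow> 'v set" where
  "torsion_coset scale x = (\<lambda>y. x + y) ` torsion scale"

text \<open>The quotient \<open>W = V/T\<close>; its elements are cosets, its zero is \<open>T\<close> itself.\<close>

definition torsion_quotient ::
  "('a::field poly \<Rightarrow> 'v::ab_group_add \<Rightarrow> 'v) \<Rightarrow> 'v set set" where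
  "torsion_quotient scale = range (torsion_coset scale)"

text \<open>\<open>p (x + T) = p x + T\<close>; all members of the union coincide.\<close>

definition quotient_scale ::
  "('a::field poly \<Rightarrow> 'v::ab_group_add \<Rightarrow> 'v) \<Rightarrow> 'a poly \<Rightarrow> 'v set \<Rightarrow> 'v set" where
  "quotient_scale scale p C = (\<Union>x\<in>C. torsion_coset scale (scale p x))"

definition P_W :: "('a::field poly \<Rightarrow> 'v::ab_group_add \<Rightarrow> 'v) \<Rightarrow> 'a poly set" where
  "P_W scale =
     {p. prime_poly p \<and> quotient_scale scale p ` torsion_quotient scale \<noteq> torsion_quotient scale}"

definition Q_T :: "('a::field poly \<Rightarrow> 'v::ab_group_add \<Rightarrow> 'v) \<Rightarrow> 'a poly set" where
  "Q_T scale = {q. prime_poly q \<and> primary_part scale q \<noteq> {0}}"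

text \<open>
  ``\<open>T\<^sub>q\<close> is a direct sum of cyclic modules of orders bounded by some \<open>n\<close>'' is spelled
  out as \<open>q\<^sup>n T\<^sub>q = 0\<close>; over a principal ideal domain the two agree by the Pruefer-Baer
  theorem.
\<close>

definition bounded_primes ::
  "('a::field poly \<Rightarrow> 'v::ab_group_add \<Rightarrow> 'v) \<Rightarrow> 'a poly set" where
  "bounded_primes scale =
     {q \<in> Q_T scale - P_W scale. \<exists>n::nat. scale (q ^ n) ` primary_part scale q = {0}}"

subsection \<open>Operators, the dual module and centers\<close>

definition field_scale ::
  "('a::field poly \<Rightarrow> 'v::ab_group_add \<Rightarrow> 'v) \<Rightarrow> 'a \<Rightarrow> 'v \<Rightarrow> 'v" where
  "field_scale scale a = scale [:a:]"

definition linear_operator ::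
  "('a::field poly \<Rightarrow> 'v::ab_group_add \<Rightarrow> 'v) \<Rightarrow> ('v \<Rightarrow> 'v) \<Rightarrow> bool" where
  "linear_operator scale c \<longleftrightarrow> Vector_Spaces.linear (field_scale scale) (field_scale scale) c"

definition dual :: "('a::field poly \<Rightarrow> 'v::ab_group_add \<Rightarrow> 'v) \<Rightarrow> ('v \<Rightarrow> 'a) set" where
  "dual scale = {\<rho>. Vector_Spaces.linear (field_scale scale) (*) \<rho>}"

definition dual_scale ::
  "('a::field poly \<Rightarrow> 'v::ab_group_add \<Rightarrow> 'v) \<Rightarrow> ('v \<Rightarrow> 'a) \<Rightarrow> 'a poly \<Rightarrow> ('v \<Rightarrow> 'a)" where
  "dual_scale scale \<rho> p = (\<lambda>\<xi>. \<rho> (scale p \<xi>))"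

definition endos :: "('a::field poly \<Rightarrow> 'v::ab_group_add \<Rightarrow> 'v) \<Rightarrow> ('v \<Rightarrow> 'v) set" where
  "endos scale = {c. module_hom scale scale c}"

text \<open>
  The dual is a proper subset of a function type, so maps on it are taken
  extensional: this makes equality of functions the equality of maps on the dual.
\<close>

definition dual_endos ::
  "('a::field poly \<Rightarrow> 'v::ab_group_add \<Rightarrow> 'v) \<Rightarrow> (('v \<Rightarrow> 'a) \<Rightarrow> ('v \<Rightarrow> 'a)) set" where
  "dual_endos scale =
     {b \<in> dual scale \<rightarrow>\<^sub>E dual scale.
        (\<forall>\<rho>\<in>dual scale. \<forall>\<sigma>\<in>dual scale. b (\<lambda>\<xi>. \<rho> \<xi> + \<sigma> \<xi>) = (\<lambda>\<xi>. b \<rho> \<xi> + b \<sigma> \<xi>)) \<and>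
        (\<forall>\<rho>\<in>dual scale. \<forall>p. b (dual_scale scale \<rho> p) = dual_scale scale (b \<rho>) p)}"

definition adjoint_op ::
  "('a::field poly \<Rightarrow> 'v::ab_group_add \<Rightarrow> 'v) \<Rightarrow> ('v \<Rightarrow> 'v) \<Rightarrow> (('v \<Rightarrow> 'a) \<Rightarrow> ('v \<Rightarrow> 'a))" where
  "adjoint_op scale c = (\<lambda>\<rho>\<in>dual scale. \<rho> \<circ> c)"

definition center :: "('m \<Rightarrow> 'm \<Rightarrow> 'm) \<Rightarrow> 'm set \<Rightarrow> 'm set" where
  "center mul A = {a \<in> A. \<forall>b\<in>A. mul a b = mul b a}"

definition endos_center :: "('a::field poly \<Rightarrow> 'v::ab_group_add \<Rightarrow> 'v) \<Rightarrow> ('v \<Rightarrow> 'v) set" where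
  "endos_center scale = center (\<circ>) (endos scale)"

definition dual_endos_center ::
  "('a::field poly \<Rightarrow> 'v::ab_group_add \<Rightarrow> 'v) \<Rightarrow> (('v \<Rightarrow> 'a) \<Rightarrow> ('v \<Rightarrow> 'a)) set" where
  "dual_endos_center scale = center (compose (dual scale)) (dual_endos scale)"

subsection \<open>Internal direct sums and multiplication operators\<close>

definition direct_sum_family :: "'i set \<Rightarrow> ('i \<Rightarrow> 'v::ab_group_add set) \<Rightarrow> 'v set \<Rightarrow> bool" where
  "direct_sum_family I N M \<longleftrightarrow> finite I \<and> bij_betw (\<lambda>x. \<Sum>i\<in>I. x i) (\<Pi>\<^sub>E i\<in>I. N i) M"

definition direct_sum :: "'v::ab_group_add set \<Rightarrow> 'v set \<Rightarrow> 'v set \<Rightarrow> bool" where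
  "direct_sum A B M \<longleftrightarrow> bij_betw (\<lambda>(x, y). x + y) (A \<times> B) M"

definition acts_as_poly ::
  "('a::field poly \<Rightarrow> 'v::ab_group_add \<Rightarrow> 'v) \<Rightarrow> ('v \<Rightarrow> 'v) \<Rightarrow> 'v set \<Rightarrow> 'a poly \<Rightarrow> bool" where
  "acts_as_poly scale c N f \<longleftrightarrow> c ` N \<subseteq> N \<and> (\<forall>x\<in>N. c x = scale f x)"

text \<open>Multiplication by \<open>u/v\<close> in lowest terms includes invertibility of \<open>v\<close> on \<open>N\<close>.\<close>

definition acts_as_rational ::
  "('a::field poly \<Rightarrow> 'v::ab_group_add \<Rightarrow> 'v) \<Rightarrow> ('v \<Rightarrow> 'v) \<Rightarrow> 'v set \<Rightarrow> 'a poly fract \<Rightarrow> bool" where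
  "acts_as_rational scale c N r \<longleftrightarrow>
     c ` N \<subseteq> N \<and>
     (\<exists>u v. v \<noteq> 0 \<and> coprime u v \<and> r = Fract u v \<and> bij_betw (scale v) N N \<and>
        (\<forall>x\<in>N. c x = the_inv_into N (scale v) (scale u x)))"

definition multiplication_decomposition ::
  "('a::field poly \<Rightarrow> 'v::ab_group_add \<Rightarrow> 'v) \<Rightarrow> ('v \<Rightarrow> 'v) \<Rightarrow> 'a poly set \<Rightarrow> 'v set \<Rightarrow> 'v set
    \<Rightarrow> 'a poly fract \<Rightarrow> ('a poly \<Rightarrow> 'a poly) \<Rightarrow> bool" where
  "multiplication_decomposition scale c Sb Tb Wb r f \<longleftrightarrow>
     finite Sb \<and> Sb \<subseteq> bounded_primes scale \<and>
     module.subspace scale Wb \<and>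
     direct_sum_family Sb (primary_part scale) Tb \<and>
     direct_sum Tb Wb UNIV \<and>
     acts_as_rational scale c Wb r \<and>
     (\<forall>q\<in>Sb. acts_as_poly scale c (primary_part scale q) (f q))"

end

theory Submission
  imports Defs "HOL-Library.Function_Algebras"
begin

text \<open>
  Throughout, the torsion submodule is \<open>T\<close>, the quotient is \<open>W = V/T\<close>, and the dual of \<open>W\<close> is the
  submodule of the dual of \<open>V\<close> formed by the functionals that vanish on \<open>T\<close>.

  A central \<open>b\<close> is tested against two kinds of endomorphisms of the dual of \<open>V\<close>. Since \<open>W\<close> is
  torsion-free, its dual is divisible and hence injective, so every homomorphism from a submodule of
  the dual of \<open>V\<close> to the dual of \<open>W\<close> extends (\<open>hom_to_annihilator_extends\<close>). Since \<open>R/q ^ m\<close> is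
  injective over itself, homomorphisms to \<open>R/q ^ m\<close> that kill the multiples of \<open>q ^ m\<close> extend as
  well (\<open>hom_to_cyclic_quotient\<close>). Both are instances of one Baer type extension lemma
  (\<open>partial_hom_extends\<close>).

  The first kind yields the rational function: there are coprime \<open>u\<close> and \<open>v\<close> such that \<open>h = v b - u\<close>
  is zero on the dual of \<open>W\<close> and has only torsion values (\<open>dual_central_rational\<close>). This uses that
  \<open>W\<close> is nonzero, as the dual of \<open>W\<close> must contain a functional with zero annihilator. The map \<open>h\<close>
  is again central. On the \<open>q\<close>-primary part \<open>T_q\<close> all its values vanish if \<open>q W \<noteq> W\<close>, for then
  torsion values of \<open>h\<close> could be moved into the dual of \<open>W\<close>, where \<open>h\<close> is zero; and if \<open>T_q\<close> is
  unbounded, for then the orders of the values of \<open>h\<close> could not be finite. They vanish for all but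
  finitely many \<open>q\<close>, because functionals on different \<open>T_q\<close> can be glued to a single one, whose
  image under \<open>h\<close> is killed by one polynomial. So \<open>h\<close> lives on finitely many bounded \<open>T_q\<close> with
  \<open>q W = W\<close>, and on each of these \<open>b\<close> is multiplication by a polynomial.

  Let \<open>N\<close> be \<open>v\<close> times the exponents of these \<open>T_q\<close>. No prime divisor of \<open>N\<close> lies in \<open>P_W\<close>, and
  \<open>T_q\<close> is killed by \<open>N\<close> for every prime divisor \<open>q\<close> of \<open>N\<close>, so \<open>V\<close> is the direct sum of the
  kernel of \<open>N\<close>, which is the sum of the chosen \<open>T_q\<close>, and the image \<open>N V\<close>, on which \<open>v\<close> is invertible and \<open>b\<close> is given
  by \<open>u/v\<close> (\<open>central_decomposition\<close>).

  For the converse, the summands of such a decomposition are respected by all endomorphisms, of \<open>V\<close> as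
  well as of its dual, and multiplication operators on them commute with everything
  (\<open>multiplication_decomposition_endo\<close>).
\<close>

section \<open>Polynomials over a field\<close>

lemma poly_ideal_principal:
  fixes I :: "'a::field poly set"
  assumes zero: "0 \<in> I" and add: "\<And>p q. p \<in> I \<Longrightarrow> q \<in> I \<Longrightarrow> p + q \<in> I"
    and mult: "\<And>p s. p \<in> I \<Longrightarrow> s * p \<in> I"
  shows "\<exists>g\<in>I. \<forall>p\<in>I. g dvd p"
proof (cases "I = {0}")
  case True
  then show ?thesis by auto
next
  case False
  then have "\<exists>g. g \<in> I \<and> g \<noteq> 0" using zero by auto
  then obtain g where g: "g \<in> I" "g \<noteq> 0"
    and min: "\<And>p. p \<in> I \<Longrightarrow> p \<noteq> 0 \<Longrightarrow> degree g \<le> degree p"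
    using ex_has_least_nat[of "\<lambda>g. g \<in> I \<and> g \<noteq> 0" _ degree] by blast
  have "g dvd p" if "p \<in> I" for p
  proof -
    have "p mod g = p + (- (p div g)) * g"
      by (simp add: minus_div_mult_eq_mod[symmetric])
    then have "p mod g \<in> I"
      using add[OF that mult[OF g(1), of "- (p div g)"]] by simp
    then show ?thesis
      using min degree_mod_less[OF g(2)] by (metis dvd_eq_mod_eq_0 not_less)
  qed
  then show ?thesis using g by blast
qed

lemma poly_bezout_gcd:
  fixes p n :: "'a::field poly"
  shows "\<exists>g x y. g = x * p + y * n \<and> g dvd p \<and> g dvd n"
proof -
  let ?I = "{x * p + y * n | x y. True}"
  have "\<exists>g\<in>?I. \<forall>p\<in>?I. g dvd p"
  proof (rule poly_ideal_principal)
    show "0 \<in> ?I" by (metis (mono_tags, lifting) CollectI add_0 mult_zero_left)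
    show "a + b \<in> ?I" if "a \<in> ?I" "b \<in> ?I" for a b
    proof -
      obtain x y x' y' where "a = x * p + y * n" "b = x' * p + y' * n" using \<open>a \<in> ?I\<close> \<open>b \<in> ?I\<close> by auto
      then have "a + b = (x + x') * p + (y + y') * n" by (simp add: algebra_simps)
      then show ?thesis by blast
    qed
    show "s * a \<in> ?I" if "a \<in> ?I" for a s
    proof -
      obtain x y where "a = x * p + y * n" using \<open>a \<in> ?I\<close> by auto
      then have "s * a = (s * x) * p + (s * y) * n" by (simp add: algebra_simps)
      then show ?thesis by blast
    qed
  qed
  then obtain g where g: "g \<in> ?I" "\<forall>p\<in>?I. g dvd p" by blast
  have "p = 1 * p + 0 * n" "n = 0 * p + 1 * n" by simp_all
  then have "p \<in> ?I" "n \<in> ?I" by blast+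
  then show ?thesis using g by blast
qed

lemma poly_coprime_bezout:
  fixes p n :: "'a::field poly"
  assumes "coprime p n"
  shows "\<exists>x y. x * p + y * n = 1"
proof -
  obtain g x y where g: "g = x * p + y * n" "g dvd p" "g dvd n" using poly_bezout_gcd by metis
  then have "is_unit g" using assms by (metis coprime_common_divisor)
  then obtain c where "c * g = 1" by (metis dvdE mult.commute)
  then have "(c * x) * p + (c * y) * n = 1" using g(1) by (simp add: algebra_simps)
  then show ?thesis by blast
qed

lemma poly_reduce_fraction:
  fixes u v :: "'a::field poly"
  assumes "v \<noteq> 0"
  shows "\<exists>k u' v'. u = k * u' \<and> v = k * v' \<and> coprime u' v' \<and> k \<noteq> 0 \<and> v' \<noteq> 0"
proof -
  obtain g x y where g: "g = x * u + y * v" "g dvd u" "g dvd v" using poly_bezout_gcd by metis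
  then obtain u' v' where uv: "u = g * u'" "v = g * v'" by (metis dvdE)
  have g0: "g \<noteq> 0" "v' \<noteq> 0" using uv assms by auto
  have "g * (x * u' + y * v') = g * 1" using g(1) uv by (simp add: algebra_simps)
  then have "x * u' + y * v' = 1" using g0 by (metis mult_left_cancel)
  then have "coprime u' v'" by (metis coprimeI dvd_add dvd_mult)
  then show ?thesis using uv g0 by blast
qed

text \<open>
  Passes to powers of \<open>q\<close> by multiplying the identity for \<open>q\<close> with the one for \<open>q ^ m\<close>.
\<close>

lemma irreducible_bezout_power:
  fixes q p :: "'a::field poly"
  assumes "irreducible q" "\<not> q dvd p"
  shows "\<exists>x y. x * p + y * q ^ m = 1"
proof (induction m)
  case 0
  show ?case by (intro exI[of _ 0] exI[of _ 1]) simp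
next
  case (Suc m)
  obtain g x y where g: "g = x * p + y * q" "g dvd p" "g dvd q" using poly_bezout_gcd by metis
  obtain c where c: "q = g * c" using g by (metis dvdE)
  then have "is_unit g \<or> is_unit c" using assms(1) irreducibleD by blast
  then have "is_unit g"
  proof
    assume "is_unit c"
    then have "q dvd g" using c by (metis dvd_refl mult_unit_dvd_iff)
    then show ?thesis using assms(2) g(2) dvd_trans by blast
  qed
  then obtain e where "e * g = 1" by (metis dvdE mult.commute)
  then have 1: "(e * x) * p + (e * y) * q = 1" using g(1) by (simp add: algebra_simps)
  obtain x' y' where 2: "x' * p + y' * q ^ m = 1" using Suc by blast
  have "1 = ((e * x) * p + (e * y) * q) * (x' * p + y' * q ^ m)" using 1 2 by simp
  also have "\<dots> = (e * x * (x' * p + y' * q ^ m) + e * y * q * x') * p + (e * y * y') * q ^ Suc m"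
    by (simp add: algebra_simps)
  finally show ?case by metis
qed

lemma irreducible_power_dvd_cancel:
  fixes q p :: "'a::field poly"
  assumes "irreducible q" "\<not> q dvd p" "q ^ i dvd p * a"
  shows "q ^ i dvd a"
proof -
  obtain x y where "x * p + y * q ^ i = 1" using irreducible_bezout_power[OF assms(1,2)] by blast
  then have "a = x * (p * a) + y * a * q ^ i"
    by (metis (no_types, opaque_lifting) distrib_right mult.assoc mult.commute mult_1)
  then show ?thesis using assms(3) by (metis dvd_add dvd_mult dvd_triv_right)
qed

lemma irreducible_dvd_mult_iff_poly:
  fixes q a b :: "'a::field poly"
  assumes "irreducible q"
  shows "q dvd a * b \<longleftrightarrow> q dvd a \<or> q dvd b"
  using irreducible_power_dvd_cancel[OF assms, of a 1 b] by (metis dvd_mult dvd_mult2 power_one_right)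

lemma irreducible_dvd_power_poly:
  fixes q a :: "'a::field poly"
  assumes "irreducible q" "q dvd a ^ n"
  shows "q dvd a"
  using assms(2)
proof (induction n)
  case 0
  then show ?case using assms(1) by (simp add: irreducible_def)
next
  case (Suc n)
  then show ?case by (simp add: irreducible_dvd_mult_iff_poly[OF assms(1)]) blast
qed

lemma poly_split_power:
  fixes q p :: "'a::field poly"
  assumes "irreducible q" "p \<noteq> 0"
  shows "\<exists>k p'. p = q ^ k * p' \<and> \<not> q dvd p'"
  using assms(2)
proof (induction "degree p" arbitrary: p rule: less_induct)
  case less
  show ?case
  proof (cases "q dvd p")
    case False
    then show ?thesis by (intro exI[of _ 0] exI[of _ p]) simp
  next
    case True
    then obtain s where s: "p = q * s" by (metis dvdE)
    have "q \<noteq> 0" "\<not> is_unit q" using assms(1) by (auto simp: irreducible_def)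
    then have "degree q > 0" by (simp add: is_unit_iff_degree)
    moreover have "s \<noteq> 0" using s less.prems by auto
    ultimately have "degree s < degree p" using s \<open>q \<noteq> 0\<close> by (simp add: degree_mult_eq)
    then obtain k p' where "s = q ^ k * p'" "\<not> q dvd p'" using less.hyps[of s] \<open>s \<noteq> 0\<close> by blast
    then show ?thesis using s by (intro exI[of _ "Suc k"] exI[of _ p']) simp
  qed
qed

lemma prime_poly_irreducible: "prime_poly q \<Longrightarrow> irreducible q"
  and prime_poly_nonzero: "prime_poly q \<Longrightarrow> q \<noteq> 0"
  by (auto simp: prime_poly_def)

lemma prime_poly_degree_pos: "prime_poly q \<Longrightarrow> degree q > 0"
  using prime_poly_nonzero[of q] irreducible_not_unit[OF prime_poly_irreducible, of q]
  by (simp add: is_unit_iff_degree)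

lemma prime_poly_dvd_imp_eq:
  assumes "prime_poly p" "prime_poly q" "p dvd q"
  shows "p = q"
proof -
  obtain c where c: "q = p * c" using assms(3) by (metis dvdE)
  have "is_unit c"
    using irreducibleD[OF prime_poly_irreducible[OF assms(2)] c]
      irreducible_not_unit[OF prime_poly_irreducible[OF assms(1)]] by blast
  then obtain a where a: "c = [:a:]" by (auto simp: is_unit_poly_iff)
  have "lead_coeff q = lead_coeff p * a" unfolding c a lead_coeff_mult by simp
  moreover have "lead_coeff q = 1" "lead_coeff p = 1" using assms(1,2) unfolding prime_poly_def by blast+
  ultimately have "a = 1" by (metis mult_1)
  then have "c = 1" using a by (simp add: one_pCons)
  then show ?thesis using c by (metis mult_1_right)
qed

lemma exists_prime_poly_dvd:
  fixes p :: "'a::field poly"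
  assumes "p \<noteq> 0" "\<not> is_unit p"
  shows "\<exists>q. prime_poly q \<and> q dvd p"
  using assms
proof (induction "degree p" arbitrary: p rule: less_induct)
  case less
  show ?case
  proof (cases "irreducible p")
    case True
    define e where "e = [:inverse (lead_coeff p):]"
    have e: "is_unit e" using less.prems(1) by (simp add: e_def is_unit_iff_degree)
    have "irreducible (e * p)"
      using True e by (simp add: irreducible_mult_unit_left)
    moreover have "lead_coeff (e * p) = 1"
      using less.prems(1) by (simp add: e_def)
    moreover have "e * p dvd p" using e by simp
    ultimately show ?thesis by (auto simp: prime_poly_def)
  next
    case False
    then obtain a b where ab: "p = a * b" "\<not> is_unit a" "\<not> is_unit b"
      using less.prems by (auto simp: irreducible_def)
    then have nz: "a \<noteq> 0" "b \<noteq> 0" using less.prems by auto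
    then have "degree b > 0" using ab(3) by (simp add: is_unit_iff_degree)
    then have "degree a < degree p" using ab(1) nz by (simp add: degree_mult_eq)
    then show ?thesis using less.hyps[of a] ab nz by (meson dvd_mult2)
  qed
qed

lemma poly_prime_induct [consumes 1, case_names unit mult]:
  fixes p :: "'a::field poly"
  assumes "p \<noteq> 0"
    and "\<And>p. is_unit p \<Longrightarrow> P p"
    and "\<And>q p. prime_poly q \<Longrightarrow> p \<noteq> 0 \<Longrightarrow> P p \<Longrightarrow> P (q * p)"
  shows "P p"
  using assms(1)
proof (induction "degree p" arbitrary: p rule: less_induct)
  case less
  show ?case
  proof (cases "is_unit p")
    case False
    then obtain q s where q: "prime_poly q" "p = q * s"
      using exists_prime_poly_dvd[OF less.prems] by (metis dvdE)
    have "s \<noteq> 0" using q less.prems by auto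
    then have "degree s < degree p"
      using q prime_poly_degree_pos[OF q(1)] prime_poly_nonzero[OF q(1)] by (simp add: degree_mult_eq)
    then show ?thesis using less.hyps \<open>s \<noteq> 0\<close> q assms(3) by blast
  qed (rule assms(2))
qed

lemma finite_prime_poly_divisors:
  fixes p :: "'a::field poly"
  assumes "p \<noteq> 0"
  shows "finite {q. prime_poly q \<and> q dvd p}"
  using assms
proof (induction p rule: poly_prime_induct)
  case (unit p)
  have "\<not> q dvd p" if "prime_poly q" for q
    using dvd_unit_imp_unit[OF _ unit] irreducible_not_unit[OF prime_poly_irreducible[OF that]] by blast
  then have no_divisor: "{q. prime_poly q \<and> q dvd p} = {}" by blast
  show ?case unfolding no_divisor by simp
next
  case (mult q p)
  have "r = q \<or> r dvd p" if "prime_poly r" "r dvd q * p" for r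
    using that irreducible_dvd_mult_iff_poly[OF prime_poly_irreducible[OF that(1)], of q p]
      prime_poly_dvd_imp_eq[OF that(1) mult(1)] by blast
  then have "{r. prime_poly r \<and> r dvd q * p} \<subseteq> insert q {r. prime_poly r \<and> r dvd p}"
    by blast
  then show ?case using mult finite_subset by blast
qed

text \<open>
  The power of \<open>N\<close> absorbs the primes that \<open>p\<close> shares with \<open>N\<close>, and \<open>p'\<close> is the product of the
  remaining ones.
\<close>

lemma poly_split_coprime:
  fixes p N :: "'a::field poly"
  assumes "p \<noteq> 0"
  shows "\<exists>k p' s t. p dvd N ^ k * p' \<and> s * p' + t * N = 1"
  using assms
proof (induction p rule: poly_prime_induct)
  case (unit p)
  then have "p dvd N ^ 0 * 1 \<and> 1 * 1 + 0 * N = 1" by simp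
  then show ?case by blast
next
  case (mult q p)
  then obtain k p' s t where IH: "p dvd N ^ k * p'" "s * p' + t * N = 1" by blast
  show ?case
  proof (cases "q dvd N")
    case True
    have "q * p dvd N ^ Suc k * p'" using mult_dvd_mono[OF True IH(1)] by (simp add: mult.assoc)
    then show ?thesis using IH(2) by blast
  next
    case False
    obtain a b where ab: "a * N + b * q ^ 1 = 1"
      using irreducible_bezout_power[OF prime_poly_irreducible[OF mult.hyps(1)] False] by blast
    have "(s * p' + t * N) * (a * N + b * q ^ 1) = 1" using ab IH(2) by simp
    then have "(s * b) * (q * p') + (s * p' * a + t * (a * N + b * q)) * N = 1"
      by (simp add: algebra_simps)
    moreover have "q * p dvd N ^ k * (q * p')" using mult_dvd_mono[OF dvd_refl IH(1), of q] by (simp add: mult_ac)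
    ultimately show ?thesis by blast
  qed
qed

text \<open>
  Finds orders of elements and functionals and exponents of primary parts, with \<open>P k\<close> saying that
  the power \<open>k\<close> of a prime does not yet annihilate.
\<close>

lemma exists_exact_power:
  assumes P: "P 0" and "\<not> P m"
  shows "\<exists>k. P k \<and> \<not> P (Suc k) \<and> k < (m::nat)"
proof -
  define l where "l = (LEAST l. \<not> P l)"
  have l: "\<not> P l" "l \<le> m" unfolding l_def using assms(2) by (rule LeastI, rule Least_le)
  have below: "P j" if "j < l" for j using not_less_Least that unfolding l_def by blast
  obtain k where k: "l = Suc k" using l(1) P by (cases l) auto
  show ?thesis using l below[of k] k by (intro exI[of _ k]) simp
qed

section \<open>Extending partial homomorphisms\<close>

text \<open>
  The dual of \<open>V\<close> is a proper subset of a function type, so the modules among which the extension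
  problem is solved live on a carrier set.
\<close>

locale carrier_module =
  fixes M :: "'m::ab_group_add set" and act :: "'r::comm_ring_1 \<Rightarrow> 'm \<Rightarrow> 'm"
  assumes zero_mem: "0 \<in> M"
    and add_mem: "x \<in> M \<Longrightarrow> y \<in> M \<Longrightarrow> x + y \<in> M"
    and act_mem: "x \<in> M \<Longrightarrow> act p x \<in> M"
    and act_add: "x \<in> M \<Longrightarrow> y \<in> M \<Longrightarrow> act p (x + y) = act p x + act p y"
    and act_plus: "x \<in> M \<Longrightarrow> act (p + q) x = act p x + act q x"
    and act_mult: "x \<in> M \<Longrightarrow> act (p * q) x = act p (act q x)"
    and act_one: "x \<in> M \<Longrightarrow> act 1 x = x"
begin

lemma act_zero: "x \<in> M \<Longrightarrow> act 0 x = 0"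
  using act_plus[of x 0 0] by simp

lemma act_zero_right: "act p 0 = 0"
  using act_add[of 0 0 p] zero_mem by simp

lemma act_minus: "x \<in> M \<Longrightarrow> act (- p) x = - act p x"
  using act_plus[of x p "- p"] act_zero[of x] by (simp add: eq_neg_iff_add_eq_0 add.commute)

lemma act_minus_one: "x \<in> M \<Longrightarrow> act (- 1) x = - x"
  by (simp add: act_minus act_one)

end

locale carrier_module_pair =
  dom: carrier_module M actM + cod: carrier_module D actD
  for M :: "'m::ab_group_add set" and actM :: "'a::field poly \<Rightarrow> 'm \<Rightarrow> 'm"
    and D :: "'d::ab_group_add set" and actD :: "'a poly \<Rightarrow> 'd \<Rightarrow> 'd"
begin

text \<open>
  Homomorphisms defined on submodules are represented by their graphs: submodules of the product
  that are single-valued at \<open>0\<close>. Extension is then inclusion, and a chain of partial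
  homomorphisms is glued by taking its union.
\<close>

definition partial_hom :: "('m \<times> 'd) set \<Rightarrow> bool" where
  "partial_hom G \<longleftrightarrow>
     G \<subseteq> M \<times> D \<and> (0, 0) \<in> G \<and>
     (\<forall>x d y e. (x, d) \<in> G \<longrightarrow> (y, e) \<in> G \<longrightarrow> (x + y, d + e) \<in> G) \<and>
     (\<forall>p x d. (x, d) \<in> G \<longrightarrow> (actM p x, actD p d) \<in> G) \<and>
     (\<forall>d. (0, d) \<in> G \<longrightarrow> d = 0)"

lemma partial_hom_unique:
  assumes "partial_hom G" "(x, d) \<in> G" "(x, e) \<in> G"
  shows "d = e"
proof -
  have mem: "x \<in> M" "d \<in> D" "e \<in> D" using assms unfolding partial_hom_def by auto
  have "(actM (- 1) x, actD (- 1) e) \<in> G" using assms unfolding partial_hom_def by blast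
  then have "(- x, - e) \<in> G" using mem by (simp add: dom.act_minus_one cod.act_minus_one)
  then have "(x + - x, d + - e) \<in> G" using assms(1,2) unfolding partial_hom_def by blast
  then have "(0, d - e) \<in> G" by simp
  then show ?thesis using assms(1) unfolding partial_hom_def by auto
qed

lemma partial_hom_union_chain:
  assumes chain: "subset.chain {H. partial_hom H \<and> G \<subseteq> H} C" and "C \<noteq> {}"
  shows "partial_hom (\<Union>C)"
proof -
  have each: "partial_hom H" if "H \<in> C" for H
    using chain that unfolding subset.chain_def by auto
  have common: "\<exists>H\<in>C. a \<in> H \<and> b \<in> H" if ab: "a \<in> \<Union>C" "b \<in> \<Union>C" for a b
  proof -
    obtain H H' where "H \<in> C" "H' \<in> C" "a \<in> H" "b \<in> H'" using ab by blast
    moreover have "H \<subseteq> H' \<or> H' \<subseteq> H" using chain \<open>H \<in> C\<close> \<open>H' \<in> C\<close> by (auto simp: subset_chain_def)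
    ultimately show ?thesis by blast
  qed
  show ?thesis
    unfolding partial_hom_def
  proof (intro conjI allI impI)
    show "\<Union>C \<subseteq> M \<times> D" using each unfolding partial_hom_def by blast
    show "(0, 0) \<in> \<Union>C" using each \<open>C \<noteq> {}\<close> unfolding partial_hom_def by blast
    show "(x + y, d + e) \<in> \<Union>C" if "(x, d) \<in> \<Union>C" "(y, e) \<in> \<Union>C" for x d y e
      using common[OF that] each unfolding partial_hom_def by blast
    show "(actM p x, actD p d) \<in> \<Union>C" if "(x, d) \<in> \<Union>C" for p x d
      using that each unfolding partial_hom_def by blast
    show "d = 0" if "(0, d) \<in> \<Union>C" for d
      using that each unfolding partial_hom_def by blast
  qed
qed

text \<open>
  The polynomials that send \<open>x\<close> into the domain of \<open>H\<close> form an ideal. Over a principal ideal domain,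
  one equation, for the generator of this ideal, therefore decides whether \<open>H\<close> can be extended to \<open>x\<close>.
\<close>

lemma partial_hom_extend_step:
  assumes H: "partial_hom H" and x: "x \<in> M"
    and solvable: "\<And>p e. (actM p x, e) \<in> H \<Longrightarrow> \<exists>d\<in>D. actD p d = e"
  shows "\<exists>d H'. partial_hom H' \<and> H \<subseteq> H' \<and> (x, d) \<in> H'"
proof -
  have memH: "a \<in> M" "b \<in> D" if "(a, b) \<in> H" for a b
    using H that unfolding partial_hom_def by auto
  have addH: "(a + a', b + b') \<in> H" if "(a, b) \<in> H" "(a', b') \<in> H" for a a' b b'
    using H that unfolding partial_hom_def by blast
  have actH: "(actM p a, actD p b) \<in> H" if "(a, b) \<in> H" for p a b
    using H that unfolding partial_hom_def by blast
  have zeroH: "(0, 0) \<in> H" using H unfolding partial_hom_def by blast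
  let ?I = "{p. \<exists>e. (actM p x, e) \<in> H}"
  have "\<exists>g\<in>?I. \<forall>p\<in>?I. g dvd p"
  proof (rule poly_ideal_principal)
    show "0 \<in> ?I" using zeroH x by (auto simp: dom.act_zero)
    show "p + q \<in> ?I" if pq: "p \<in> ?I" "q \<in> ?I" for p q
    proof -
      obtain d e where "(actM p x, d) \<in> H" "(actM q x, e) \<in> H" using pq by blast
      then show ?thesis using addH[of "actM p x" d "actM q x" e] x by (auto simp: dom.act_plus)
    qed
    show "s * p \<in> ?I" if p: "p \<in> ?I" for p s
    proof -
      obtain d where "(actM p x, d) \<in> H" using p by blast
      then show ?thesis using actH[of "actM p x" d s] x by (auto simp: dom.act_mult)
    qed
  qed
  then obtain p0 e0 where e0: "(actM p0 x, e0) \<in> H"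
    and gen: "\<And>p e. (actM p x, e) \<in> H \<Longrightarrow> p0 dvd p" by blast
  obtain d where d: "d \<in> D" "actD p0 d = e0" using solvable[OF e0] by blast
  have compat: "e = actD p d" if pe: "(actM p x, e) \<in> H" for p e
  proof -
    obtain c where c: "p = c * p0" using gen[OF pe] by (metis dvdE mult.commute)
    have "(actM p x, actD p d) \<in> H" using actH[OF e0, of c] c x d by (simp add: dom.act_mult cod.act_mult)
    then show ?thesis using partial_hom_unique[OF H pe] by blast
  qed
  define H' where "H' = {(y + actM p x, e + actD p d) | y e p. (y, e) \<in> H}"
  have "partial_hom H'"
    unfolding partial_hom_def
  proof (intro conjI allI impI)
    show "H' \<subseteq> M \<times> D" using memH x d unfolding H'_def
      by (auto intro: dom.add_mem cod.add_mem dom.act_mem cod.act_mem)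
    have "(0, 0) = (0 + actM 0 x, 0 + actD 0 d)" using x d by (simp add: dom.act_zero cod.act_zero)
    then show "(0, 0) \<in> H'" using zeroH unfolding H'_def by blast
    show "(a + a', b + b') \<in> H'" if ab: "(a, b) \<in> H'" "(a', b') \<in> H'" for a b a' b'
    proof -
      obtain y e p where 1: "(y, e) \<in> H" "a = y + actM p x" "b = e + actD p d" using ab(1) unfolding H'_def by auto
      obtain y' e' p' where 2: "(y', e') \<in> H" "a' = y' + actM p' x" "b' = e' + actD p' d" using ab(2) unfolding H'_def by auto
      have "(a + a', b + b') = ((y + y') + actM (p + p') x, (e + e') + actD (p + p') d)"
        using 1 2 x d by (simp add: dom.act_plus cod.act_plus algebra_simps)
      then show ?thesis using addH[OF 1(1) 2(1)] unfolding H'_def by blast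
    qed
    show "(actM s a, actD s b) \<in> H'" if ab: "(a, b) \<in> H'" for s a b
    proof -
      obtain y e p where 1: "(y, e) \<in> H" "a = y + actM p x" "b = e + actD p d" using ab unfolding H'_def by auto
      have "(actM s a, actD s b) = (actM s y + actM (s * p) x, actD s e + actD (s * p) d)"
        using 1 x d memH[OF 1(1)]
        by (simp add: dom.act_mult cod.act_mult dom.act_add cod.act_add dom.act_mem cod.act_mem)
      then show ?thesis using actH[OF 1(1)] unfolding H'_def by blast
    qed
    show "b = 0" if ab: "(0, b) \<in> H'" for b
    proof -
      obtain y e p where 1: "(y, e) \<in> H" "y + actM p x = 0" "b = e + actD p d" using ab unfolding H'_def by auto
      have "actM p x = - y" using 1(2) by (simp add: eq_neg_iff_add_eq_0 add.commute)
      moreover have "(- y, - e) \<in> H"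
        using actH[OF 1(1), of "- 1"] memH[OF 1(1)] by (simp add: dom.act_minus_one cod.act_minus_one)
      ultimately have "- e = actD p d" using compat by simp
      then show ?thesis using 1(3) by (metis add.right_inverse)
    qed
  qed
  moreover have "H \<subseteq> H'"
  proof
    fix a assume "a \<in> H"
    then obtain y e where a: "a = (y, e)" "(y, e) \<in> H" by (cases a) auto
    have "a = (y + actM 0 x, e + actD 0 d)" using a x d by (simp add: dom.act_zero cod.act_zero)
    then show "a \<in> H'" using a(2) unfolding H'_def by blast
  qed
  moreover have "(x, d) \<in> H'"
  proof -
    have "(x, d) = (0 + actM 1 x, 0 + actD 1 d)" using x d by (simp add: dom.act_one cod.act_one)
    then show ?thesis using zeroH unfolding H'_def by blast
  qed
  ultimately show ?thesis by blast
qed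

text \<open>
  A form of Baer's criterion, proved with Zorn's lemma. An equation \<open>p d = e\<close> has to be solvable in
  \<open>D\<close> only if \<open>e\<close> is killed by every \<open>s\<close> for which \<open>G\<close> is zero on \<open>s p M\<close>, as this necessary
  condition holds for all equations that arise. If \<open>D\<close> is divisible, the condition is harmless, and
  the lemma says that \<open>D\<close> is injective. If \<open>n \<noteq> 0\<close> and \<open>G\<close> vanishes on \<open>n M\<close>, the lemma
  also covers \<open>D = R/n\<close>, which is injective over itself but, unless zero, not over \<open>R\<close>.
\<close>

lemma partial_hom_extends:
  assumes G: "partial_hom G"
    and solvable: "\<And>p e. e \<in> D \<Longrightarrow>
          (\<And>s. (\<And>x. x \<in> M \<Longrightarrow> (actM (s * p) x, 0) \<in> G) \<Longrightarrow> actD s e = 0) \<Longrightarrow>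
          \<exists>d\<in>D. actD p d = e"
  shows "\<exists>g. (\<forall>x\<in>M. g x \<in> D) \<and> (\<forall>x\<in>M. \<forall>y\<in>M. g (x + y) = g x + g y) \<and>
             (\<forall>x\<in>M. \<forall>p. g (actM p x) = actD p (g x)) \<and> (\<forall>(x, d)\<in>G. g x = d)"
proof -
  let ?A = "{H. partial_hom H \<and> G \<subseteq> H}"
  have "\<exists>H\<in>?A. \<forall>X\<in>?A. H \<subseteq> X \<longrightarrow> X = H"
  proof (rule subset_Zorn_nonempty)
    have "G \<in> ?A" using G by simp
    then show "?A \<noteq> {}" by (metis empty_iff)
    fix C assume C: "C \<noteq> {}" "subset.chain ?A C"
    then obtain X where "X \<in> C" by blast
    then have "G \<subseteq> X" using C(2) unfolding subset.chain_def by auto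
    then have "G \<subseteq> \<Union>C" using \<open>X \<in> C\<close> by blast
    then show "\<Union>C \<in> ?A" using partial_hom_union_chain[OF C(2,1)] by simp
  qed
  then obtain H where "H \<in> ?A" and maximal: "\<forall>X\<in>?A. H \<subseteq> X \<longrightarrow> X = H" by (rule bexE)
  then have H: "partial_hom H" and GH: "G \<subseteq> H" by simp_all
  have max: "X = H" if "partial_hom X" "H \<subseteq> X" for X
    using maximal that GH by (metis (mono_tags) CollectI order_trans)
  have memH: "x \<in> M" "d \<in> D" if "(x, d) \<in> H" for x d
    using H that unfolding partial_hom_def by auto
  have addH: "(x + y, d + e) \<in> H" if "(x, d) \<in> H" "(y, e) \<in> H" for x y d e
    using H that unfolding partial_hom_def by blast
  have actH: "(actM p x, actD p d) \<in> H" if "(x, d) \<in> H" for p x d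
    using H that unfolding partial_hom_def by blast
  have total: "\<exists>d. (x, d) \<in> H" if x: "x \<in> M" for x
  proof -
    have "\<exists>d\<in>D. actD p d = e" if pe: "(actM p x, e) \<in> H" for p e
    proof (rule solvable)
      show "e \<in> D" using memH(2)[OF pe] .
      fix s assume s: "\<And>x. x \<in> M \<Longrightarrow> (actM (s * p) x, 0) \<in> G"
      have "(actM (s * p) x, actD s e) \<in> H"
        using actH[OF pe, of s] x by (simp add: dom.act_mult)
      moreover have "(actM (s * p) x, 0) \<in> H" using s[OF x] GH by blast
      ultimately show "actD s e = 0" by (rule partial_hom_unique[OF H])
    qed
    from partial_hom_extend_step[OF H x this]
    obtain d H' where "partial_hom H'" "H \<subseteq> H'" "(x, d) \<in> H'" by blast
    then show ?thesis using max[of H'] by blast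
  qed
  define g where "g x = (SOME d. (x, d) \<in> H)" for x
  have gH: "(x, g x) \<in> H" if "x \<in> M" for x
    unfolding g_def using total[OF that] by (rule someI_ex)
  have g_eq: "g x = d" if "(x, d) \<in> H" for x d
    using partial_hom_unique[OF H gH[OF memH(1)[OF that]] that] .
  show ?thesis
  proof (intro exI[of _ g] conjI ballI allI)
    show "g x \<in> D" if "x \<in> M" for x using memH(2)[OF gH[OF that]] .
    show "g (x + y) = g x + g y" if "x \<in> M" "y \<in> M" for x y
      by (rule g_eq[OF addH[OF gH[OF that(1)] gH[OF that(2)]]])
    show "g (actM p x) = actD p (g x)" if "x \<in> M" for x p
      by (rule g_eq[OF actH[OF gH[OF that]]])
    show "case z of (x, d) \<Rightarrow> g x = d" if "z \<in> G" for z
      using that g_eq GH by auto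
  qed
qed

end

lemma carrier_module_residues:
  fixes n :: "'a::field poly"
  shows "carrier_module {d. d mod n = d} (\<lambda>p d. (p * d) mod n)"
  by standard (simp_all add: poly_mod_add_left distrib_left distrib_right mod_mult_right_eq mult.assoc)

section \<open>A functional on polynomials with zero annihilator\<close>

definition power_of_two_functional :: "'a::field poly \<Rightarrow> 'a" where
  "power_of_two_functional p = (\<Sum>i\<le>degree p. if \<exists>k. i = 2 ^ k then coeff p i else 0)"

lemma power_of_two_functional_bound:
  assumes "degree p \<le> N"
  shows "power_of_two_functional p = (\<Sum>i\<le>N. if \<exists>k. i = 2 ^ k then coeff p i else 0)"
  unfolding power_of_two_functional_def
  using assms by (intro sum.mono_neutral_left) (auto simp: coeff_eq_0)

lemma power_of_two_functional_add:
  "power_of_two_functional (p + q) = power_of_two_functional p + power_of_two_functional q"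
proof -
  let ?N = "max (degree p) (degree q)"
  have "degree (p + q) \<le> ?N" by (rule degree_add_le_max)
  then show ?thesis
    by (simp add: power_of_two_functional_bound[where N = ?N] flip: sum.distrib)
      (intro sum.cong, auto)
qed

lemma power_of_two_functional_smult:
  "power_of_two_functional (smult a p) = a * power_of_two_functional p"
  by (simp add: power_of_two_functional_bound[OF degree_smult_le] power_of_two_functional_def
      sum_distrib_left if_distrib cong: if_cong)

text \<open>
  The gaps between powers of two grow without bound. Hence \<open>p\<close> can be shifted so that its leading
  coefficient sits at a power of two while its other coefficients lie strictly between this power and
  the preceding one.
\<close>

lemma power_of_two_functional_nonzero_multiple:
  assumes "p \<noteq> 0"
  shows "\<exists>s. power_of_two_functional (s * p) \<noteq> 0"
proof -
  define d where "d = degree p"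
  define k where "k = Suc d"
  have dk: "d < 2 ^ d" by (rule less_exp)
  define j where "j = 2 ^ k - d"
  have j: "j + d = 2 ^ k" "2 ^ d < j" using dk unfolding j_def k_def power_Suc by linarith+
  let ?p = "monom 1 j * p"
  have "degree ?p = j + d" using assms by (simp add: degree_mult_eq degree_monom_eq d_def monom_eq_0_iff)
  then have "power_of_two_functional ?p =
      (\<Sum>i\<le>j + d. if \<exists>l. i = 2 ^ l then coeff ?p i else 0)"
    by (simp add: power_of_two_functional_def)
  also have "\<dots> = (\<Sum>i\<le>j + d. if i = j + d then coeff ?p i else 0)"
  proof (rule sum.cong[OF refl])
    fix i assume "i \<in> {..j + d}"
    then have i: "i \<le> j + d" by simp
    show "(if \<exists>l. i = 2 ^ l then coeff ?p i else 0) = (if i = j + d then coeff ?p i else 0)"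
    proof (cases "i < j")
      case True
      then show ?thesis by (auto simp: coeff_monom_mult)
    next
      case False
      have only: "i = j + d" if "i = 2 ^ l" for l
      proof -
        have "(2::nat) ^ d < 2 ^ l" using j(2) False that by linarith
        then have "k \<le> l" by (simp add: k_def)
        then have "(2::nat) ^ k \<le> 2 ^ l" by simp
        then show ?thesis using j(1) i that by linarith
      qed
      have "(\<exists>l. i = 2 ^ l) \<longleftrightarrow> i = j + d" using only j(1) by blast
      then show ?thesis by (simp only:)
    qed
  qed
  also have "\<dots> = coeff ?p (j + d)" by simp
  also have "\<dots> = lead_coeff p" by (simp add: coeff_monom_mult d_def)
  finally show ?thesis using assms by (metis leading_coeff_0_iff)
qed

section \<open>Linear functionals on the module\<close>

locale poly_module = module scale
  for scale :: "'a::field poly \<Rightarrow> 'v::ab_group_add \<Rightarrow> 'v" (infixr \<open>*s\<close> 75)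
begin

abbreviation dual_act :: "'a poly \<Rightarrow> ('v \<Rightarrow> 'a) \<Rightarrow> ('v \<Rightarrow> 'a)" (infixr \<open>\<odot>\<close> 75) where
  "p \<odot> \<rho> \<equiv> dual_scale scale \<rho> p"

lemma dual_act_apply [simp]: "(p \<odot> \<rho>) x = \<rho> (p *s x)"
  by (simp add: dual_scale_def)

lemma const_scale_add: "[:a + b:] *s x = [:a:] *s x + [:b:] *s x"
  by (simp flip: scale_left_distrib)

lemma const_scale_one: "[:1:] *s x = x"
  by (simp flip: one_pCons)

lemma vector_space_field_scale: "vector_space (field_scale scale)"
  by unfold_locales
    (simp_all add: field_scale_def scale_right_distrib const_scale_add const_scale_one mult.commute)

lemma vector_space_field: "vector_space ((*) :: 'a \<Rightarrow> 'a \<Rightarrow> 'a)"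
  by unfold_locales (simp_all add: algebra_simps)

lemma vector_space_pair_field: "vector_space_pair (field_scale scale) ((*) :: 'a \<Rightarrow> 'a \<Rightarrow> 'a)"
  using vector_space_field_scale vector_space_field by (simp add: vector_space_pair_def)

lemma mem_dual_iff:
  "\<rho> \<in> dual scale \<longleftrightarrow>
     (\<forall>x y. \<rho> (x + y) = \<rho> x + \<rho> y) \<and> (\<forall>a x. \<rho> ([:a:] *s x) = a * \<rho> x)"
  using vector_space_field_scale vector_space_field
  by (simp add: dual_def Vector_Spaces.linear_iff field_scale_def)

lemma linear_operator_iff:
  "linear_operator scale c \<longleftrightarrow>
     (\<forall>x y. c (x + y) = c x + c y) \<and> (\<forall>a x. c ([:a:] *s x) = [:a:] *s c x)"
  using vector_space_field_scale
  by (simp add: linear_operator_def Vector_Spaces.linear_iff field_scale_def)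

context
  fixes \<rho> assumes \<rho>: "\<rho> \<in> dual scale"
begin

lemma dual_add: "\<rho> (x + y) = \<rho> x + \<rho> y" and dual_scalar: "\<rho> ([:a:] *s x) = a * \<rho> x"
  using \<rho> by (auto simp: mem_dual_iff)

lemma dual_zero [simp]: "\<rho> 0 = 0"
  using dual_scalar[of 0 0] by simp

lemma dual_minus: "\<rho> (- x) = - \<rho> x"
  using dual_add[of x "- x"] by (simp add: eq_neg_iff_add_eq_0 add.commute)

lemma dual_diff: "\<rho> (x - y) = \<rho> x - \<rho> y"
  using dual_add[of x "- y"] dual_minus[of y] by simp

lemma dual_sum: "\<rho> (sum f A) = (\<Sum>i\<in>A. \<rho> (f i))"
  by (induction A rule: infinite_finite_induct) (simp_all add: dual_add)

end

lemma carrier_module_dual: "carrier_module (dual scale) dual_act"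
proof
  show "0 \<in> dual scale" by (simp add: mem_dual_iff)
  show "\<rho> + \<sigma> \<in> dual scale" if "\<rho> \<in> dual scale" "\<sigma> \<in> dual scale" for \<rho> \<sigma>
    using that by (simp add: mem_dual_iff algebra_simps)
  show "p \<odot> \<rho> \<in> dual scale" if "\<rho> \<in> dual scale" for \<rho> p
    using that by (simp add: mem_dual_iff scale_right_distrib scale_left_commute[of p] del: scale_scale)
  show "p \<odot> (\<rho> + \<sigma>) = p \<odot> \<rho> + p \<odot> \<sigma>" for p \<rho> \<sigma>
    by (simp add: fun_eq_iff)
  show "(p + q) \<odot> \<rho> = p \<odot> \<rho> + q \<odot> \<rho>" if "\<rho> \<in> dual scale" for \<rho> p q
    using that by (simp add: fun_eq_iff scale_left_distrib mem_dual_iff)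
  show "(p * q) \<odot> \<rho> = p \<odot> (q \<odot> \<rho>)" for p q \<rho>
    by (simp add: fun_eq_iff mult.commute)
  show "1 \<odot> \<rho> = \<rho>" for \<rho>
    by (simp add: fun_eq_iff)
qed

sublocale dual: carrier_module "dual scale" dual_act
  by (rule carrier_module_dual)

lemma dual_diff_mem: "\<rho> \<in> dual scale \<Longrightarrow> \<sigma> \<in> dual scale \<Longrightarrow> \<rho> - \<sigma> \<in> dual scale"
  using dual.add_mem[of \<rho> "- 1 \<odot> \<sigma>"] dual.act_mem[of \<sigma> "- 1"] dual.act_minus_one[of \<sigma>] by simp

text \<open>
  A functional on a subspace is given by its graph \<open>G\<close>. For a functional prescribed on a sum of
  subspaces, this leaves only the check that the prescription is single-valued.
\<close>

lemma functional_extends: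
  assumes zero: "(0, 0) \<in> G"
    and add: "\<And>x d y e. (x, d) \<in> G \<Longrightarrow> (y, e) \<in> G \<Longrightarrow> (x + y, d + e) \<in> G"
    and scalar: "\<And>a x d. (x, d) \<in> G \<Longrightarrow> ([:a:] *s x, a * d) \<in> G"
    and single: "\<And>d. (0, d) \<in> G \<Longrightarrow> d = (0::'a)"
  shows "\<exists>\<rho>\<in>dual scale. \<forall>x d. (x, d) \<in> G \<longrightarrow> \<rho> x = d"
proof -
  interpret vs: vector_space_pair "field_scale scale" "(*) :: 'a \<Rightarrow> 'a \<Rightarrow> 'a"
    by (rule vector_space_pair_field)
  have unique: "d = e" if "(x, d) \<in> G" "(x, e) \<in> G" for x d e
  proof -
    have "([:- 1:] *s x, - 1 * e) \<in> G" by (rule scalar[OF that(2)])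
    then have "(x + [:- 1:] *s x, d + - 1 * e) \<in> G" by (rule add[OF that(1)])
    moreover have "[:- 1:] *s x = - x" using scale_minus_left[of "[:1:]" x] by (simp add: const_scale_one)
    ultimately show ?thesis using single[of "d - e"] by simp
  qed
  let ?U = "fst ` G"
  have mem: "x \<in> ?U" if "(x, d) \<in> G" for x d
    using imageI[OF that, of fst] by simp
  define f where "f x = (SOME d. (x, d) \<in> G)" for x
  have fG: "(x, f x) \<in> G" if x: "x \<in> ?U" for x
  proof -
    obtain d where "(x, d) \<in> G" using x by auto
    then show ?thesis unfolding f_def by (rule someI)
  qed
  have f_eq: "f x = d" if "(x, d) \<in> G" for x d
    by (rule unique[OF fG[OF mem[OF that]] that])
  have "vs.vs1.subspace ?U"
  proof (rule vs.vs1.subspaceI)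
    show "0 \<in> ?U" by (rule mem[OF zero])
    show "x + y \<in> ?U" if "x \<in> ?U" "y \<in> ?U" for x y
      by (rule mem[OF add[OF fG[OF that(1)] fG[OF that(2)]]])
    show "field_scale scale a x \<in> ?U" if "x \<in> ?U" for a x
      unfolding field_scale_def by (rule mem[OF scalar[OF fG[OF that]]])
  qed
  obtain B where B: "B \<subseteq> ?U" "vs.vs1.independent B" "?U \<subseteq> vs.vs1.span B"
    using vs.vs1.maximal_independent_subset[of ?U] by metis
  obtain \<rho> where lin: "Vector_Spaces.linear (field_scale scale) (*) \<rho>" and \<rho>B: "\<forall>x\<in>B. \<rho> x = f x"
    using vs.linear_independent_extend[OF B(2), of f] by metis
  have \<rho>: "\<rho> \<in> dual scale" using lin by (simp add: dual_def)
  let ?S = "{x \<in> ?U. \<rho> x = f x}"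
  have memS: "x \<in> ?S" if "(x, d) \<in> G" "\<rho> x = d" for x d
    using mem[OF that(1)] f_eq[OF that(1)] that(2) by simp
  have "vs.vs1.subspace ?S"
  proof (rule vs.vs1.subspaceI)
    show "0 \<in> ?S" by (rule memS[OF zero dual_zero[OF \<rho>]])
    show "x + y \<in> ?S" if "x \<in> ?S" "y \<in> ?S" for x y
    proof (rule memS)
      show "(x + y, f x + f y) \<in> G" using that by (intro add fG) simp_all
      show "\<rho> (x + y) = f x + f y" using that dual_add[OF \<rho>] by simp
    qed
    show "field_scale scale a x \<in> ?S" if "x \<in> ?S" for a x
      unfolding field_scale_def
    proof (rule memS)
      show "([:a:] *s x, a * f x) \<in> G" using that by (intro scalar fG) simp
      show "\<rho> ([:a:] *s x) = a * f x" using that dual_scalar[OF \<rho>] by simp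
    qed
  qed
  moreover have "B \<subseteq> ?S" using B(1) \<rho>B by blast
  ultimately have "vs.vs1.span B \<subseteq> ?S" by (intro vs.vs1.span_minimal)
  then have US: "?U \<subseteq> ?S" using B(3) by (rule order_trans[rotated])
  have "\<rho> x = d" if "(x, d) \<in> G" for x d
    using subsetD[OF US mem[OF that]] f_eq[OF that] by simp
  then show ?thesis using \<rho> by (intro bexI[of _ \<rho>]) auto
qed

text \<open>
  Stated for submodules, since those are the subspaces from which points are separated below.
\<close>

lemma functional_separates:
  assumes U: "subspace U" and z: "z \<notin> U"
  shows "\<exists>\<rho>\<in>dual scale. (\<forall>x\<in>U. \<rho> x = 0) \<and> \<rho> z \<noteq> 0"
proof -
  let ?G = "{(x + [:a:] *s z, a) | x a. x \<in> U}"
  have mem: "(x + [:a:] *s z, a) \<in> ?G" if "x \<in> U" for x a using that by blast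
  have "\<exists>\<rho>\<in>dual scale. \<forall>x d. (x, d) \<in> ?G \<longrightarrow> \<rho> x = d"
  proof (rule functional_extends)
    show "(0, 0) \<in> ?G" using mem[OF subspace_0[OF U], of 0] by simp
    show "(x + y, d + e) \<in> ?G" if xd: "(x, d) \<in> ?G" and ye: "(y, e) \<in> ?G" for x d y e
    proof -
      obtain x' y' where "x' \<in> U" "x = x' + [:d:] *s z" "y' \<in> U" "y = y' + [:e:] *s z"
        using xd ye by auto
      then show ?thesis
        using mem[OF subspace_add[OF U], of x' y' "d + e"] by (simp add: const_scale_add algebra_simps)
    qed
    show "([:a:] *s x, a * d) \<in> ?G" if xd: "(x, d) \<in> ?G" for a x d
    proof -
      obtain x' where "x' \<in> U" "x = x' + [:d:] *s z" using xd by auto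
      then show ?thesis using mem[OF subspace_scale[OF U, of x' "[:a:]"], of "a * d"] by (simp add: scale_right_distrib mult.commute)
    qed
    show "d = 0" if d0: "(0, d) \<in> ?G" for d
    proof (rule ccontr)
      assume d: "d \<noteq> 0"
      obtain x where x: "x \<in> U" "x + [:d:] *s z = 0" using d0 by auto
      then have "[:d:] *s z = - x" by (simp add: eq_neg_iff_add_eq_0 add.commute)
      then have "[:d:] *s z = [:- 1:] *s x"
        using scale_minus_left[of "[:1:]" x] by (simp add: const_scale_one)
      then have "[:inverse d:] *s ([:d:] *s z) \<in> U" using subspace_scale[OF U] x(1) by metis
      then show False using z d by (simp add: const_scale_one)
    qed
  qed
  then obtain \<rho> where \<rho>: "\<rho> \<in> dual scale" "\<forall>x d. (x, d) \<in> ?G \<longrightarrow> \<rho> x = d" by (rule bexE)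
  have "\<rho> x = 0" if "x \<in> U" for x using \<rho>(2)[rule_format, OF mem[OF that, of 0]] by simp
  moreover have "\<rho> z = 1" using \<rho>(2)[rule_format, OF mem[OF subspace_0[OF U], of 1]] by (simp add: const_scale_one)
  ultimately show ?thesis using \<rho>(1) by (intro bexI[of _ \<rho>]) auto
qed

lemma functionals_separate_points:
  assumes "\<And>\<rho>. \<rho> \<in> dual scale \<Longrightarrow> \<rho> x = \<rho> y"
  shows "x = y"
proof (rule ccontr)
  assume "x \<noteq> y"
  then have "x - y \<notin> {0}" by simp
  then obtain \<rho> where \<rho>: "\<rho> \<in> dual scale" "\<rho> (x - y) \<noteq> 0"
    using functional_separates[OF subspace_single_0, of "x - y"] by auto
  then show False using assms[OF \<rho>(1)] dual_diff[OF \<rho>(1)] by simp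
qed

section \<open>Torsion and primary parts\<close>

lemma mem_torsion_iff: "x \<in> torsion scale \<longleftrightarrow> (\<exists>p. p \<noteq> 0 \<and> p *s x = 0)"
  by (simp add: torsion_def)

lemma torsion_zero: "0 \<in> torsion scale"
  unfolding mem_torsion_iff by (rule exI[of _ 1]) simp

lemma torsion_add: "x \<in> torsion scale \<Longrightarrow> y \<in> torsion scale \<Longrightarrow> x + y \<in> torsion scale"
proof -
  assume "x \<in> torsion scale" "y \<in> torsion scale"
  then obtain p s where ps: "p \<noteq> 0" "p *s x = 0" "s \<noteq> 0" "s *s y = 0" by (auto simp: mem_torsion_iff)
  have "(p * s) *s x = s *s (p *s x)" "(p * s) *s y = p *s (s *s y)" by (simp_all add: mult.commute)
  then have "(p * s) *s (x + y) = 0" using ps by (simp add: scale_right_distrib del: scale_scale)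
  then show ?thesis using ps by (metis mem_torsion_iff mult_eq_0_iff)
qed

lemma torsion_scale: "x \<in> torsion scale \<Longrightarrow> p *s x \<in> torsion scale"
  by (metis mem_torsion_iff scale_left_commute scale_zero_right)

lemma torsion_minus: "x \<in> torsion scale \<Longrightarrow> - x \<in> torsion scale"
  using torsion_scale[of x "- 1"] by simp

lemma torsion_cancel: "p \<noteq> 0 \<Longrightarrow> p *s x \<in> torsion scale \<Longrightarrow> x \<in> torsion scale"
  by (metis mem_torsion_iff mult_eq_0_iff scale_scale)

lemma mem_primary_iff: "q \<noteq> 0 \<Longrightarrow> x \<in> primary_part scale q \<longleftrightarrow> (\<exists>k. q ^ k *s x = 0)"
  by (auto simp: primary_part_def mem_torsion_iff intro: exI[of _ "q ^ _"])

lemma primary_zero: "0 \<in> primary_part scale q"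
  by (simp add: primary_part_def torsion_zero)

lemma primary_scale: "x \<in> primary_part scale q \<Longrightarrow> p *s x \<in> primary_part scale q"
  unfolding primary_part_def using torsion_scale scale_left_commute[of _ p x] scale_zero_right[of p]
  by (smt (verit) mem_Collect_eq)

lemma primary_add:
  assumes "x \<in> primary_part scale q" "y \<in> primary_part scale q"
  shows "x + y \<in> primary_part scale q"
proof -
  obtain k l where kl: "q ^ k *s x = 0" "q ^ l *s y = 0" using assms by (auto simp: primary_part_def)
  have "q ^ (k + l) *s x = q ^ l *s (q ^ k *s x)" "q ^ (k + l) *s y = q ^ k *s (q ^ l *s y)"
    by (simp_all add: power_add mult.commute)
  then have "q ^ (k + l) *s (x + y) = 0" using kl by (simp add: scale_right_distrib del: scale_scale)
  then show ?thesis using assms torsion_add by (auto simp: primary_part_def)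
qed

lemma subspace_torsion: "subspace (torsion scale)"
  by (intro subspaceI torsion_zero torsion_add torsion_scale)

lemma subspace_primary: "subspace (primary_part scale q)"
  by (intro subspaceI primary_zero primary_add primary_scale)

lemma subspace_range_scale: "subspace (range (scale n))"
proof (rule subspaceI)
  show "0 \<in> range (scale n)" by (rule range_eqI[of _ _ 0]) simp
  show "x + y \<in> range (scale n)" if xy: "x \<in> range (scale n)" "y \<in> range (scale n)" for x y
  proof -
    obtain x' y' where "x = n *s x'" "y = n *s y'" using xy by blast
    then show ?thesis by (intro range_eqI[of _ _ "x' + y'"]) (simp add: scale_right_distrib)
  qed
  show "p *s x \<in> range (scale n)" if x: "x \<in> range (scale n)" for p x
  proof -
    obtain x' where "x = n *s x'" using x by blast
    then show ?thesis by (intro range_eqI[of _ _ "p *s x'"]) (simp add: mult.commute)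
  qed
qed

lemma power_scale_mono:
  assumes "q ^ k *s x = 0" "k \<le> l"
  shows "q ^ l *s x = 0"
proof -
  have "q ^ l *s x = q ^ (l - k) *s (q ^ k *s x)" using assms(2) by (simp flip: power_add)
  then show ?thesis using assms(1) by simp
qed

text \<open>
  A polynomial that \<open>q\<close> does not divide acts invertibly on the \<open>q\<close>-primary part, by a Bezout identity
  with the power of \<open>q\<close> that kills the given element. This lemma and the next one are the two halves.
\<close>

lemma primary_coprime_divide:
  assumes q: "irreducible q" "\<not> q dvd p" and x: "x \<in> primary_part scale q"
  shows "\<exists>y\<in>primary_part scale q. x = p *s y"
proof -
  obtain k where k: "q ^ k *s x = 0" using x by (auto simp: primary_part_def)
  obtain s t where st: "s * p + t * q ^ k = 1" using irreducible_bezout_power[OF q] by blast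
  have "x = (s * p + t * q ^ k) *s x" using st by simp
  also have "\<dots> = p *s (s *s x) + t *s (q ^ k *s x)" by (simp add: scale_left_distrib mult.commute)
  finally have "x = p *s (s *s x)" using k by simp
  then show ?thesis using primary_scale[OF x] by blast
qed

lemma primary_coprime_cancel:
  assumes q: "irreducible q" "\<not> q dvd p" and x: "x \<in> primary_part scale q" and px: "p *s x = 0"
  shows "x = 0"
proof -
  obtain k where k: "q ^ k *s x = 0" using x by (auto simp: primary_part_def)
  obtain s t where st: "s * p + t * q ^ k = 1" using irreducible_bezout_power[OF q] by blast
  have "x = (s * p + t * q ^ k) *s x" using st by simp
  also have "\<dots> = s *s (p *s x) + t *s (q ^ k *s x)" by (simp add: scale_left_distrib)
  finally show ?thesis using k px by simp
qed

section \<open>Divisibility in the dual and locality of its endomorphisms\<close>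

text \<open>
  On \<open>n V + U\<close> the quotient has to send \<open>n x + u\<close> to \<open>\<sigma> x\<close>; the hypothesis on \<open>\<sigma>\<close> makes this
  single-valued.
\<close>

lemma functional_divide_vanishing:
  assumes \<sigma>: "\<sigma> \<in> dual scale" and U: "subspace U"
    and vanish: "\<And>x. n *s x \<in> U \<Longrightarrow> \<sigma> x = 0"
  shows "\<exists>\<sigma>'\<in>dual scale. n \<odot> \<sigma>' = \<sigma> \<and> (\<forall>x\<in>U. \<sigma>' x = 0)"
proof -
  let ?G = "{(n *s x + u, \<sigma> x) | x u. u \<in> U}"
  have mem: "(n *s x + u, \<sigma> x) \<in> ?G" if "u \<in> U" for x u using that by blast
  have "\<exists>\<rho>\<in>dual scale. \<forall>x d. (x, d) \<in> ?G \<longrightarrow> \<rho> x = d"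
  proof (rule functional_extends)
    show "(0, 0) \<in> ?G" using mem[OF subspace_0[OF U], of 0] \<sigma> by simp
    show "(x + y, d + e) \<in> ?G" if xd: "(x, d) \<in> ?G" and ye: "(y, e) \<in> ?G" for x d y e
    proof -
      obtain x' u y' w where "u \<in> U" "x = n *s x' + u" "d = \<sigma> x'" "w \<in> U" "y = n *s y' + w" "e = \<sigma> y'"
        using xd ye by auto
      then show ?thesis
        using mem[OF subspace_add[OF U], of u w "x' + y'"] by (simp add: dual_add[OF \<sigma>] algebra_simps)
    qed
    show "([:a:] *s x, a * d) \<in> ?G" if xd: "(x, d) \<in> ?G" for a x d
    proof -
      obtain x' u where u: "u \<in> U" and "x = n *s x' + u" "d = \<sigma> x'" using xd by auto
      then show ?thesis
        using mem[OF subspace_scale[OF U u, of "[:a:]"], of "[:a:] *s x'"]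
        by (simp add: scale_right_distrib dual_scalar[OF \<sigma>] mult.commute)
    qed
    show "d = 0" if d: "(0, d) \<in> ?G" for d
    proof -
      obtain x u where u: "u \<in> U" "n *s x + u = 0" "d = \<sigma> x" using d by auto
      then have "n *s x = (- 1) *s u" by (simp add: eq_neg_iff_add_eq_0)
      then show ?thesis using vanish subspace_scale[OF U u(1)] u(3) by metis
    qed
  qed
  then obtain \<sigma>' where \<sigma>': "\<sigma>' \<in> dual scale" "\<forall>x d. (x, d) \<in> ?G \<longrightarrow> \<sigma>' x = d" by (rule bexE)
  have "\<sigma>' (n *s x) = \<sigma> x" for x using \<sigma>'(2)[rule_format, OF mem[OF subspace_0[OF U], of x]] by simp
  moreover have "\<sigma>' u = 0" if "u \<in> U" for u using \<sigma>'(2)[rule_format, OF mem[OF that, of 0]] \<sigma> by simp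
  ultimately show ?thesis using \<sigma>'(1) by (intro bexI[of _ \<sigma>']) (auto simp: fun_eq_iff)
qed

lemma functional_divide:
  assumes "\<sigma> \<in> dual scale" "\<And>x. n *s x = 0 \<Longrightarrow> \<sigma> x = 0"
  shows "\<exists>\<sigma>'\<in>dual scale. n \<odot> \<sigma>' = \<sigma>"
  using functional_divide_vanishing[OF assms(1) subspace_single_0, of n] assms(2) by auto

text \<open>
  The dual of the torsion-free quotient \<open>W\<close>, realised inside the dual of \<open>V\<close>.
\<close>

definition torsion_annihilator :: "('v \<Rightarrow> 'a) set" where
  "torsion_annihilator = {\<rho> \<in> dual scale. \<forall>x\<in>torsion scale. \<rho> x = 0}"

text \<open>
  Divisibility of the dual of \<open>W\<close> reflects that multiplication by \<open>n \<noteq> 0\<close> is injective on \<open>W\<close>.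
\<close>

lemma torsion_annihilator_divisible:
  assumes "\<sigma> \<in> torsion_annihilator" "n \<noteq> 0"
  shows "\<exists>\<sigma>'\<in>torsion_annihilator. n \<odot> \<sigma>' = \<sigma>"
proof -
  have "\<exists>\<sigma>'\<in>dual scale. n \<odot> \<sigma>' = \<sigma> \<and> (\<forall>x\<in>torsion scale. \<sigma>' x = 0)"
  proof (rule functional_divide_vanishing[OF _ subspace_torsion])
    show "\<sigma> \<in> dual scale" using assms(1) by (simp add: torsion_annihilator_def)
    show "\<sigma> x = 0" if "n *s x \<in> torsion scale" for x
      using torsion_cancel[OF assms(2) that] assms(1) by (simp add: torsion_annihilator_def)
  qed
  then show ?thesis by (auto simp: torsion_annihilator_def)
qed

lemma carrier_module_annihilator: "carrier_module torsion_annihilator dual_act"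
  by standard
    (auto simp: torsion_annihilator_def dual.zero_mem dual.add_mem dual.act_mem torsion_scale
      dual.act_add dual.act_plus dual.act_mult dual.act_one)

text \<open>
  Endomorphisms of the dual module, with values outside of the dual left arbitrary. In this way maps
  such as \<open>\<lambda>\<rho>. g \<rho> \<odot> \<eta>\<close> need not be restricted.
\<close>

definition dual_hom :: "(('v \<Rightarrow> 'a) \<Rightarrow> ('v \<Rightarrow> 'a)) \<Rightarrow> bool" where
  "dual_hom g \<longleftrightarrow>
     (\<forall>\<rho>\<in>dual scale. g \<rho> \<in> dual scale) \<and>
     (\<forall>\<rho>\<in>dual scale. \<forall>\<sigma>\<in>dual scale. g (\<rho> + \<sigma>) = g \<rho> + g \<sigma>) \<and>
     (\<forall>\<rho>\<in>dual scale. \<forall>p. g (p \<odot> \<rho>) = p \<odot> g \<rho>)"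

lemma dual_hom_mem: "dual_hom g \<Longrightarrow> \<rho> \<in> dual scale \<Longrightarrow> g \<rho> \<in> dual scale"
  and dual_hom_add: "dual_hom g \<Longrightarrow> \<rho> \<in> dual scale \<Longrightarrow> \<sigma> \<in> dual scale \<Longrightarrow> g (\<rho> + \<sigma>) = g \<rho> + g \<sigma>"
  and dual_hom_act: "dual_hom g \<Longrightarrow> \<rho> \<in> dual scale \<Longrightarrow> g (p \<odot> \<rho>) = p \<odot> g \<rho>"
  by (simp_all add: dual_hom_def)

lemma dual_hom_zero: "dual_hom g \<Longrightarrow> g 0 = 0"
  using dual_hom_act[of g 0 0] dual.act_zero[of "g 0"] dual_hom_mem[of g 0] dual.act_zero_right[of 0] dual.zero_mem
  by simp

lemma dual_hom_diff:
  assumes g: "dual_hom g" and \<rho>: "\<rho> \<in> dual scale" and \<sigma>: "\<sigma> \<in> dual scale"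
  shows "g (\<rho> - \<sigma>) = g \<rho> - g \<sigma>"
proof -
  have "g (\<rho> - \<sigma>) + g \<sigma> = g \<rho>"
    using dual_hom_add[OF g dual_diff_mem[OF \<rho> \<sigma>] \<sigma>] by simp
  then show ?thesis by (simp add: eq_diff_eq)
qed

text \<open>
  A functional that vanishes on the kernel of \<open>n\<close> is an \<open>n\<close>-fold multiple, hence so is its image,
  and an \<open>n\<close>-fold multiple vanishes on the kernel of \<open>n\<close>. Thus the values of \<open>g \<sigma>\<close> on a primary part
  depend only on the values of \<open>\<sigma>\<close> there, although \<open>g\<close> need not be the adjoint of an operator on \<open>V\<close>.
\<close>

lemma dual_hom_local:
  assumes g: "dual_hom g" and \<sigma>: "\<sigma> \<in> dual scale" and vanish: "\<And>x. n *s x = 0 \<Longrightarrow> \<sigma> x = 0"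
    and z: "n *s z = 0"
  shows "g \<sigma> z = 0"
proof -
  obtain \<sigma>' where \<sigma>': "\<sigma>' \<in> dual scale" "n \<odot> \<sigma>' = \<sigma>" using functional_divide[OF \<sigma> vanish] by blast
  then have "g \<sigma> = n \<odot> g \<sigma>'" using dual_hom_act[OF g] by blast
  then show ?thesis using z dual_hom_mem[OF g \<sigma>'(1)] by simp
qed

lemma dual_hom_local_primary:
  assumes g: "dual_hom g" and \<sigma>: "\<sigma> \<in> dual scale" and q: "q \<noteq> 0"
    and vanish: "\<And>x. x \<in> primary_part scale q \<Longrightarrow> \<sigma> x = 0"
    and z: "z \<in> primary_part scale q"
  shows "g \<sigma> z = 0"
proof -
  obtain k where "q ^ k *s z = 0" using z by (auto simp: primary_part_def)
  then show ?thesis using vanish by (intro dual_hom_local[OF g \<sigma>]) (auto simp: mem_primary_iff[OF q])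
qed

lemma dual_hom_eq_on_primary:
  assumes g: "dual_hom g" and \<sigma>: "\<sigma> \<in> dual scale" and \<tau>: "\<tau> \<in> dual scale" and q: "q \<noteq> 0"
    and eq: "\<And>x. x \<in> primary_part scale q \<Longrightarrow> \<sigma> x = \<tau> x"
    and z: "z \<in> primary_part scale q"
  shows "g \<sigma> z = g \<tau> z"
proof -
  have "g (\<sigma> - \<tau>) z = 0"
    using eq by (intro dual_hom_local_primary[OF g dual_diff_mem[OF \<sigma> \<tau>] q _ z]) simp
  then show ?thesis by (simp add: dual_hom_diff[OF g \<sigma> \<tau>])
qed

section \<open>Endomorphisms of the dual with values in the dual of the quotient\<close>

lemma dual_act_diff: "p \<odot> (\<rho> - \<sigma>) = p \<odot> \<rho> - p \<odot> \<sigma>"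
  by (simp add: fun_eq_iff)

lemma dual_act_commute: "p \<odot> s \<odot> \<rho> = s \<odot> p \<odot> \<rho>"
  by (simp add: fun_eq_iff mult.commute)

lemma dual_act_act: "p \<odot> s \<odot> \<rho> = (p * s) \<odot> \<rho>"
  by (simp add: fun_eq_iff mult.commute)

lemma annihilator_subset_dual: "\<rho> \<in> torsion_annihilator \<Longrightarrow> \<rho> \<in> dual scale"
  by (simp add: torsion_annihilator_def)

text \<open>
  The submodule generated by \<open>z\<close> is free and meets the torsion submodule trivially, so a functional
  on polynomials with zero annihilator can be transported to it.
\<close>

lemma exists_torsion_free_functional:
  assumes z: "z \<notin> torsion scale"
  shows "\<exists>\<rho>\<in>torsion_annihilator. \<forall>p. p \<noteq> 0 \<longrightarrow> p \<odot> \<rho> \<noteq> 0"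
proof -
  define G where "G = {(t + p *s z, power_of_two_functional p) | t p. t \<in> torsion scale}"
  have mem: "(t + p *s z, power_of_two_functional p) \<in> G" if "t \<in> torsion scale" for t p
    using that unfolding G_def by blast
  have "\<exists>\<rho>\<in>dual scale. \<forall>x d. (x, d) \<in> G \<longrightarrow> \<rho> x = d"
  proof (rule functional_extends)
    show "(0, 0) \<in> G"
      using mem[OF torsion_zero, of 0] by (simp add: power_of_two_functional_def)
    show "(x + y, d + e) \<in> G" if xd: "(x, d) \<in> G" and ye: "(y, e) \<in> G" for x d y e
    proof -
      obtain t p t' p' where t: "t \<in> torsion scale" "t' \<in> torsion scale"
        and eq: "x = t + p *s z" "d = power_of_two_functional p"
          "y = t' + p' *s z" "e = power_of_two_functional p'"
        using xd ye unfolding G_def by auto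
      show ?thesis
        using mem[OF torsion_add[OF t], of "p + p'"] unfolding eq
        by (simp add: power_of_two_functional_add algebra_simps)
    qed
    show "([:a:] *s x, a * d) \<in> G" if xd: "(x, d) \<in> G" for a x d
    proof -
      obtain t p where t: "t \<in> torsion scale" and eq: "x = t + p *s z" "d = power_of_two_functional p"
        using xd unfolding G_def by auto
      show ?thesis
        using mem[OF torsion_scale[OF t, of "[:a:]"], of "smult a p"] unfolding eq
        by (simp add: power_of_two_functional_smult scale_right_distrib)
    qed
    show "d = 0" if d0: "(0, d) \<in> G" for d
    proof -
      obtain t p where t: "t \<in> torsion scale" and eq: "t + p *s z = 0" "d = power_of_two_functional p"
        using d0 unfolding G_def by auto
      have "p *s z = - t" using eq(1) by (simp add: eq_neg_iff_add_eq_0 add.commute)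
      then have "p *s z \<in> torsion scale" using torsion_minus[OF t] by simp
      then have "p = 0" using torsion_cancel z by blast
      then show ?thesis using eq(2) by (simp add: power_of_two_functional_def)
    qed
  qed
  then obtain \<rho> where \<rho>: "\<rho> \<in> dual scale" and G: "\<forall>x d. (x, d) \<in> G \<longrightarrow> \<rho> x = d" by (rule bexE)
  have val: "\<rho> (t + p *s z) = power_of_two_functional p" if "t \<in> torsion scale" for t p
    using G mem[OF that] by blast
  have "\<rho> t = 0" if "t \<in> torsion scale" for t
    using val[OF that, of 0] by (simp add: power_of_two_functional_def)
  then have "\<rho> \<in> torsion_annihilator" using \<rho> by (simp add: torsion_annihilator_def)
  moreover have "p \<odot> \<rho> \<noteq> 0" if p: "p \<noteq> 0" for p
  proof
    assume "p \<odot> \<rho> = 0"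
    then have "\<rho> (p *s (s *s z)) = 0" for s
      by (metis dual_act_apply zero_fun_apply)
    then have "\<rho> ((p * s) *s z) = 0" for s by simp
    moreover obtain s where "power_of_two_functional (s * p) \<noteq> 0"
      using power_of_two_functional_nonzero_multiple[OF p] by blast
    ultimately show False using val[OF torsion_zero, of "s * p"] by (simp add: mult.commute[of s])
  qed
  ultimately show ?thesis by blast
qed

sublocale to_annihilator: carrier_module_pair "dual scale" dual_act torsion_annihilator dual_act
  by (intro carrier_module_pair.intro carrier_module_dual carrier_module_annihilator)

text \<open>
  The dual of \<open>W\<close> is divisible, hence injective. This is the main supply of endomorphisms of the dual.
\<close>

lemma hom_to_annihilator_extends:
  assumes G: "to_annihilator.partial_hom G"
  shows "\<exists>g. dual_hom g \<and> (\<forall>\<rho>\<in>dual scale. g \<rho> \<in> torsion_annihilator) \<and>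
             (\<forall>\<rho> \<eta>. (\<rho>, \<eta>) \<in> G \<longrightarrow> g \<rho> = \<eta>)"
proof -
  have "\<exists>\<delta>\<in>torsion_annihilator. p \<odot> \<delta> = \<eta>"
    if \<eta>: "\<eta> \<in> torsion_annihilator"
      and kill: "\<And>s. (\<And>\<rho>. \<rho> \<in> dual scale \<Longrightarrow> ((s * p) \<odot> \<rho>, 0) \<in> G) \<Longrightarrow> s \<odot> \<eta> = 0" for p \<eta>
  proof (cases "p = 0")
    case True
    have "(0, 0) \<in> G" using G unfolding to_annihilator.partial_hom_def by blast
    then have "1 \<odot> \<eta> = 0" using True by (intro kill) (simp add: dual.act_zero)
    then have "\<eta> = 0" using dual.act_one[OF annihilator_subset_dual[OF \<eta>]] by simp
    then show ?thesis using to_annihilator.cod.zero_mem dual.act_zero_right by blast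
  next
    case False
    then show ?thesis by (rule torsion_annihilator_divisible[OF \<eta>])
  qed
  from to_annihilator.partial_hom_extends[OF G this]
  obtain g where g: "\<forall>\<rho>\<in>dual scale. g \<rho> \<in> torsion_annihilator"
      "\<forall>\<rho>\<in>dual scale. \<forall>\<sigma>\<in>dual scale. g (\<rho> + \<sigma>) = g \<rho> + g \<sigma>"
      "\<forall>\<rho>\<in>dual scale. \<forall>p. g (p \<odot> \<rho>) = p \<odot> g \<rho>" "\<forall>(\<rho>, \<eta>)\<in>G. g \<rho> = \<eta>"
    by metis
  have "dual_hom g" unfolding dual_hom_def using g(1-3) annihilator_subset_dual by simp
  then show ?thesis using g by (intro exI[of _ g]) auto
qed

text \<open>
  Separates a second functional \<open>\<sigma>\<close> from \<open>\<rho>\<close> by an endomorphism, as far as the relations between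
  them permit.
\<close>

lemma hom_to_annihilator_two_generators:
  assumes \<rho>: "\<rho> \<in> dual scale" and \<sigma>: "\<sigma> \<in> dual scale" and \<eta>: "\<eta> \<in> torsion_annihilator"
    and compat: "\<And>p s. p \<odot> \<rho> + s \<odot> \<sigma> = 0 \<Longrightarrow> s \<odot> \<eta> = 0"
  shows "\<exists>g. dual_hom g \<and> (\<forall>\<tau>\<in>dual scale. g \<tau> \<in> torsion_annihilator) \<and> g \<rho> = 0 \<and> g \<sigma> = \<eta>"
proof -
  define G where "G = {(p \<odot> \<rho> + s \<odot> \<sigma>, s \<odot> \<eta>) | p s. True}"
  have mem: "(p \<odot> \<rho> + s \<odot> \<sigma>, s \<odot> \<eta>) \<in> G" for p s unfolding G_def by blast
  note \<eta>d = annihilator_subset_dual[OF \<eta>]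
  have "to_annihilator.partial_hom G"
    unfolding to_annihilator.partial_hom_def
  proof (intro conjI allI impI)
    show "G \<subseteq> dual scale \<times> torsion_annihilator"
      unfolding G_def using \<rho> \<sigma> \<eta> by (auto intro: dual.add_mem dual.act_mem to_annihilator.cod.act_mem)
    show "(0, 0) \<in> G" using mem[of 0 0] \<rho> \<sigma> \<eta>d by (simp add: dual.act_zero)
    show "(x + y, d + e) \<in> G" if xd: "(x, d) \<in> G" and ye: "(y, e) \<in> G" for x d y e
    proof -
      obtain p s p' s' where eq: "x = p \<odot> \<rho> + s \<odot> \<sigma>" "d = s \<odot> \<eta>" "y = p' \<odot> \<rho> + s' \<odot> \<sigma>" "e = s' \<odot> \<eta>"
        using xd ye unfolding G_def by auto
      have "x + y = (p + p') \<odot> \<rho> + (s + s') \<odot> \<sigma>" "d + e = (s + s') \<odot> \<eta>"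
        unfolding eq using \<rho> \<sigma> \<eta>d by (simp_all add: dual.act_plus add_ac)
      then show ?thesis using mem by simp
    qed
    show "(r \<odot> x, r \<odot> d) \<in> G" if xd: "(x, d) \<in> G" for r x d
    proof -
      obtain p s where eq: "x = p \<odot> \<rho> + s \<odot> \<sigma>" "d = s \<odot> \<eta>" using xd unfolding G_def by auto
      have "r \<odot> x = (r * p) \<odot> \<rho> + (r * s) \<odot> \<sigma>" "r \<odot> d = (r * s) \<odot> \<eta>"
        unfolding eq using \<rho> \<sigma> by (simp_all add: dual.act_add dual.act_mem dual_act_act)
      then show ?thesis using mem by simp
    qed
    show "d = 0" if d0: "(0, d) \<in> G" for d
    proof -
      obtain p s where "p \<odot> \<rho> + s \<odot> \<sigma> = 0" "d = s \<odot> \<eta>" using d0 unfolding G_def by auto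
      then show ?thesis using compat by simp
    qed
  qed
  from hom_to_annihilator_extends[OF this] obtain g where g: "dual_hom g"
      "\<forall>\<tau>\<in>dual scale. g \<tau> \<in> torsion_annihilator" and gG: "\<forall>\<rho> \<eta>. (\<rho>, \<eta>) \<in> G \<longrightarrow> g \<rho> = \<eta>" by metis
  have "g \<rho> = 0" using gG mem[of 1 0] \<rho> \<sigma> \<eta>d by (simp add: dual.act_zero dual.act_one)
  moreover have "g \<sigma> = \<eta>" using gG mem[of 0 1] \<rho> \<sigma> \<eta>d by (simp add: dual.act_zero dual.act_one)
  ultimately show ?thesis using g by blast
qed

lemma hom_to_annihilator_cyclic:
  assumes \<sigma>: "\<sigma> \<in> dual scale" and \<eta>: "\<eta> \<in> torsion_annihilator"
    and compat: "\<And>s. s \<odot> \<sigma> = 0 \<Longrightarrow> s \<odot> \<eta> = 0"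
  shows "\<exists>g. dual_hom g \<and> (\<forall>\<tau>\<in>dual scale. g \<tau> \<in> torsion_annihilator) \<and> g \<sigma> = \<eta>"
proof -
  have "s \<odot> \<eta> = 0" if "p \<odot> 0 + s \<odot> \<sigma> = 0" for p s
    using that compat by (simp add: dual.act_zero_right)
  then show ?thesis using hom_to_annihilator_two_generators[OF dual.zero_mem \<sigma> \<eta>] by blast
qed

lemma retraction_to_annihilator:
  "\<exists>\<pi>. dual_hom \<pi> \<and> (\<forall>\<rho>\<in>dual scale. \<pi> \<rho> \<in> torsion_annihilator) \<and> (\<forall>\<rho>\<in>torsion_annihilator. \<pi> \<rho> = \<rho>)"
proof -
  define G where "G = {(\<rho>, \<rho>) | \<rho>. \<rho> \<in> torsion_annihilator}"
  have "to_annihilator.partial_hom G"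
    unfolding to_annihilator.partial_hom_def G_def
    using annihilator_subset_dual to_annihilator.cod.zero_mem to_annihilator.cod.add_mem
      to_annihilator.cod.act_mem by auto
  from hom_to_annihilator_extends[OF this] show ?thesis unfolding G_def by auto
qed

section \<open>Central endomorphisms and their rational function\<close>

definition dual_central :: "(('v \<Rightarrow> 'a) \<Rightarrow> ('v \<Rightarrow> 'a)) \<Rightarrow> bool" where
  "dual_central b \<longleftrightarrow> dual_hom b \<and> (\<forall>g. dual_hom g \<longrightarrow> (\<forall>\<rho>\<in>dual scale. b (g \<rho>) = g (b \<rho>)))"

lemma dual_central_hom: "dual_central b \<Longrightarrow> dual_hom b"
  by (simp add: dual_central_def)

lemma dual_central_commute: "dual_central b \<Longrightarrow> dual_hom g \<Longrightarrow> \<rho> \<in> dual scale \<Longrightarrow> b (g \<rho>) = g (b \<rho>)"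
  by (simp add: dual_central_def)

text \<open>
  If \<open>\<rho>\<close> and \<open>b \<rho>\<close> were linearly independent, some endomorphism would kill \<open>\<rho>\<close> but not \<open>b \<rho>\<close>,
  which is impossible for a central \<open>b\<close>. So \<open>t \<odot> b \<rho> = s \<odot> \<rho>\<close> for some \<open>t \<noteq> 0\<close>. If \<open>\<rho>\<close> has zero
  annihilator, an endomorphism carries it to one fixed functional \<open>\<rho>1\<close> that vanishes on the torsion
  submodule and has zero annihilator, and hence \<open>s/t\<close> is always the same fraction \<open>u/v\<close>.
\<close>

lemma dual_central_rational:
  assumes b: "dual_central b" and z: "z \<notin> torsion scale"
  shows "\<exists>u v. v \<noteq> 0 \<and> coprime u v \<and> (\<forall>\<rho>\<in>torsion_annihilator. v \<odot> b \<rho> = u \<odot> \<rho>) \<and>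
               (\<forall>\<rho>\<in>dual scale. \<exists>p. p \<noteq> 0 \<and> p \<odot> (v \<odot> b \<rho> - u \<odot> \<rho>) = 0)"
proof -
  note bh = dual_central_hom[OF b]
  obtain \<rho>0 where \<rho>0: "\<rho>0 \<in> torsion_annihilator" and free0: "\<And>p. p \<noteq> 0 \<Longrightarrow> p \<odot> \<rho>0 \<noteq> 0"
    using exists_torsion_free_functional[OF z] by blast
  note \<rho>0d = annihilator_subset_dual[OF \<rho>0]
  have dependent: "\<exists>u v. v \<noteq> 0 \<and> v \<odot> b \<rho> = u \<odot> \<rho>" if \<rho>: "\<rho> \<in> dual scale" for \<rho>
  proof (rule ccontr)
    assume indep: "\<nexists>u v. v \<noteq> 0 \<and> v \<odot> b \<rho> = u \<odot> \<rho>"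
    have "s \<odot> \<rho>0 = 0" if "p \<odot> \<rho> + s \<odot> b \<rho> = 0" for p s
    proof -
      have "s \<odot> b \<rho> = - (p \<odot> \<rho>)" using that by (simp add: eq_neg_iff_add_eq_0 add.commute)
      then have "s \<odot> b \<rho> = (- p) \<odot> \<rho>" using dual.act_minus[OF \<rho>] by simp
      then have "s = 0" using indep by blast
      then show ?thesis using dual.act_zero[OF \<rho>0d] by simp
    qed
    then obtain g where g: "dual_hom g" "g \<rho> = 0" "g (b \<rho>) = \<rho>0"
      using hom_to_annihilator_two_generators[OF \<rho> dual_hom_mem[OF bh \<rho>] \<rho>0] by metis
    have "\<rho>0 = b 0" using dual_central_commute[OF b g(1) \<rho>] g by simp
    then show False using free0[of 1] dual_hom_zero[OF bh] dual.act_one[OF \<rho>0d] by simp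
  qed
  obtain u v where uv: "v \<noteq> 0" "v \<odot> b \<rho>0 = u \<odot> \<rho>0" using dependent[OF \<rho>0d] by blast
  obtain k u0 v0 where k: "u = k * u0" "v = k * v0" "coprime u0 v0" "k \<noteq> 0" "v0 \<noteq> 0"
    using poly_reduce_fraction[OF uv(1)] by blast
  \<comment> \<open>cancelling \<open>k\<close> costs a torsion error, which the passage from \<open>\<rho>0\<close> to its multiple removes\<close>
  define \<rho>1 where "\<rho>1 = k \<odot> \<rho>0"
  have \<rho>1: "\<rho>1 \<in> torsion_annihilator" unfolding \<rho>1_def by (rule to_annihilator.cod.act_mem[OF \<rho>0])
  note \<rho>1d = annihilator_subset_dual[OF \<rho>1]
  have free1: "p = 0" if "p \<odot> \<rho>1 = 0" for p
    using that free0[of "p * k"] k(4) unfolding \<rho>1_def by (auto simp: dual_act_act)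
  have "v0 \<odot> b \<rho>1 = v \<odot> b \<rho>0"
    unfolding \<rho>1_def k(2) using dual_hom_act[OF bh \<rho>0d] by (simp add: dual_act_act mult.commute)
  also have "\<dots> = u0 \<odot> \<rho>1" unfolding uv(2) \<rho>1_def k(1) by (simp add: dual_act_act mult.commute)
  finally have r1: "v0 \<odot> b \<rho>1 = u0 \<odot> \<rho>1" .
  have ann: "v0 \<odot> b \<rho> = u0 \<odot> \<rho>" if \<rho>: "\<rho> \<in> torsion_annihilator" for \<rho>
  proof -
    note \<rho>d = annihilator_subset_dual[OF \<rho>]
    have "s \<odot> \<rho> = 0" if "s \<odot> \<rho>1 = 0" for s
      using free1[OF that] dual.act_zero[OF \<rho>d] by simp
    then obtain g where g: "dual_hom g" "g \<rho>1 = \<rho>"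
      using hom_to_annihilator_cyclic[OF \<rho>1d \<rho>] by metis
    have "v0 \<odot> b \<rho> = v0 \<odot> g (b \<rho>1)" using dual_central_commute[OF b g(1) \<rho>1d] g(2) by simp
    also have "\<dots> = g (v0 \<odot> b \<rho>1)" using dual_hom_act[OF g(1) dual_hom_mem[OF bh \<rho>1d]] by simp
    also have "\<dots> = u0 \<odot> \<rho>" unfolding r1 using dual_hom_act[OF g(1) \<rho>1d] g(2) by simp
    finally show ?thesis .
  qed
  have tors: "\<exists>p. p \<noteq> 0 \<and> p \<odot> (v0 \<odot> b \<rho> - u0 \<odot> \<rho>) = 0" if \<rho>: "\<rho> \<in> dual scale" for \<rho>
  proof (cases "\<exists>p. p \<noteq> 0 \<and> p \<odot> \<rho> = 0")
    case True
    then obtain p where p: "p \<noteq> 0" "p \<odot> \<rho> = 0" by blast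
    have "p \<odot> b \<rho> = 0" using dual_hom_act[OF bh \<rho>, of p] p(2) dual_hom_zero[OF bh] by simp
    then have "p \<odot> (v0 \<odot> b \<rho> - u0 \<odot> \<rho>) = 0"
      using p(2) by (simp add: dual_act_diff dual_act_commute[where p = p] dual.act_zero_right)
    then show ?thesis using p(1) by blast
  next
    case False
    obtain s t where st: "t \<noteq> 0" "t \<odot> b \<rho> = s \<odot> \<rho>" using dependent[OF \<rho>] by blast
    have "c \<odot> \<rho>1 = 0" if "c \<odot> \<rho> = 0" for c
      using that False dual.act_zero[OF \<rho>1d] by metis
    then obtain g where g: "dual_hom g" "g \<rho> = \<rho>1"
      using hom_to_annihilator_cyclic[OF \<rho> \<rho>1] by metis
    have "t \<odot> b \<rho>1 = t \<odot> g (b \<rho>)" using dual_central_commute[OF b g(1) \<rho>] g(2) by simp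
    also have "\<dots> = g (t \<odot> b \<rho>)" using dual_hom_act[OF g(1) dual_hom_mem[OF bh \<rho>]] by simp
    also have "\<dots> = s \<odot> \<rho>1" unfolding st(2) using dual_hom_act[OF g(1) \<rho>] g(2) by simp
    finally have "v0 \<odot> s \<odot> \<rho>1 = v0 \<odot> t \<odot> b \<rho>1" by simp
    also have "\<dots> = t \<odot> u0 \<odot> \<rho>1" unfolding dual_act_commute[where p = v0] r1 ..
    finally have "(v0 * s - t * u0) \<odot> \<rho>1 = 0"
      using dual.act_plus[OF \<rho>1d, of "v0 * s" "- (t * u0)"] dual.act_minus[OF \<rho>1d, of "t * u0"]
      by (simp add: dual_act_act)
    then have eq: "v0 * s = t * u0" using free1 eq_iff_diff_eq_0 by blast
    have "t \<odot> (v0 \<odot> b \<rho> - u0 \<odot> \<rho>) = v0 \<odot> t \<odot> b \<rho> - (t * u0) \<odot> \<rho>"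
      by (simp add: dual_act_diff dual_act_commute[where p = t] dual_act_act mult.commute)
    also have "\<dots> = 0" unfolding st(2) by (simp add: dual_act_act eq)
    finally show ?thesis using st(1) by blast
  qed
  show ?thesis using k(3,5) ann tors by blast
qed

lemma dual_central_combination:
  assumes b: "dual_central b"
  shows "dual_central (\<lambda>\<rho>. v \<odot> b \<rho> - u \<odot> \<rho>)"
proof -
  note bh = dual_central_hom[OF b]
  have "dual_hom (\<lambda>\<rho>. v \<odot> b \<rho> - u \<odot> \<rho>)"
    unfolding dual_hom_def
  proof (intro conjI ballI allI)
    fix \<rho> assume \<rho>: "\<rho> \<in> dual scale"
    show "v \<odot> b \<rho> - u \<odot> \<rho> \<in> dual scale"
      by (intro dual_diff_mem dual.act_mem dual_hom_mem[OF bh] \<rho>)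
    show "v \<odot> b (\<rho> + \<sigma>) - u \<odot> (\<rho> + \<sigma>) = v \<odot> b \<rho> - u \<odot> \<rho> + (v \<odot> b \<sigma> - u \<odot> \<sigma>)"
      if \<sigma>: "\<sigma> \<in> dual scale" for \<sigma>
      using dual_hom_add[OF bh \<rho> \<sigma>] by (simp add: fun_eq_iff)
    show "v \<odot> b (p \<odot> \<rho>) - u \<odot> p \<odot> \<rho> = p \<odot> (v \<odot> b \<rho> - u \<odot> \<rho>)" for p
      using dual_hom_act[OF bh \<rho>] by (simp add: dual_act_diff dual_act_commute[where p = p])
  qed
  moreover have "v \<odot> b (g \<rho>) - u \<odot> g \<rho> = g (v \<odot> b \<rho> - u \<odot> \<rho>)"
    if g: "dual_hom g" and \<rho>: "\<rho> \<in> dual scale" for g \<rho>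
    using dual_hom_mem[OF bh \<rho>] \<rho> dual_central_commute[OF b g \<rho>]
    by (simp add: dual_hom_diff[OF g] dual_hom_act[OF g] dual.act_mem)
  ultimately show ?thesis by (simp add: dual_central_def)
qed

text \<open>
  Replaces a functional by one with the same values on \<open>U\<close> that is annihilated by all \<open>n\<close> with
  \<open>n V \<subseteq> U'\<close>.
\<close>

lemma functional_extends_by_zero:
  assumes \<sigma>: "\<sigma> \<in> dual scale"
    and U: "subspace U" and U': "subspace U'"
    and disjoint: "\<And>x. x \<in> U \<Longrightarrow> x \<in> U' \<Longrightarrow> x = 0"
  shows "\<exists>\<eta>\<in>dual scale. (\<forall>x\<in>U. \<eta> x = \<sigma> x) \<and> (\<forall>x\<in>U'. \<eta> x = 0)"
proof -
  define G where "G = {(x + u, \<sigma> x) | x u. x \<in> U \<and> u \<in> U'}"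
  have mem: "(x + u, \<sigma> x) \<in> G" if "x \<in> U" "u \<in> U'" for x u using that unfolding G_def by blast
  have "\<exists>\<eta>\<in>dual scale. \<forall>x d. (x, d) \<in> G \<longrightarrow> \<eta> x = d"
  proof (rule functional_extends)
    show "(0, 0) \<in> G" using mem[OF subspace_0[OF U] subspace_0[OF U']] dual_zero[OF \<sigma>] by simp
    show "(x + y, d + e) \<in> G" if xd: "(x, d) \<in> G" and ye: "(y, e) \<in> G" for x d y e
    proof -
      obtain a u a' u' where a: "a \<in> U" "a' \<in> U" "u \<in> U'" "u' \<in> U'"
        and eq: "x = a + u" "d = \<sigma> a" "y = a' + u'" "e = \<sigma> a'"
        using xd ye unfolding G_def by auto
      show ?thesis
        using mem[OF subspace_add[OF U a(1,2)] subspace_add[OF U' a(3,4)]] unfolding eq dual_add[OF \<sigma>]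
        by (simp add: add_ac)
    qed
    show "([:r:] *s x, r * d) \<in> G" if xd: "(x, d) \<in> G" for r x d
    proof -
      obtain a u where a: "a \<in> U" "u \<in> U'" and eq: "x = a + u" "d = \<sigma> a"
        using xd unfolding G_def by auto
      show ?thesis
        using mem[OF subspace_scale[OF U a(1), of "[:r:]"] subspace_scale[OF U' a(2), of "[:r:]"]] unfolding eq dual_scalar[OF \<sigma>]
        by (simp add: scale_right_distrib)
    qed
    show "d = 0" if d0: "(0, d) \<in> G" for d
    proof -
      obtain a u where a: "a \<in> U" "u \<in> U'" "a + u = 0" "d = \<sigma> a" using d0 unfolding G_def by auto
      have "a = (- 1) *s u" using a(3) by (simp add: eq_neg_iff_add_eq_0)
      then have "a \<in> U'" using subspace_scale[OF U' a(2), of "- 1"] by simp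
      then show ?thesis using disjoint[OF a(1)] a(4) dual_zero[OF \<sigma>] by simp
    qed
  qed
  then obtain \<eta> where \<eta>: "\<eta> \<in> dual scale" and G: "\<forall>x d. (x, d) \<in> G \<longrightarrow> \<eta> x = d" by (rule bexE)
  have "\<eta> x = \<sigma> x" if "x \<in> U" for x using G mem[OF that subspace_0[OF U']] by simp
  moreover have "\<eta> x = 0" if "x \<in> U'" for x using G mem[OF subspace_0[OF U] that] dual_zero[OF \<sigma>] by simp
  ultimately show ?thesis using \<eta> by blast
qed

section \<open>Primes acting on the torsion-free quotient\<close>

lemma torsion_coset_eq_iff: "torsion_coset scale x = torsion_coset scale y \<longleftrightarrow> x - y \<in> torsion scale"
proof
  assume "torsion_coset scale x = torsion_coset scale y"
  moreover have "x + 0 \<in> torsion_coset scale x" unfolding torsion_coset_def by (rule imageI[OF torsion_zero])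
  ultimately obtain t where "x = y + t" "t \<in> torsion scale" unfolding torsion_coset_def by auto
  then show "x - y \<in> torsion scale" by simp
next
  have sub: "torsion_coset scale x \<subseteq> torsion_coset scale y" if "x - y \<in> torsion scale" for x y
  proof
    fix w assume "w \<in> torsion_coset scale x"
    then obtain t where t: "t \<in> torsion scale" "w = x + t" unfolding torsion_coset_def by auto
    then have "w = y + ((x - y) + t)" by simp
    then show "w \<in> torsion_coset scale y" unfolding torsion_coset_def using torsion_add[OF that t(1)] by blast
  qed
  assume xy: "x - y \<in> torsion scale"
  then have "y - x \<in> torsion scale" using torsion_minus[OF xy] by simp
  then show "torsion_coset scale x = torsion_coset scale y" using sub[OF xy] sub by (intro equalityI) auto
qed

lemma quotient_scale_coset: "quotient_scale scale p (torsion_coset scale x) = torsion_coset scale (p *s x)"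
proof -
  have "torsion_coset scale (p *s y) = torsion_coset scale (p *s x)" if y: "y \<in> torsion_coset scale x" for y
  proof -
    obtain t where "t \<in> torsion scale" "y = x + t" using y unfolding torsion_coset_def by auto
    then show ?thesis by (simp add: torsion_coset_eq_iff scale_right_distrib torsion_scale)
  qed
  moreover have "x \<in> torsion_coset scale x"
    unfolding torsion_coset_def using imageI[OF torsion_zero, of "\<lambda>y. x + y"] by simp
  ultimately show ?thesis unfolding quotient_scale_def by blast
qed

lemma P_W_iff:
  assumes "prime_poly p"
  shows "p \<in> P_W scale \<longleftrightarrow> (\<exists>x. \<forall>y. x - p *s y \<notin> torsion scale)"
proof -
  have "quotient_scale scale p ` torsion_quotient scale = range (\<lambda>y. torsion_coset scale (p *s y))"
    unfolding torsion_quotient_def by (simp add: image_image quotient_scale_coset)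
  moreover have "range (\<lambda>y. torsion_coset scale (p *s y)) = range (torsion_coset scale) \<longleftrightarrow>
      (\<forall>x. \<exists>y. torsion_coset scale x = torsion_coset scale (p *s y))"
  proof
    assume eq: "range (\<lambda>y. torsion_coset scale (p *s y)) = range (torsion_coset scale)"
    show "\<forall>x. \<exists>y. torsion_coset scale x = torsion_coset scale (p *s y)"
    proof
      fix x
      have "torsion_coset scale x \<in> range (\<lambda>y. torsion_coset scale (p *s y))" unfolding eq by (rule rangeI)
      then show "\<exists>y. torsion_coset scale x = torsion_coset scale (p *s y)" by (simp only: image_iff) simp
    qed
  next
    assume "\<forall>x. \<exists>y. torsion_coset scale x = torsion_coset scale (p *s y)"
    then show "range (\<lambda>y. torsion_coset scale (p *s y)) = range (torsion_coset scale)"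
      by (intro equalityI image_subsetI) (rule rangeI, simp only: image_iff, simp)
  qed
  ultimately show ?thesis using assms by (simp add: P_W_def torsion_quotient_def torsion_coset_eq_iff)
qed

text \<open>
  If \<open>p W\<close> is a proper submodule of \<open>W\<close>, a functional that vanishes on it but not on all of \<open>W\<close> is
  \<open>p\<close>-torsion.
\<close>

lemma P_W_annihilator:
  assumes p: "p \<in> P_W scale"
  shows "\<exists>\<rho>\<in>torsion_annihilator. \<rho> \<noteq> 0 \<and> p \<odot> \<rho> = 0"
proof -
  have "prime_poly p" using p by (simp add: P_W_def)
  then obtain z where z: "\<And>y. z - p *s y \<notin> torsion scale" using p P_W_iff by auto
  define U where "U = {x. \<exists>y. x - p *s y \<in> torsion scale}"
  have memU: "x \<in> U" if "x - p *s y \<in> torsion scale" for x y using that unfolding U_def by blast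
  have "subspace U"
  proof (rule subspaceI)
    show "0 \<in> U" using memU[of 0 0] torsion_zero by simp
    show "x + y \<in> U" if xy: "x \<in> U" "y \<in> U" for x y
    proof -
      obtain x' y' where "x - p *s x' \<in> torsion scale" "y - p *s y' \<in> torsion scale" using xy unfolding U_def by auto
      from torsion_add[OF this] show ?thesis
        by (intro memU[of _ "x' + y'"]) (simp add: algebra_simps)
    qed
    show "r *s x \<in> U" if x: "x \<in> U" for r x
    proof -
      obtain x' where "x - p *s x' \<in> torsion scale" using x unfolding U_def by auto
      from torsion_scale[OF this, of r] show ?thesis
        by (intro memU[of _ "r *s x'"]) (simp add: scale_right_diff_distrib mult.commute)
    qed
  qed
  moreover have "z \<notin> U" unfolding U_def using z by blast
  ultimately obtain \<rho> where \<rho>: "\<rho> \<in> dual scale" "\<And>x. x \<in> U \<Longrightarrow> \<rho> x = 0" "\<rho> z \<noteq> 0"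
    using functional_separates by metis
  have "\<rho> \<in> torsion_annihilator" using \<rho>(1,2) memU[of _ 0] by (simp add: torsion_annihilator_def)
  moreover have "\<rho> (p *s y) = 0" for y
    using \<rho>(2) memU[of "p *s y" y] torsion_zero by simp
  then have "p \<odot> \<rho> = 0" by (simp add: fun_eq_iff)
  ultimately show ?thesis using \<rho>(3) by (metis zero_fun_apply)
qed

text \<open>
  If \<open>v = p w\<close>, choose \<open>\<sigma>\<close> with \<open>w \<odot> \<sigma>\<close> a nonzero \<open>p\<close>-torsion functional \<open>\<rho>\<close>. Then \<open>v\<close> kills \<open>\<sigma>\<close>,
  so \<open>u\<close> does too, and \<open>\<rho>\<close> is annihilated by the coprime polynomials \<open>u\<close> and \<open>p\<close>.
\<close>

lemma P_W_not_dvd_denominator: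
  assumes b: "dual_hom b" and uv: "coprime u v" "v \<noteq> 0"
    and rational: "\<And>\<rho>. \<rho> \<in> torsion_annihilator \<Longrightarrow> v \<odot> b \<rho> = u \<odot> \<rho>"
    and p: "p \<in> P_W scale"
  shows "\<not> p dvd v"
proof
  assume "p dvd v"
  then obtain w where w: "v = p * w" by (rule dvdE)
  then have "w \<noteq> 0" using uv(2) by auto
  obtain \<rho> where \<rho>: "\<rho> \<in> torsion_annihilator" "\<rho> \<noteq> 0" "p \<odot> \<rho> = 0" using P_W_annihilator[OF p] by blast
  obtain \<sigma> where \<sigma>: "\<sigma> \<in> torsion_annihilator" "w \<odot> \<sigma> = \<rho>"
    using torsion_annihilator_divisible[OF \<rho>(1) \<open>w \<noteq> 0\<close>] by blast
  note \<sigma>d = annihilator_subset_dual[OF \<sigma>(1)]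
  have "v \<odot> \<sigma> = 0" unfolding w using \<sigma>(2) \<rho>(3) by (simp flip: dual_act_act)
  then have "u \<odot> \<sigma> = 0" using rational[OF \<sigma>(1)] dual_hom_act[OF b \<sigma>d, of v] dual_hom_zero[OF b] by simp
  then have "u \<odot> \<rho> = 0" using \<sigma>(2) dual_act_commute[of \<sigma> w u] dual.act_zero_right[of w] by simp
  have "coprime u p" using uv(1) w by (metis coprime_mult_right_iff coprime_commute dvd_triv_left coprime_divisors dvd_refl)
  then obtain s t where "s * u + t * p = 1" using poly_coprime_bezout by blast
  then have "\<rho> = (s * u + t * p) \<odot> \<rho>" using dual.act_one[OF annihilator_subset_dual[OF \<rho>(1)]] by simp
  also have "\<dots> = s \<odot> u \<odot> \<rho> + t \<odot> p \<odot> \<rho>"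
    using dual.act_plus[OF annihilator_subset_dual[OF \<rho>(1)]] by (simp add: dual_act_act)
  also have "\<dots> = 0" using \<open>u \<odot> \<rho> = 0\<close> \<rho>(3) by (simp add: dual.act_zero_right)
  finally show False using \<rho>(2) by simp
qed

section \<open>Homomorphisms from the dual to cyclic modules\<close>

text \<open>
  The hypothesis on \<open>\<sigma>\<close> says that \<open>\<sigma>\<close> has order \<open>n\<close> modulo the \<open>n\<close>-fold multiples: evaluation at \<open>y\<close>
  detects \<open>q ^ k \<odot> \<sigma>\<close> and kills all \<open>n\<close>-fold multiples. Hence \<open>\<sigma> \<mapsto> 1\<close> defines a partial homomorphism
  to \<open>R/n\<close> that is zero on \<open>n\<close>-fold multiples, and self-injectivity of \<open>R/n\<close> extends it to \<open>g\<close>. As \<open>R/n\<close>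
  maps to the dual by \<open>1 \<mapsto> \<eta>\<close> whenever \<open>n\<close> kills \<open>\<eta>\<close>, there are endomorphisms taking \<open>\<sigma>\<close> to any
  such \<open>\<eta>\<close>. The last conclusion bounds the order of \<open>g \<rho>\<close> by that of \<open>\<rho>\<close>.
\<close>

lemma hom_to_cyclic_quotient:
  assumes q: "irreducible q" and \<sigma>: "\<sigma> \<in> dual scale"
    and n: "n = q ^ Suc k" and ny: "n *s y = 0" and \<sigma>y: "\<sigma> (q ^ k *s y) \<noteq> 0"
  shows "\<exists>g. (\<forall>\<eta>\<in>dual scale. n \<odot> \<eta> = 0 \<longrightarrow> dual_hom (\<lambda>\<rho>. g \<rho> \<odot> \<eta>) \<and> g \<sigma> \<odot> \<eta> = \<eta>) \<and>
             (\<forall>\<rho>\<in>dual scale. \<forall>p. p \<odot> \<rho> = 0 \<longrightarrow> n dvd p * g \<rho>)"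
proof -
  define D where "D = {d. d mod n = d}"
  define actD where "actD = (\<lambda>p d. (p * d) mod n)"
  interpret carrier_module_pair "dual scale" dual_act D actD
    unfolding D_def actD_def
    by (intro carrier_module_pair.intro carrier_module_dual carrier_module_residues)
  have n0: "n \<noteq> 0" using q n by auto
  define G where "G = {(p \<odot> \<sigma> + n \<odot> \<tau>, p mod n) | p \<tau>. \<tau> \<in> dual scale}"
  have mem: "(p \<odot> \<sigma> + n \<odot> \<tau>, p mod n) \<in> G" if "\<tau> \<in> dual scale" for p \<tau>
    using that unfolding G_def by blast
  have n_dvd: "n dvd p" if \<tau>: "\<tau> \<in> dual scale" and rel: "p \<odot> \<sigma> + n \<odot> \<tau> = 0" for p \<tau>
  proof (rule ccontr)
    assume np: "\<not> n dvd p"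
    then have "p \<noteq> 0" by auto
    then obtain j p' where p': "p = q ^ j * p'" "\<not> q dvd p'" using poly_split_power[OF q] by blast
    have "j \<le> k"
    proof (rule ccontr)
      assume "\<not> j \<le> k"
      then have "n dvd q ^ j" unfolding n by (intro le_imp_power_dvd) simp
      then show False using np p'(1) by simp
    qed
    obtain s t where st: "s * p' + t * q ^ 1 = 1" using irreducible_bezout_power[OF q p'(2)] by blast
    have "q ^ k = (s * p' + t * q ^ 1) * q ^ k" using st by simp
    also have "\<dots> = s * q ^ (k - j) * p + t * n"
      unfolding n p'(1) using \<open>j \<le> k\<close> by (simp add: algebra_simps flip: power_add)
    finally have "q ^ k *s y = p *s ((s * q ^ (k - j)) *s y) + t *s n *s y"
      by (simp add: scale_left_distrib mult.commute)
    then have "\<sigma> (q ^ k *s y) = (p \<odot> \<sigma>) ((s * q ^ (k - j)) *s y)"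
      using ny by (simp add: mult.commute)
    also have "p \<odot> \<sigma> = - (n \<odot> \<tau>)" using rel by (simp add: eq_neg_iff_add_eq_0)
    also have "(- (n \<odot> \<tau>)) ((s * q ^ (k - j)) *s y) = - \<tau> ((s * q ^ (k - j)) *s n *s y)"
      by (simp add: mult.commute)
    also have "\<dots> = 0" unfolding ny using dual_zero[OF \<tau>] by simp
    finally show False using \<sigma>y by simp
  qed
  have ph: "partial_hom G"
    unfolding partial_hom_def
  proof (intro conjI allI impI)
    show "G \<subseteq> dual scale \<times> D"
      unfolding G_def D_def using \<sigma> by (auto intro: dual.add_mem dual.act_mem)
    show "(0, 0) \<in> G" using mem[OF dual.zero_mem, of 0] dual.act_zero[OF \<sigma>] by (simp add: dual.act_zero_right)
    show "(x + x', d + d') \<in> G" if xd: "(x, d) \<in> G" and xd': "(x', d') \<in> G" for x d x' d'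
    proof -
      obtain p \<tau> p' \<tau>' where \<tau>: "\<tau> \<in> dual scale" "\<tau>' \<in> dual scale"
        and eq: "x = p \<odot> \<sigma> + n \<odot> \<tau>" "d = p mod n" "x' = p' \<odot> \<sigma> + n \<odot> \<tau>'" "d' = p' mod n"
        using xd xd' unfolding G_def by auto
      have "x + x' = (p + p') \<odot> \<sigma> + n \<odot> (\<tau> + \<tau>')" "d + d' = (p + p') mod n"
        unfolding eq using dual.act_plus[OF \<sigma>] dual.act_add[OF \<tau>] by (simp_all add: poly_mod_add_left add_ac)
      then show ?thesis using mem[OF dual.add_mem[OF \<tau>]] by simp
    qed
    show "(r \<odot> x, actD r d) \<in> G" if xd: "(x, d) \<in> G" for r x d
    proof -
      obtain p \<tau> where \<tau>: "\<tau> \<in> dual scale" and eq: "x = p \<odot> \<sigma> + n \<odot> \<tau>" "d = p mod n"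
        using xd unfolding G_def by auto
      have "r \<odot> x = (r * p) \<odot> \<sigma> + n \<odot> r \<odot> \<tau>" "actD r d = (r * p) mod n"
        unfolding eq actD_def using dual.act_add[OF dual.act_mem[OF \<sigma>] dual.act_mem[OF \<tau>]]
        by (simp_all add: dual_act_act mult.commute mod_mult_right_eq)
      then show ?thesis using mem[OF dual.act_mem[OF \<tau>]] by simp
    qed
    show "d = 0" if d0: "(0, d) \<in> G" for d
    proof -
      obtain p \<tau> where "\<tau> \<in> dual scale" "p \<odot> \<sigma> + n \<odot> \<tau> = 0" "d = p mod n" using d0 unfolding G_def by auto
      then show ?thesis using n_dvd by (simp add: mod_eq_0_iff_dvd)
    qed
  qed
  have solvable: "\<exists>d\<in>D. actD p d = e"
    if e: "e \<in> D" and kill: "\<And>s. (\<And>\<rho>. \<rho> \<in> dual scale \<Longrightarrow> ((s * p) \<odot> \<rho>, 0) \<in> G) \<Longrightarrow> actD s e = 0" for p e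
  proof -
    obtain g x y where g: "g = x * p + y * n" "g dvd p" "g dvd n" using poly_bezout_gcd by metis
    obtain p' where p': "p = g * p'" using g(2) by (rule dvdE)
    obtain n' where n': "n = g * n'" using g(3) by (rule dvdE)
    \<comment> \<open>with \<open>g = gcd p n\<close>, multiplication by \<open>n' = n / g\<close> takes \<open>p\<close> to a multiple of \<open>n\<close>\<close>
    have "actD n' e = 0"
    proof (rule kill)
      fix \<rho> assume \<rho>: "\<rho> \<in> dual scale"
      have "(n' * p) \<odot> \<rho> = 0 \<odot> \<sigma> + n \<odot> p' \<odot> \<rho>"
        unfolding p' n' using dual.act_zero[OF \<sigma>] by (simp add: dual_act_act algebra_simps)
      then show "((n' * p) \<odot> \<rho>, 0) \<in> G" using mem[OF dual.act_mem[OF \<rho>], of 0 p'] by simp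
    qed
    then have "g * n' dvd n' * e" unfolding actD_def n'[symmetric] by (simp add: mod_eq_0_iff_dvd)
    moreover have "n' \<noteq> 0" using n' n0 by auto
    ultimately have "g dvd e" by (simp add: mult.commute[of g])
    then obtain e' where e': "e = g * e'" by (rule dvdE)
    have "p * (x * e') = e - n * (y * e')" unfolding e' g(1) by (simp add: algebra_simps)
    also have "(e - n * (y * e')) mod n = e" using e by (simp add: D_def poly_mod_diff_left)
    finally have "(p * (x * e')) mod n = e" .
    then have "actD p ((x * e') mod n) = e" by (simp add: actD_def mod_mult_right_eq)
    then show ?thesis by (intro bexI[of _ "(x * e') mod n"]) (simp_all add: D_def)
  qed
  from partial_hom_extends[OF ph solvable]
  obtain g where g: "\<forall>\<rho>\<in>dual scale. \<forall>\<tau>\<in>dual scale. g (\<rho> + \<tau>) = g \<rho> + g \<tau>"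
      "\<forall>\<rho>\<in>dual scale. \<forall>p. g (p \<odot> \<rho>) = actD p (g \<rho>)" "\<forall>(\<rho>, d)\<in>G. g \<rho> = d"
    by metis
  have gadd: "g (\<rho> + \<tau>) = g \<rho> + g \<tau>" if "\<rho> \<in> dual scale" "\<tau> \<in> dual scale" for \<rho> \<tau>
    using g(1) that by simp
  have gact: "g (p \<odot> \<rho>) = (p * g \<rho>) mod n" if "\<rho> \<in> dual scale" for \<rho> p
    using g(2) that unfolding actD_def by simp
  have gG: "g \<rho> = d" if "(\<rho>, d) \<in> G" for \<rho> d
    using g(3) that by auto
  have mod_act: "(p mod n) \<odot> \<eta> = p \<odot> \<eta>" if \<eta>: "\<eta> \<in> dual scale" "n \<odot> \<eta> = 0" for p \<eta>
  proof -
    have "p \<odot> \<eta> = (p div n * n + p mod n) \<odot> \<eta>" by simp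
    also have "\<dots> = (p div n) \<odot> n \<odot> \<eta> + (p mod n) \<odot> \<eta>"
      using dual.act_plus[OF \<eta>(1)] by (simp only: dual_act_act)
    finally show ?thesis using \<eta>(2) by (simp add: dual.act_zero_right)
  qed
  show ?thesis
  proof (intro exI[of _ g] conjI ballI allI impI)
    fix \<eta> assume \<eta>: "\<eta> \<in> dual scale" "n \<odot> \<eta> = 0"
    show "dual_hom (\<lambda>\<rho>. g \<rho> \<odot> \<eta>)"
      unfolding dual_hom_def
      using gadd gact mod_act[OF \<eta>] dual.act_mem[OF \<eta>(1)] dual.act_plus[OF \<eta>(1)]
      by (simp add: dual_act_act)
    have "(1 \<odot> \<sigma> + n \<odot> 0, 1 mod n) \<in> G" by (rule mem[OF dual.zero_mem])
    then have "g \<sigma> = 1 mod n" using gG dual.act_one[OF \<sigma>] dual.act_zero_right by simp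
    then show "g \<sigma> \<odot> \<eta> = \<eta>" using mod_act[OF \<eta>, of 1] dual.act_one[OF \<eta>(1)] by simp
  next
    fix \<rho> p assume \<rho>: "\<rho> \<in> dual scale" "p \<odot> \<rho> = 0"
    have "g 0 = 0" using gadd[OF dual.zero_mem dual.zero_mem] by (metis add.right_neutral add_left_cancel)
    then have "(p * g \<rho>) mod n = 0" using gact[OF \<rho>(1), of p] \<rho>(2) by simp
    then show "n dvd p * g \<rho>" by (simp add: mod_eq_0_iff_dvd)
  qed
qed

section \<open>Central endomorphisms on a primary part\<close>

lemma primary_exact_order:
  assumes x: "x \<in> primary_part scale q" "q ^ j *s x \<noteq> 0"
  shows "\<exists>k\<ge>j. q ^ k *s x \<noteq> 0 \<and> q ^ Suc k *s x = 0"
proof -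
  obtain m where "q ^ m *s x = 0" using x(1) by (auto simp: primary_part_def)
  then have "\<exists>k. q ^ k *s x \<noteq> 0 \<and> \<not> q ^ Suc k *s x \<noteq> 0 \<and> k < m"
    using x(2) power_scale_mono[of q 0 x j] by (intro exists_exact_power) auto
  then obtain k where k: "q ^ k *s x \<noteq> 0" "q ^ Suc k *s x = 0" by blast
  have "j \<le> k"
  proof (rule ccontr)
    assume "\<not> j \<le> k"
    then show False using power_scale_mono[OF k(2), of j] x(2) by simp
  qed
  then show ?thesis using k by blast
qed

lemma dual_act_linear_combination:
  assumes "\<eta> \<in> dual scale" "s * p + t * r = 1"
  shows "\<eta> = s \<odot> p \<odot> \<eta> + t \<odot> r \<odot> \<eta>"
  using dual.act_plus[OF assms(1), of "s * p" "t * r"] dual.act_one[OF assms(1)] assms(2)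
  by (simp add: dual_act_act)

text \<open>
  With \<open>n\<close> the exact exponent of the primary part, the endomorphisms \<open>\<rho> \<mapsto> g \<rho> \<odot> \<eta>\<close> send one functional
  \<open>\<sigma>0\<close> to all functionals \<open>\<eta>\<close> that \<open>n\<close> kills. A central \<open>b\<close> therefore multiplies all of them by the
  same polynomial \<open>g (b \<sigma>0)\<close>. By locality these functionals suffice, because every functional agrees on
  the primary part with one that vanishes on \<open>n V\<close>.
\<close>

lemma central_on_bounded_primary:
  assumes b: "dual_central b" and q: "irreducible q"
    and bounded: "\<And>x. x \<in> primary_part scale q \<Longrightarrow> q ^ m *s x = 0"
  shows "\<exists>f. \<forall>\<sigma>\<in>dual scale. \<forall>x\<in>primary_part scale q. b \<sigma> x = \<sigma> (f *s x)"
proof (cases "primary_part scale q \<subseteq> {0}")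
  case True
  then have zero: "x = 0" if "x \<in> primary_part scale q" for x using that by blast
  have "b \<sigma> x = \<sigma> (0 *s x)" if \<sigma>: "\<sigma> \<in> dual scale" and x: "x \<in> primary_part scale q" for \<sigma> x
    unfolding zero[OF x] using dual_zero[OF \<sigma>] dual_zero[OF dual_hom_mem[OF dual_central_hom[OF b] \<sigma>]] by simp
  then show ?thesis by blast
next
  case False
  note bh = dual_central_hom[OF b]
  have q0: "q \<noteq> 0" using q by auto
  define nontrivial where "nontrivial j \<longleftrightarrow> (\<exists>x\<in>primary_part scale q. q ^ j *s x \<noteq> 0)" for j
  have "nontrivial 0" using False unfolding nontrivial_def by auto
  moreover have "\<not> nontrivial m" using bounded unfolding nontrivial_def by auto
  ultimately obtain k where k: "nontrivial k" "\<not> nontrivial (Suc k)"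
    using exists_exact_power[of nontrivial m] by blast
  define n where "n = q ^ Suc k"
  have kill: "n *s x = 0" if "x \<in> primary_part scale q" for x
    using k(2) that unfolding nontrivial_def n_def by blast
  obtain y where y: "y \<in> primary_part scale q" "q ^ k *s y \<noteq> 0" using k(1) unfolding nontrivial_def by blast
  obtain \<sigma>0 where \<sigma>0: "\<sigma>0 \<in> dual scale" "\<sigma>0 (q ^ k *s y) \<noteq> 0"
    using functionals_separate_points[of "q ^ k *s y" 0] y(2) dual_zero by metis
  obtain g where g: "\<And>\<eta>. \<eta> \<in> dual scale \<Longrightarrow> n \<odot> \<eta> = 0 \<Longrightarrow> dual_hom (\<lambda>\<rho>. g \<rho> \<odot> \<eta>) \<and> g \<sigma>0 \<odot> \<eta> = \<eta>"
    using hom_to_cyclic_quotient[OF q \<sigma>0(1) n_def kill[OF y(1)] \<sigma>0(2)] by metis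
  define f where "f = g (b \<sigma>0)"
  have b_eq: "b \<eta> = f \<odot> \<eta>" if \<eta>: "\<eta> \<in> dual scale" "n \<odot> \<eta> = 0" for \<eta>
    using dual_central_commute[OF b conjunct1[OF g[OF \<eta>]] \<sigma>0(1)] g[OF \<eta>] unfolding f_def by simp
  have "b \<sigma> x = \<sigma> (f *s x)" if \<sigma>: "\<sigma> \<in> dual scale" and x: "x \<in> primary_part scale q" for \<sigma> x
  proof -
    have "\<exists>\<eta>\<in>dual scale. (\<forall>x\<in>primary_part scale q. \<eta> x = \<sigma> x) \<and> (\<forall>x\<in>range (scale n). \<eta> x = 0)"
    proof (rule functional_extends_by_zero[OF \<sigma> subspace_primary subspace_range_scale])
      show "x = 0" if x: "x \<in> primary_part scale q" and range: "x \<in> range (scale n)" for x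
      proof -
        obtain x' where x': "x = n *s x'" using range by blast
        obtain l where "q ^ l *s x = 0" using x by (auto simp: primary_part_def)
        then have "q ^ (l + Suc k) *s x' = 0" unfolding x' n_def by (simp add: power_add mult_ac)
        then have "x' \<in> primary_part scale q" using mem_primary_iff[OF q0] by blast
        then show ?thesis unfolding x' by (rule kill)
      qed
    qed
    then obtain \<eta> where \<eta>: "\<eta> \<in> dual scale" "\<And>x. x \<in> primary_part scale q \<Longrightarrow> \<eta> x = \<sigma> x"
      and \<eta>0: "\<And>y. \<eta> (n *s y) = 0" by blast
    have "n \<odot> \<eta> = 0" using \<eta>0 by (simp add: fun_eq_iff)
    then have "b \<eta> = f \<odot> \<eta>" by (rule b_eq[OF \<eta>(1)])
    moreover have "b \<sigma> x = b \<eta> x"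
      using dual_hom_eq_on_primary[OF bh \<sigma> \<eta>(1) q0 _ x] \<eta>(2) by simp
    ultimately show ?thesis using \<eta>(2)[OF primary_scale[OF x, of f]] by simp
  qed
  then show ?thesis by blast
qed

text \<open>
  If the chain becomes stationary, one vector of the smallest member suffices. Otherwise choose a
  vector from each proper step; these vectors are linearly independent, and the functional may be
  prescribed as \<open>1\<close> on all of them.
\<close>

lemma functional_nonzero_on_chain:
  assumes zero: "\<And>m. 0 \<in> U m"
    and add: "\<And>m x y. x \<in> U m \<Longrightarrow> y \<in> U m \<Longrightarrow> x + y \<in> U m"
    and scalar: "\<And>m a x. x \<in> U m \<Longrightarrow> [:a:] *s x \<in> U m"
    and decreasing: "\<And>m. U (Suc m) \<subseteq> U m"
    and nontrivial: "\<And>m. \<exists>x\<in>U m. x \<noteq> 0"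
  shows "\<exists>\<sigma>\<in>dual scale. \<forall>m. \<exists>x\<in>U m. \<sigma> x \<noteq> 0"
proof -
  have antimono: "U l \<subseteq> U m" if "m \<le> l" for m l
    using lift_Suc_antimono_le[of U, OF decreasing that] .
  define H where "H = {m. \<exists>x. x \<in> U m \<and> x \<notin> U (Suc m)}"
  show ?thesis
  proof (cases "finite H")
    case True
    then obtain M where M: "\<And>m. m \<in> H \<Longrightarrow> m < M" using finite_nat_set_iff_bounded by auto
    have stable: "U M \<subseteq> U m" for m
    proof (induction m)
      case 0
      show ?case using antimono[of 0 M] by simp
    next
      case (Suc m)
      show ?case
      proof (cases "Suc m \<le> M")
        case True
        then show ?thesis by (rule antimono)
      next
        case False
        then have "m \<notin> H" using M by force
        then show ?thesis using Suc unfolding H_def by blast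
      qed
    qed
    obtain x where x: "x \<in> U M" "x \<noteq> 0" using nontrivial by blast
    obtain \<sigma> where \<sigma>: "\<sigma> \<in> dual scale" "\<sigma> x \<noteq> 0"
      using functionals_separate_points[of x 0] x(2) dual_zero by metis
    have "\<exists>x\<in>U m. \<sigma> x \<noteq> 0" for m using stable[of m] x(1) \<sigma>(2) by blast
    then show ?thesis using \<sigma>(1) by blast
  next
    case False
    interpret vs: vector_space_pair "field_scale scale" "(*) :: 'a \<Rightarrow> 'a \<Rightarrow> 'a"
      by (rule vector_space_pair_field)
    define z where "z m = (SOME x. x \<in> U m \<and> x \<notin> U (Suc m))" for m
    have z: "z m \<in> U m" "z m \<notin> U (Suc m)" if m: "m \<in> H" for m
    proof -
      obtain x where "x \<in> U m \<and> x \<notin> U (Suc m)" using m unfolding H_def by blast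
      then have "z m \<in> U m \<and> z m \<notin> U (Suc m)" unfolding z_def by (rule someI)
      then show "z m \<in> U m" "z m \<notin> U (Suc m)" by simp_all
    qed
    have subspace: "vs.vs1.subspace (U m)" for m
      by (rule vs.vs1.subspaceI) (simp_all add: zero add scalar field_scale_def)
    have fin: "vs.vs1.independent (z ` A)" if "finite A" "A \<subseteq> H" for A
      using that
    proof (induction A rule: finite_linorder_min_induct)
      case empty
      show ?case unfolding image_empty by (rule vs.vs1.independent_empty)
    next
      case (insert m A)
      have "z ` A \<subseteq> U (Suc m)"
      proof
        fix x assume "x \<in> z ` A"
        then obtain l where l: "l \<in> A" "x = z l" by blast
        have "x \<in> U l" using z(1)[of l] l insert.prems by blast
        then show "x \<in> U (Suc m)" using antimono[of "Suc m" l] insert.hyps(2) l(1) by force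
      qed
      then have "vs.vs1.span (z ` A) \<subseteq> U (Suc m)" by (rule vs.vs1.span_minimal[OF _ subspace])
      then have "z m \<notin> vs.vs1.span (z ` A)" using z(2)[of m] insert.prems by blast
      then show ?case using insert by (simp add: vs.vs1.independent_insertI)
    qed
    have "vs.vs1.independent (z ` H)"
    proof
      assume "vs.vs1.dependent (z ` H)"
      then obtain t u where t: "finite t" "t \<subseteq> z ` H" "(\<Sum>v\<in>t. field_scale scale (u v) v) = 0" "\<exists>v\<in>t. u v \<noteq> 0"
        unfolding vs.vs1.dependent_explicit by blast
      obtain A where A: "A \<subseteq> H" "finite A" "t = z ` A" using finite_subset_image[OF t(1,2)] by blast
      have "vs.vs1.dependent t" unfolding vs.vs1.dependent_explicit using t by blast
      then show False using fin[OF A(2,1)] A(3) by simp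
    qed
    then obtain \<sigma> where lin: "Vector_Spaces.linear (field_scale scale) (*) \<sigma>" and \<sigma>: "\<forall>x\<in>z ` H. \<sigma> x = 1"
      using vs.linear_independent_extend[of "z ` H" "\<lambda>_. 1"] by metis
    have "\<sigma> \<in> dual scale" using lin by (simp add: dual_def)
    moreover have "\<exists>x\<in>U m. \<sigma> x \<noteq> 0" for m
    proof -
      obtain l where l: "l \<in> H" "m < l" using False infinite_nat_iff_unbounded by blast
      have "z l \<in> U m" using z(1)[OF l(1)] antimono[of m l] l(2) by auto
      moreover have "\<sigma> (z l) \<noteq> 0" using \<sigma> l(1) by simp
      ultimately show ?thesis by blast
    qed
    ultimately show ?thesis by blast
  qed
qed

text \<open>
  The chain consists of the elements that \<open>q\<close> kills and that are divisible by \<open>q ^ m\<close>.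
\<close>

lemma unbounded_primary_functional:
  assumes q: "irreducible q" and unbounded: "\<And>m. \<exists>x\<in>primary_part scale q. q ^ m *s x \<noteq> 0"
  shows "\<exists>\<sigma>\<in>dual scale. \<forall>k. \<exists>y. q ^ Suc k *s y = 0 \<and> \<sigma> (q ^ k *s y) \<noteq> 0"
proof -
  define U where "U m = {x. \<exists>y. x = q ^ m *s y \<and> q ^ Suc m *s y = 0}" for m :: nat
  have mem: "q ^ m *s y \<in> U m" if "q ^ Suc m *s y = 0" for m y using that unfolding U_def by blast
  have "\<exists>\<sigma>\<in>dual scale. \<forall>m. \<exists>x\<in>U m. \<sigma> x \<noteq> 0"
  proof (rule functional_nonzero_on_chain)
    show "0 \<in> U m" for m using mem[of m 0] by simp
    show "x + x' \<in> U m" if x: "x \<in> U m" "x' \<in> U m" for m x x'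
    proof -
      obtain y y' where y: "x = q ^ m *s y" "q ^ Suc m *s y = 0" "x' = q ^ m *s y'" "q ^ Suc m *s y' = 0"
        using x unfolding U_def by blast
      then have "q ^ Suc m *s (y + y') = 0" by (simp only: scale_right_distrib add_0)
      from mem[OF this] show ?thesis using y by (simp add: scale_right_distrib)
    qed
    show "[:a:] *s x \<in> U m" if x: "x \<in> U m" for m a x
    proof -
      obtain y where y: "x = q ^ m *s y" "q ^ Suc m *s y = 0" using x unfolding U_def by blast
      then have "q ^ Suc m *s [:a:] *s y = 0" by (metis scale_left_commute scale_zero_right)
      from mem[OF this] show ?thesis using y by (simp add: mult.commute)
    qed
    show "U (Suc m) \<subseteq> U m" for m
    proof
      fix x assume "x \<in> U (Suc m)"
      then obtain y where y: "x = q ^ Suc m *s y" "q ^ Suc (Suc m) *s y = 0" unfolding U_def by blast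
      have "q ^ Suc m *s q *s y = 0" using y(2) by (simp add: mult_ac)
      from mem[OF this] show "x \<in> U m" using y(1) by (simp add: mult.commute)
    qed
    show "\<exists>x\<in>U m. x \<noteq> 0" for m
    proof -
      obtain x where x: "x \<in> primary_part scale q" "q ^ m *s x \<noteq> 0" using unbounded by blast
      obtain k where k: "k \<ge> m" "q ^ k *s x \<noteq> 0" "q ^ Suc k *s x = 0" using primary_exact_order[OF x] by blast
      have "q ^ Suc m *s q ^ (k - m) *s x = 0" using k(1,3) by (simp flip: power_add power_Suc)
      from mem[OF this] have "q ^ k *s x \<in> U m" using k(1) by (simp flip: power_add)
      then show ?thesis using k(2) by blast
    qed
  qed
  then obtain \<sigma> where \<sigma>: "\<sigma> \<in> dual scale" "\<And>m. \<exists>x\<in>U m. \<sigma> x \<noteq> 0" by blast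
  have "\<exists>y. q ^ Suc k *s y = 0 \<and> \<sigma> (q ^ k *s y) \<noteq> 0" for k using \<sigma>(2)[of k] unfolding U_def by blast
  then show ?thesis using \<sigma>(1) by blast
qed

definition torsion_valued :: "(('v \<Rightarrow> 'a) \<Rightarrow> ('v \<Rightarrow> 'a)) \<Rightarrow> bool" where
  "torsion_valued h \<longleftrightarrow> (\<forall>\<rho>\<in>dual scale. \<exists>p. p \<noteq> 0 \<and> p \<odot> h \<rho> = 0)"

lemma torsion_value_split:
  assumes h: "dual_hom h" "torsion_valued h" and q: "irreducible q" and \<sigma>: "\<sigma> \<in> dual scale"
  shows "\<exists>k p. \<not> q dvd p \<and> q ^ k \<odot> p \<odot> h \<sigma> = 0"
proof -
  obtain p where p: "p \<noteq> 0" "p \<odot> h \<sigma> = 0" using h(2) \<sigma> unfolding torsion_valued_def by blast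
  obtain k p' where p': "p = q ^ k * p'" "\<not> q dvd p'" using poly_split_power[OF q p(1)] by blast
  then have "q ^ k \<odot> p' \<odot> h \<sigma> = 0" using p(2) by (simp add: dual_act_act)
  then show ?thesis using p'(2) by blast
qed

text \<open>
  An unbounded primary part provides a single functional \<open>\<sigma>\<close> that can be sent to \<open>1\<close> in \<open>R/q ^ m\<close> for
  all \<open>m\<close>. The order of \<open>h \<sigma>\<close> is fixed, so for large \<open>m\<close> the image of \<open>h \<sigma>\<close> in \<open>R/q ^ m\<close> is divisible
  by a high power of \<open>q\<close>, which kills \<open>\<eta>\<close>. But this image times \<open>\<eta>\<close> is \<open>h \<eta>\<close>.
\<close>

lemma central_vanishes_on_q_torsion:
  assumes h: "dual_central h" "torsion_valued h" and q: "irreducible q"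
    and unbounded: "\<And>m. \<exists>x\<in>primary_part scale q. q ^ m *s x \<noteq> 0"
    and \<eta>: "\<eta> \<in> dual scale" "q ^ j \<odot> \<eta> = 0"
  shows "h \<eta> = 0"
proof -
  note hh = dual_central_hom[OF h(1)]
  obtain \<sigma> where \<sigma>: "\<sigma> \<in> dual scale" "\<And>k. \<exists>y. q ^ Suc k *s y = 0 \<and> \<sigma> (q ^ k *s y) \<noteq> 0"
    using unbounded_primary_functional[OF q unbounded] by blast
  obtain k p where p: "\<not> q dvd p" "q ^ k \<odot> p \<odot> h \<sigma> = 0" using torsion_value_split[OF hh h(2) q \<sigma>(1)] by blast
  define n where "n = q ^ Suc (j + k)"
  obtain y where y: "n *s y = 0" "\<sigma> (q ^ (j + k) *s y) \<noteq> 0" using \<sigma>(2)[of "j + k"] unfolding n_def by blast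
  have "n \<odot> \<eta> = q ^ Suc k \<odot> q ^ j \<odot> \<eta>" unfolding n_def by (simp add: dual_act_act power_add mult_ac)
  then have n\<eta>: "n \<odot> \<eta> = 0" using \<eta>(2) by (simp add: dual.act_zero_right)
  obtain g where g: "dual_hom (\<lambda>\<rho>. g \<rho> \<odot> \<eta>)" "g \<sigma> \<odot> \<eta> = \<eta>"
      "\<And>\<rho> p. \<rho> \<in> dual scale \<Longrightarrow> p \<odot> \<rho> = 0 \<Longrightarrow> n dvd p * g \<rho>"
    using hom_to_cyclic_quotient[OF q \<sigma>(1) n_def y] \<eta>(1) n\<eta> by metis
  have "(q ^ k * p) \<odot> h \<sigma> = 0" using p(2) by (simp add: dual_act_act)
  then have dvd: "n dvd (q ^ k * p) * g (h \<sigma>)" by (rule g(3)[OF dual_hom_mem[OF hh \<sigma>(1)]])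
  have n_eq: "n = q ^ k * q ^ Suc j" unfolding n_def by (simp add: power_add mult_ac)
  have "q ^ k \<noteq> 0" using q by auto
  then have "q ^ Suc j dvd p * g (h \<sigma>)"
    using dvd unfolding n_eq mult.assoc[of "q ^ k" p] dvd_mult_cancel_left by blast
  then have "q ^ Suc j dvd g (h \<sigma>)" by (rule irreducible_power_dvd_cancel[OF q p(1)])
  then obtain c where "g (h \<sigma>) = q ^ Suc j * c" by (rule dvdE)
  then have "g (h \<sigma>) = (q * c) * q ^ j" by simp
  then have "g (h \<sigma>) \<odot> \<eta> = (q * c) \<odot> q ^ j \<odot> \<eta>" by (simp add: dual_act_act)
  also have "\<dots> = 0" using \<eta>(2) by (simp add: dual.act_zero_right)
  finally have "g (h \<sigma>) \<odot> \<eta> = 0" .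
  then show ?thesis using dual_central_commute[OF h(1) g(1) \<sigma>(1)] g(2) by simp
qed

text \<open>
  This goes beyond the preceding lemma, since the dual of a divisible primary part is torsion-free.
  Suppose that \<open>h \<sigma>\<close> is nonzero on the primary part. A multiple \<open>\<chi>\<close> of \<open>h \<sigma>\<close> is still nonzero on it,
  but \<open>q \<odot> \<chi>\<close> is zero on it. If \<open>z\<close> has the least order \<open>q ^ Suc l\<close> among the elements with \<open>\<chi> z \<noteq> 0\<close>,
  then \<open>\<chi> = q ^ l \<odot> \<chi>'\<close>, where \<open>\<chi>'\<close> can be sent to a \<open>q\<close>-torsion functional \<open>\<eta>\<close> that is nonzero at
  \<open>q ^ l *s z\<close>. The same endomorphism sends \<open>\<chi>\<close> to \<open>q ^ l \<odot> \<eta> \<noteq> 0\<close>. On the other hand, \<open>\<chi>\<close> lies in the image of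
  \<open>h\<close>, so this value is \<open>h\<close> of a \<open>q\<close>-torsion functional, hence zero.
\<close>

lemma central_vanishes_on_unbounded_primary:
  assumes h: "dual_central h" "torsion_valued h" and q: "irreducible q"
    and unbounded: "\<And>m. \<exists>x\<in>primary_part scale q. q ^ m *s x \<noteq> 0"
    and \<sigma>: "\<sigma> \<in> dual scale" and x: "x \<in> primary_part scale q"
  shows "h \<sigma> x = 0"
proof (rule ccontr)
  assume hx: "h \<sigma> x \<noteq> 0"
  note hh = dual_central_hom[OF h(1)]
  have q0: "q \<noteq> 0" using q by auto
  note q_torsion = central_vanishes_on_q_torsion[OF h q unbounded]
  obtain k p where p: "\<not> q dvd p" "q ^ k \<odot> p \<odot> h \<sigma> = 0" using torsion_value_split[OF hh h(2) q \<sigma>] by blast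
  define nonvanishing where "nonvanishing j \<longleftrightarrow> (\<exists>z\<in>primary_part scale q. h \<sigma> (q ^ j *s z) \<noteq> 0)" for j
  have "\<not> nonvanishing k"
  proof -
    have "h \<sigma> (q ^ k *s z) = 0" if z: "z \<in> primary_part scale q" for z
    proof -
      obtain z' where z': "z = p *s z'" using primary_coprime_divide[OF q p(1) z] by blast
      have "h \<sigma> (q ^ k *s z) = (q ^ k \<odot> p \<odot> h \<sigma>) z'" unfolding z' by (simp add: mult.commute)
      then show ?thesis using p(2) by simp
    qed
    then show ?thesis unfolding nonvanishing_def by blast
  qed
  moreover have "nonvanishing 0" using hx x unfolding nonvanishing_def by auto
  ultimately obtain j where j: "nonvanishing j" "\<not> nonvanishing (Suc j)" using exists_exact_power[of nonvanishing k] by blast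
  define \<chi> where "\<chi> = q ^ j \<odot> h \<sigma>"
  have \<chi>h: "\<chi> = h (q ^ j \<odot> \<sigma>)" unfolding \<chi>_def using dual_hom_act[OF hh \<sigma>] by simp
  have \<chi>: "\<chi> \<in> dual scale" unfolding \<chi>_def by (intro dual.act_mem dual_hom_mem[OF hh \<sigma>])
  have q\<chi>: "\<chi> (q *s z) = 0" if "z \<in> primary_part scale q" for z
    using j(2) that unfolding nonvanishing_def \<chi>_def by (simp add: mult.commute)
  define visible where "visible i \<longleftrightarrow> (\<exists>z. q ^ i *s z = 0 \<and> \<chi> z \<noteq> 0)" for i
  obtain z0 where z0: "z0 \<in> primary_part scale q" "\<chi> z0 \<noteq> 0"
    using j(1) unfolding nonvanishing_def \<chi>_def by auto
  then obtain i where "visible i" unfolding visible_def by (auto simp: primary_part_def)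
  moreover have "\<not> visible 0" unfolding visible_def using dual_zero[OF \<chi>] by auto
  ultimately obtain l where l: "\<not> visible l" "visible (Suc l)"
    using exists_exact_power[of "\<lambda>i. \<not> visible i" i] by auto
  obtain z where z: "q ^ Suc l *s z = 0" "\<chi> z \<noteq> 0" using l(2) unfolding visible_def by blast
  have \<chi>l: "\<chi> w = 0" if "q ^ l *s w = 0" for w using l(1) that unfolding visible_def by blast
  obtain \<chi>' where \<chi>': "\<chi>' \<in> dual scale" "q ^ l \<odot> \<chi>' = \<chi>" using functional_divide[OF \<chi> \<chi>l] by blast
  have "\<chi>' (q ^ l *s z) \<noteq> 0" using z(2) \<chi>'(2) by (metis dual_act_apply)
  define n where "n = q ^ Suc l"
  define U where "U = range (scale n)"
  have "q ^ l *s z \<notin> U"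
  proof
    \<comment> \<open>otherwise \<open>z\<close> could be replaced by \<open>z - q *s w\<close>, of smaller order and with the same value of \<open>\<chi>\<close>\<close>
    assume "q ^ l *s z \<in> U"
    then obtain w where w: "q ^ l *s z = n *s w" unfolding U_def by blast
    have "q ^ l *s (z - q *s w) = 0" using w unfolding n_def by (simp add: scale_right_diff_distrib mult.commute)
    then have "\<chi> (z - q *s w) = 0" by (rule \<chi>l)
    moreover have "q ^ Suc l *s n *s w = 0" unfolding w[symmetric] using z(1) by (metis scale_left_commute scale_zero_right)
    then have "q ^ (Suc l + Suc l) *s w = 0" unfolding n_def by (simp add: power_add mult_ac)
    then have "w \<in> primary_part scale q" using mem_primary_iff[OF q0] by blast
    then have "\<chi> (q *s w) = 0" by (rule q\<chi>)
    ultimately show False using z(2) dual_diff[OF \<chi>] by simp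
  qed
  moreover have "subspace U" unfolding U_def by (rule subspace_range_scale)
  ultimately obtain \<eta> where \<eta>: "\<eta> \<in> dual scale" "\<forall>x\<in>U. \<eta> x = 0" "\<eta> (q ^ l *s z) \<noteq> 0"
    using functional_separates by metis
  have "\<eta> (n *s w) = 0" for w using \<eta>(2) unfolding U_def by blast
  then have n\<eta>: "n \<odot> \<eta> = 0" by (simp add: fun_eq_iff)
  have nz: "n *s z = 0" using z(1) unfolding n_def .
  obtain g where g: "dual_hom (\<lambda>\<rho>. g \<rho> \<odot> \<eta>)" "g \<chi>' \<odot> \<eta> = \<eta>"
    using hom_to_cyclic_quotient[OF q \<chi>'(1) n_def nz \<open>\<chi>' (q ^ l *s z) \<noteq> 0\<close>] \<eta>(1) n\<eta> by metis
  define \<tau> where "\<tau> = q ^ j \<odot> \<sigma>"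
  have \<tau>: "\<tau> \<in> dual scale" unfolding \<tau>_def by (rule dual.act_mem[OF \<sigma>])
  have "n \<odot> g \<tau> \<odot> \<eta> = 0" using n\<eta> dual_act_commute[where p = n and s = "g \<tau>" and \<rho> = \<eta>] by (simp add: dual.act_zero_right)
  then have "h (g \<tau> \<odot> \<eta>) = 0" using q_torsion[OF dual.act_mem[OF \<eta>(1)]] unfolding n_def by blast
  then have "g \<chi> \<odot> \<eta> = 0" using dual_central_commute[OF h(1) g(1) \<tau>] \<chi>h unfolding \<tau>_def by simp
  moreover have "g \<chi> \<odot> \<eta> = q ^ l \<odot> \<eta>" using dual_hom_act[OF g(1) \<chi>'(1), of "q ^ l"] g(2) \<chi>'(2) by simp
  ultimately have "(q ^ l \<odot> \<eta>) z = 0" by simp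
  then show False using \<eta>(3) by simp
qed

text \<open>
  The dual of \<open>W\<close> contains a nonzero \<open>q\<close>-torsion functional \<open>\<rho>\<close>. If \<open>h \<sigma>\<close> is nonzero on the primary
  part, the image of \<open>h\<close> contains a nonzero \<open>\<chi>\<close> killed by \<open>q\<close>, and \<open>\<chi> \<mapsto> \<rho>\<close> extends to a homomorphism
  into the dual of \<open>W\<close>. Commuting it with \<open>h\<close> gives \<open>\<rho> = 0\<close>, as \<open>h\<close> kills the dual of \<open>W\<close>.
\<close>

lemma central_vanishes_on_P_W_primary:
  assumes h: "dual_central h" "torsion_valued h" and ann: "\<And>\<rho>. \<rho> \<in> torsion_annihilator \<Longrightarrow> h \<rho> = 0"
    and q: "q \<in> P_W scale" and \<sigma>: "\<sigma> \<in> dual scale" and x: "x \<in> primary_part scale q"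
  shows "h \<sigma> x = 0"
proof (rule ccontr)
  assume hx: "h \<sigma> x \<noteq> 0"
  note hh = dual_central_hom[OF h(1)]
  have irr: "irreducible q" using q by (simp add: P_W_def prime_poly_irreducible)
  obtain k p where p: "\<not> q dvd p" "q ^ k \<odot> p \<odot> h \<sigma> = 0" using torsion_value_split[OF hh h(2) irr \<sigma>] by blast
  obtain x' where x': "x = p *s x'" using primary_coprime_divide[OF irr p(1) x] by blast
  have "p \<odot> h \<sigma> \<noteq> 0"
  proof
    assume "p \<odot> h \<sigma> = 0"
    then have "(p \<odot> h \<sigma>) x' = 0" by simp
    then show False using hx x' by simp
  qed
  then have "\<exists>j. q ^ j \<odot> p \<odot> h \<sigma> \<noteq> 0 \<and> \<not> q ^ Suc j \<odot> p \<odot> h \<sigma> \<noteq> 0 \<and> j < k"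
    using p(2) dual.act_one[OF dual.act_mem[OF dual_hom_mem[OF hh \<sigma>]]] by (intro exists_exact_power) simp_all
  then obtain j where j: "q ^ j \<odot> p \<odot> h \<sigma> \<noteq> 0" "q ^ Suc j \<odot> p \<odot> h \<sigma> = 0" by blast
  define \<tau> where "\<tau> = q ^ j \<odot> p \<odot> \<sigma>"
  define \<chi> where "\<chi> = h \<tau>"
  have \<tau>: "\<tau> \<in> dual scale" unfolding \<tau>_def by (intro dual.act_mem \<sigma>)
  have \<chi>: "\<chi> \<in> dual scale" unfolding \<chi>_def by (rule dual_hom_mem[OF hh \<tau>])
  have \<chi>_eq: "\<chi> = q ^ j \<odot> p \<odot> h \<sigma>"
    unfolding \<chi>_def \<tau>_def by (simp add: dual_hom_act[OF hh] dual.act_mem \<sigma>)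
  have \<chi>0: "\<chi> \<noteq> 0" using j(1) \<chi>_eq by simp
  have q\<chi>: "q \<odot> \<chi> = 0" using j(2) unfolding \<chi>_eq by (simp add: dual_act_act mult.assoc)
  obtain \<rho> where \<rho>: "\<rho> \<in> torsion_annihilator" "\<rho> \<noteq> 0" "q \<odot> \<rho> = 0" using P_W_annihilator[OF q] by blast
  have "s \<odot> \<rho> = 0" if s: "s \<odot> \<chi> = 0" for s
  proof (cases "q dvd s")
    case True
    then obtain c where "s = c * q" by (metis dvdE mult.commute)
    then have "s \<odot> \<rho> = c \<odot> q \<odot> \<rho>" by (simp add: dual_act_act)
    then show ?thesis using \<rho>(3) by (simp add: dual.act_zero_right)
  next
    case False
    obtain a c where "a * s + c * q ^ 1 = 1" using irreducible_bezout_power[OF irr False] by blast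
    then have "\<chi> = a \<odot> s \<odot> \<chi> + c \<odot> q \<odot> \<chi>" by (intro dual_act_linear_combination \<chi>) simp
    then show ?thesis using s q\<chi> \<chi>0 by (simp add: dual.act_zero_right)
  qed
  then obtain g where g: "dual_hom g" "\<forall>\<tau>\<in>dual scale. g \<tau> \<in> torsion_annihilator" "g \<chi> = \<rho>"
    using hom_to_annihilator_cyclic[OF \<chi> \<rho>(1)] by metis
  have "g \<chi> = h (g \<tau>)" unfolding \<chi>_def using dual_central_commute[OF h(1) g(1) \<tau>] by simp
  also have "\<dots> = 0" using ann g(2) \<tau> by blast
  finally show False using g(3) \<rho>(2) by simp
qed

section \<open>Primary decomposition and finiteness of the support\<close>

lemma primary_sum_annihilated:
  assumes "finite A" "\<And>i. i \<in> A \<Longrightarrow> prime_poly i" "\<And>i. i \<in> A \<Longrightarrow> f i \<in> primary_part scale i"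
    and q: "prime_poly q" "q \<notin> A"
  shows "\<exists>M. \<not> q dvd M \<and> M *s sum f A = 0"
  using assms
proof (induction A rule: finite_induct)
  case empty
  have "\<not> q dvd 1" using irreducible_not_unit[OF prime_poly_irreducible[OF q(1)]] .
  then show ?case by (intro exI[of _ 1]) simp
next
  case (insert i A)
  then obtain M where M: "\<not> q dvd M" "M *s sum f A = 0" by auto
  obtain k where k: "i ^ k *s f i = 0" using insert.prems(2)[of i] by (auto simp: primary_part_def)
  have "\<not> q dvd i" using prime_poly_dvd_imp_eq[OF q(1) insert.prems(1)[of i]] insert.prems(4) by auto
  then have "\<not> q dvd i ^ k" using irreducible_dvd_power_poly[OF prime_poly_irreducible[OF q(1)]] by blast
  then have "\<not> q dvd i ^ k * M" using M(1) irreducible_dvd_mult_iff_poly[OF prime_poly_irreducible[OF q(1)]] by blast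
  moreover have "(i ^ k * M) *s (f i + sum f A) = M *s i ^ k *s f i + i ^ k *s M *s sum f A"
    by (simp add: scale_right_distrib mult.commute)
  then have "(i ^ k * M) *s sum f (insert i A) = 0" using k M(2) insert.hyps by simp
  ultimately show ?case by blast
qed

lemma primary_parts_independent:
  assumes A: "finite A" "\<And>i. i \<in> A \<Longrightarrow> prime_poly i" "\<And>i. i \<in> A \<Longrightarrow> f i \<in> primary_part scale i"
    and sum0: "sum f A = 0" and q: "q \<in> A"
  shows "f q = 0"
proof -
  obtain M where M: "\<not> q dvd M" "M *s sum f (A - {q}) = 0"
    using primary_sum_annihilated[of "A - {q}" f q] A q by auto
  have "f q + sum f (A - {q}) = 0" using sum0 sum.remove[OF A(1) q, of f] by simp
  then have "f q = - sum f (A - {q})" by (simp add: eq_neg_iff_add_eq_0)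
  then have "M *s f q = 0" using M(2) by simp
  then show ?thesis
    using primary_coprime_cancel[OF prime_poly_irreducible[OF A(2)[OF q]] M(1) A(3)[OF q]] by blast
qed

lemma primary_cancel_prime:
  assumes "prime_poly q" "q *s x \<in> primary_part scale q"
  shows "x \<in> primary_part scale q"
proof -
  have q0: "q \<noteq> 0" by (rule prime_poly_nonzero[OF assms(1)])
  obtain k where "q ^ k *s q *s x = 0" using assms(2) by (auto simp: primary_part_def)
  then have "q ^ Suc k *s x = 0" by (simp add: mult.commute)
  then show ?thesis using mem_primary_iff[OF q0] by blast
qed

lemma primary_minus: "x \<in> primary_part scale q \<Longrightarrow> - x \<in> primary_part scale q"
  using primary_scale[of x q "- 1"] by simp

lemma primary_diff: "x \<in> primary_part scale q \<Longrightarrow> y \<in> primary_part scale q \<Longrightarrow> x - y \<in> primary_part scale q"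
  using primary_add[of x q "- y"] primary_minus[of y q] by simp

text \<open>
  Induction on the prime factors of \<open>N\<close>: given a decomposition of \<open>q *s x\<close>, divide its components at the
  primes other than \<open>q\<close> by \<open>q\<close>; what \<open>x\<close> differs from their sum by is \<open>q\<close>-primary. The index set \<open>A\<close>
  is allowed to be larger than the set of relevant primes, so that one fixed set serves for several \<open>N\<close>.
\<close>

lemma primary_decomposition:
  assumes N: "N \<noteq> 0" and A: "finite A" "\<And>q. q \<in> A \<Longrightarrow> prime_poly q"
    and support: "\<And>q. prime_poly q \<Longrightarrow> q dvd N \<Longrightarrow> primary_part scale q \<noteq> {0} \<Longrightarrow> q \<in> A"
    and x: "N *s x = 0"
  shows "\<exists>f. (\<forall>q\<in>A. f q \<in> primary_part scale q) \<and> x = sum f A"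
  using N support x
proof (induction N arbitrary: x rule: poly_prime_induct)
  case (unit p)
  then obtain c where "c * p = 1" by (metis dvdE mult.commute)
  then have "x = c *s p *s x" by simp
  then have "x = 0" using unit by simp
  then show ?case using primary_zero by (intro exI[of _ "\<lambda>_. 0"]) simp
next
  case (mult q p)
  have irr: "irreducible q" by (rule prime_poly_irreducible[OF mult.hyps(1)])
  have "p *s q *s x = 0" using mult.prems(2) by (simp add: mult.commute)
  then obtain f where f: "\<And>i. i \<in> A \<Longrightarrow> f i \<in> primary_part scale i" "q *s x = sum f A"
    using mult.IH[of "q *s x"] mult.prems(1) by (metis dvd_mult)
  have "\<exists>y. y \<in> primary_part scale i \<and> f i = q *s y" if i: "i \<in> A - {q}" for i
  proof -
    have "\<not> i dvd q" using prime_poly_dvd_imp_eq[OF A(2) mult.hyps(1)] i by auto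
    then show ?thesis
      using primary_coprime_divide[OF prime_poly_irreducible[OF A(2)], of i q "f i"] f(1) i by auto
  qed
  then obtain g where g: "\<And>i. i \<in> A - {q} \<Longrightarrow> g i \<in> primary_part scale i"
    "\<And>i. i \<in> A - {q} \<Longrightarrow> f i = q *s g i" by metis
  define y where "y = x - sum g (A - {q})"
  have qy: "q *s y = sum f A - sum f (A - {q})"
    unfolding y_def using f(2) g(2) by (simp add: scale_right_diff_distrib scale_sum_right)
  have y: "y \<in> primary_part scale q \<and> (q \<notin> A \<longrightarrow> y = 0)"
  proof (cases "q \<in> A")
    case True
    then have "q *s y = f q" using qy sum.remove[OF A(1) True, of f] by simp
    then show ?thesis using primary_cancel_prime[OF mult.hyps(1)] f(1)[OF True] True by simp
  next
    case False
    then have "q *s y = 0" using qy by simp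
    then have "y \<in> primary_part scale q" using primary_cancel_prime[OF mult.hyps(1)] primary_zero by simp
    moreover have "primary_part scale q = {0}" using mult.prems(1)[OF mult.hyps(1)] False by auto
    ultimately show ?thesis by auto
  qed
  define f' where "f' = (\<lambda>i. if i = q then y else g i)"
  have "x = sum f' A"
  proof (cases "q \<in> A")
    case True
    have "sum f' A = y + sum f' (A - {q})" using sum.remove[OF A(1) True, of f'] by (simp add: f'_def)
    also have "sum f' (A - {q}) = sum g (A - {q})" by (intro sum.cong) (auto simp: f'_def)
    finally show ?thesis by (simp add: y_def)
  next
    case False
    then have "sum f' A = sum g (A - {q})" by (intro sum.cong) (auto simp: f'_def)
    moreover have "y = 0" using y False by blast
    ultimately show ?thesis by (simp add: y_def)
  qed
  moreover have "f' i \<in> primary_part scale i" if "i \<in> A" for i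
    using y g(1)[of i] that by (auto simp: f'_def)
  ultimately show ?case by blast
qed

lemma torsion_annihilatorI:
  assumes \<sigma>: "\<sigma> \<in> dual scale"
    and vanish: "\<And>q x. prime_poly q \<Longrightarrow> x \<in> primary_part scale q \<Longrightarrow> \<sigma> x = 0"
  shows "\<sigma> \<in> torsion_annihilator"
proof -
  have "\<sigma> x = 0" if x: "x \<in> torsion scale" for x
  proof -
    obtain p where p: "p \<noteq> 0" "p *s x = 0" using x by (auto simp: mem_torsion_iff)
    define A where "A = {q. prime_poly q \<and> q dvd p}"
    have "finite A" unfolding A_def by (rule finite_prime_poly_divisors[OF p(1)])
    moreover have "prime_poly q" if "q \<in> A" for q using that by (simp add: A_def)
    moreover have "q \<in> A" if "prime_poly q" "q dvd p" for q using that by (simp add: A_def)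
    ultimately obtain f where f: "\<forall>q\<in>A. f q \<in> primary_part scale q" "x = sum f A"
      using primary_decomposition[OF p(1) _ _ _ p(2), of A] by metis
    have "\<sigma> (f q) = 0" if "q \<in> A" for q using f(1) that vanish unfolding A_def by blast
    then show ?thesis unfolding f(2) dual_sum[OF \<sigma>] by simp
  qed
  then show ?thesis using \<sigma> by (simp add: torsion_annihilator_def)
qed

text \<open>
  Independence of the primary parts makes the componentwise prescription single-valued, also for
  infinitely many primes at once.
\<close>

lemma functional_glue_primary:
  assumes A: "\<And>q. q \<in> A \<Longrightarrow> prime_poly q" and s: "\<And>q. q \<in> A \<Longrightarrow> s q \<in> dual scale"
  shows "\<exists>\<sigma>\<in>dual scale. \<forall>q\<in>A. \<forall>x\<in>primary_part scale q. \<sigma> x = s q x"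
proof -
  define G where "G = {(sum f B, \<Sum>q\<in>B. s q (f q)) | f B.
    finite B \<and> B \<subseteq> A \<and> (\<forall>q\<in>B. f q \<in> primary_part scale q)}"
  have mem: "(sum f B, \<Sum>q\<in>B. s q (f q)) \<in> G"
    if "finite B" "B \<subseteq> A" "\<And>q. q \<in> B \<Longrightarrow> f q \<in> primary_part scale q" for f B
    using that unfolding G_def by blast
  have "\<exists>\<sigma>\<in>dual scale. \<forall>x d. (x, d) \<in> G \<longrightarrow> \<sigma> x = d"
  proof (rule functional_extends)
    show "(0, 0) \<in> G" using mem[of "{}"] by simp
    show "(x + y, d + e) \<in> G" if xd: "(x, d) \<in> G" and ye: "(y, e) \<in> G" for x d y e
    proof -
      obtain f B where B: "finite B" "B \<subseteq> A" "\<And>q. q \<in> B \<Longrightarrow> f q \<in> primary_part scale q"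
        and xeq: "x = sum f B" "d = (\<Sum>q\<in>B. s q (f q))"
        using xd unfolding G_def by auto
      obtain f' B' where B': "finite B'" "B' \<subseteq> A" "\<And>q. q \<in> B' \<Longrightarrow> f' q \<in> primary_part scale q"
        and yeq: "y = sum f' B'" "e = (\<Sum>q\<in>B'. s q (f' q))"
        using ye unfolding G_def by auto
      define F where "F q = (if q \<in> B then f q else 0)" for q
      define F' where "F' q = (if q \<in> B' then f' q else 0)" for q
      have Fmem: "F q \<in> primary_part scale q" "F' q \<in> primary_part scale q" for q
        using B(3) B'(3) primary_zero by (auto simp: F_def F'_def)
      have x: "x = sum F (B \<union> B')" unfolding xeq
        using B(1) B'(1) by (intro sum.mono_neutral_cong_left) (auto simp: F_def)
      have y: "y = sum F' (B \<union> B')" unfolding yeq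
        using B(1) B'(1) by (intro sum.mono_neutral_cong_left) (auto simp: F'_def)
      have s0: "s q 0 = 0" if "q \<in> B \<union> B'" for q using dual_zero[OF s] that B(2) B'(2) by blast
      have d: "d = (\<Sum>q\<in>B \<union> B'. s q (F q))" unfolding xeq
        using B(1) B'(1) s0 by (intro sum.mono_neutral_cong_left) (auto simp: F_def)
      have e: "e = (\<Sum>q\<in>B \<union> B'. s q (F' q))" unfolding yeq
        using B(1) B'(1) s0 by (intro sum.mono_neutral_cong_left) (auto simp: F'_def)
      have "x + y = (\<Sum>q\<in>B \<union> B'. F q + F' q)" unfolding x y by (simp add: sum.distrib)
      moreover have "d + e = (\<Sum>q\<in>B \<union> B'. s q (F q + F' q))"
        unfolding d e sum.distrib[symmetric] using dual_add[OF s] B(2) B'(2)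
        by (intro sum.cong) auto
      ultimately show ?thesis
        using mem[of "B \<union> B'" "\<lambda>q. F q + F' q"] B(1,2) B'(1,2) primary_add[OF Fmem] by simp
    qed
    show "([:a:] *s x, a * d) \<in> G" if xd: "(x, d) \<in> G" for a x d
    proof -
      obtain f B where B: "finite B" "B \<subseteq> A" "\<And>q. q \<in> B \<Longrightarrow> f q \<in> primary_part scale q"
        and xeq: "x = sum f B" "d = (\<Sum>q\<in>B. s q (f q))"
        using xd unfolding G_def by auto
      have "[:a:] *s x = (\<Sum>q\<in>B. [:a:] *s f q)" unfolding xeq by (rule scale_sum_right)
      moreover have "a * d = (\<Sum>q\<in>B. s q ([:a:] *s f q))"
        unfolding xeq sum_distrib_left using dual_scalar[OF s] B(2) by (intro sum.cong) auto
      ultimately show ?thesis using mem[of B "\<lambda>q. [:a:] *s f q"] B primary_scale by simp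
    qed
    show "d = 0" if d0: "(0, d) \<in> G" for d
    proof -
      obtain f B where B: "finite B" "B \<subseteq> A" "\<And>q. q \<in> B \<Longrightarrow> f q \<in> primary_part scale q"
        and eq: "sum f B = 0" "d = (\<Sum>q\<in>B. s q (f q))"
        using d0 unfolding G_def by auto
      have "s q (f q) = 0" if q: "q \<in> B" for q
      proof -
        have "f q = 0" using primary_parts_independent[OF B(1) _ B(3) eq(1) q] A B(2) by blast
        then show ?thesis using dual_zero[OF s] q B(2) by auto
      qed
      then show ?thesis using eq(2) by simp
    qed
  qed
  then obtain \<sigma> where \<sigma>: "\<sigma> \<in> dual scale" and G: "\<forall>x d. (x, d) \<in> G \<longrightarrow> \<sigma> x = d" by (rule bexE)
  have "\<sigma> x = s q x" if "q \<in> A" "x \<in> primary_part scale q" for q x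
    using G mem[of "{q}" "\<lambda>_. x"] that by simp
  then show ?thesis using \<sigma> by blast
qed

text \<open>
  Choose a functional for each prime in question and glue them to a single \<open>\<sigma>\<close>. By locality, \<open>h \<sigma>\<close> is
  nonzero on all these primary parts, so every polynomial that kills \<open>h \<sigma>\<close> is divisible by all these
  primes.
\<close>

lemma central_finite_support:
  assumes h: "dual_central h" "torsion_valued h"
  shows "finite {q. prime_poly q \<and> (\<exists>\<sigma>\<in>dual scale. \<exists>x\<in>primary_part scale q. h \<sigma> x \<noteq> 0)}"
    (is "finite ?S")
proof -
  note hh = dual_central_hom[OF h(1)]
  have "\<forall>q\<in>?S. \<exists>\<sigma>. \<sigma> \<in> dual scale \<and> (\<exists>x\<in>primary_part scale q. h \<sigma> x \<noteq> 0)" by blast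
  from bchoice[OF this] obtain s
    where s: "\<forall>q\<in>?S. s q \<in> dual scale \<and> (\<exists>x\<in>primary_part scale q. h (s q) x \<noteq> 0)" ..
  obtain \<sigma> where \<sigma>: "\<sigma> \<in> dual scale"
    and glue: "\<And>q x. q \<in> ?S \<Longrightarrow> x \<in> primary_part scale q \<Longrightarrow> \<sigma> x = s q x"
    using functional_glue_primary[of ?S s] s by auto
  obtain p where p: "p \<noteq> 0" "p \<odot> h \<sigma> = 0" using h(2) \<sigma> unfolding torsion_valued_def by blast
  have "q dvd p" if q: "q \<in> ?S" for q
  proof (rule ccontr)
    assume qp: "\<not> q dvd p"
    have prime: "prime_poly q" using q by simp
    obtain x where x: "x \<in> primary_part scale q" "h (s q) x \<noteq> 0" using s q by blast
    obtain x' where x': "x = p *s x'"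
      using primary_coprime_divide[OF prime_poly_irreducible[OF prime] qp x(1)] by blast
    have "s q \<in> dual scale" using s q by blast
    then have "h (s q) x = h \<sigma> x"
      by (rule dual_hom_eq_on_primary[OF hh _ \<sigma> prime_poly_nonzero[OF prime] _ x(1)])
        (rule glue[OF q, symmetric])
    also have "\<dots> = (p \<odot> h \<sigma>) x'" unfolding x' by simp
    finally show False using p(2) x(2) by simp
  qed
  then have "?S \<subseteq> {q. prime_poly q \<and> q dvd p}" by blast
  then show ?thesis using finite_prime_poly_divisors[OF p(1)] finite_subset by blast
qed

section \<open>Splitting off the kernel of a polynomial\<close>

lemma P_W_free_surjective:
  assumes "N \<noteq> 0" "\<And>q. prime_poly q \<Longrightarrow> q dvd N \<Longrightarrow> q \<notin> P_W scale"
  shows "\<exists>y. x - N *s y \<in> torsion scale"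
  using assms
proof (induction N arbitrary: x rule: poly_prime_induct)
  case (unit p)
  then obtain c where "p * c = 1" by (metis dvdE)
  then show ?case using torsion_zero by (intro exI[of _ "c *s x"]) simp
next
  case (mult q p)
  obtain y where y: "x - q *s y \<in> torsion scale" using mult.prems[OF mult.hyps(1)] P_W_iff[OF mult.hyps(1)] by auto
  obtain y' where y': "y - p *s y' \<in> torsion scale" using mult.IH[of y] mult.prems by (metis dvd_mult)
  have "x - (q * p) *s y' = (x - q *s y) + q *s (y - p *s y')" by (simp add: scale_right_diff_distrib)
  then show ?case using torsion_add[OF y torsion_scale[OF y', of q]] by metis
qed

text \<open>
  Since \<open>N V\<close> maps onto \<open>W\<close>, only torsion elements have to be decomposed. For these, a Bezout identity
  separates the part killed by a power of \<open>N\<close>, hence by \<open>N\<close>, from a part that is divisible by \<open>N\<close>.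
\<close>

lemma kernel_image_complement:
  assumes stable: "\<And>x. N *s N *s x = 0 \<Longrightarrow> N *s x = 0"
    and surj: "\<And>x. \<exists>y. x - N *s y \<in> torsion scale"
  shows "\<exists>k y. x = k + N *s y \<and> N *s k = 0"
proof -
  obtain y where y: "x - N *s y \<in> torsion scale" using surj by blast
  define z where "z = x - N *s y"
  obtain p where p: "p \<noteq> 0" "p *s z = 0" using y unfolding z_def by (auto simp: mem_torsion_iff)
  obtain k p' s t where split: "p dvd N ^ k * p'" "s * p' + t * N = 1" using poly_split_coprime[OF p(1)] by blast
  obtain c where "N ^ k * p' = c * p" using split(1) by (metis dvdE mult.commute)
  then have "N ^ k *s p' *s z = c *s p *s z" by simp
  then have Nk: "N ^ k *s p' *s z = 0" using p(2) by simp
  have stable_power: "N *s w = 0" if "N ^ j *s w = 0" for j w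
    using that
  proof (induction j)
    case (Suc j)
    then show ?case
    proof (cases j)
      case (Suc i)
      have "N *s N *s N ^ i *s w = 0" using Suc.prems unfolding Suc by (simp add: mult_ac)
      then have "N ^ j *s w = 0" using stable unfolding Suc by (metis power_Suc scale_scale)
      then show ?thesis by (rule Suc.IH)
    qed simp
  qed simp
  have "N *s p' *s z = 0" by (rule stable_power[OF Nk])
  then have "N *s s *s p' *s z = 0" by (metis scale_left_commute scale_zero_right)
  moreover have "z = (s * p' + t * N) *s z" using split(2) by simp
  then have "z = s *s p' *s z + N *s t *s z" by (simp add: scale_left_distrib mult.commute)
  then have "x = s *s p' *s z + N *s (t *s z + y)" unfolding z_def by (simp add: scale_right_distrib algebra_simps)
  ultimately show ?thesis by blast
qed

section \<open>Decomposition of central endomorphisms\<close>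

text \<open>
  Let \<open>u/v\<close> be the rational function of \<open>b\<close> and \<open>h = v b - u\<close>. The set \<open>Sb\<close> consists of the primes at
  which \<open>h\<close> does not vanish. With \<open>N\<close> the product of \<open>v\<close> and the exponents of the primary parts in
  question, \<open>Tb\<close> and \<open>Wb\<close> are the kernel and the image of \<open>N\<close>. On \<open>Wb\<close> the polynomial \<open>v\<close> is invertible
  because \<open>N\<close> is, and \<open>v b = u\<close> there because \<open>h\<close> vanishes on \<open>Wb\<close>. The operator \<open>c\<close> is obtained
  pointwise: functionals separate points, so \<open>c x\<close> is determined by \<open>b \<sigma> x = \<sigma> (c x)\<close>, and it remains
  to see that it exists for \<open>x\<close> in \<open>Wb\<close> and in each primary part.
\<close>

lemma central_decomposition:
  assumes b: "dual_central b" and z: "z \<notin> torsion scale"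
  shows "\<exists>c Sb Tb Wb r f. linear_operator scale c \<and> (\<forall>\<sigma>\<in>dual scale. b \<sigma> = \<sigma> \<circ> c) \<and>
           multiplication_decomposition scale c Sb Tb Wb r f"
proof -
  note bh = dual_central_hom[OF b]
  obtain u v where v0: "v \<noteq> 0" and uv: "coprime u v"
    and rational: "\<And>\<rho>. \<rho> \<in> torsion_annihilator \<Longrightarrow> v \<odot> b \<rho> = u \<odot> \<rho>"
    and residue: "\<And>\<rho>. \<rho> \<in> dual scale \<Longrightarrow> \<exists>p. p \<noteq> 0 \<and> p \<odot> (v \<odot> b \<rho> - u \<odot> \<rho>) = 0"
    using dual_central_rational[OF b z] by blast
  define h where "h \<rho> = v \<odot> b \<rho> - u \<odot> \<rho>" for \<rho>
  have hc: "dual_central h" unfolding h_def[abs_def] by (rule dual_central_combination[OF b])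
  note hh = dual_central_hom[OF hc]
  have ht: "torsion_valued h" unfolding torsion_valued_def h_def using residue by blast
  have hann: "h \<rho> = 0" if "\<rho> \<in> torsion_annihilator" for \<rho> unfolding h_def using rational[OF that] by simp
  define Sb where "Sb = {q. prime_poly q \<and> (\<exists>\<sigma>\<in>dual scale. \<exists>x\<in>primary_part scale q. h \<sigma> x \<noteq> 0)}"
  have finS: "finite Sb" unfolding Sb_def by (rule central_finite_support[OF hc ht])
  have prime: "prime_poly q" if "q \<in> Sb" for q using that unfolding Sb_def by blast
  have outside: "h \<sigma> x = 0" if "prime_poly q" "q \<notin> Sb" "\<sigma> \<in> dual scale" "x \<in> primary_part scale q" for q \<sigma> x
    using that unfolding Sb_def by blast
  have not_PW: "q \<notin> P_W scale" if "q \<in> Sb" for q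
    using central_vanishes_on_P_W_primary[OF hc ht hann, of q] that unfolding Sb_def by blast
  have "\<exists>m. \<forall>x\<in>primary_part scale q. q ^ m *s x = 0" if q: "q \<in> Sb" for q
  proof (rule ccontr)
    assume "\<not> (\<exists>m. \<forall>x\<in>primary_part scale q. q ^ m *s x = 0)"
    then have "\<And>m. \<exists>x\<in>primary_part scale q. q ^ m *s x \<noteq> 0" by blast
    from central_vanishes_on_unbounded_primary[OF hc ht prime_poly_irreducible[OF prime[OF q]] this]
    show False using q unfolding Sb_def by blast
  qed
  then have "\<forall>q\<in>Sb. \<exists>m. \<forall>x\<in>primary_part scale q. q ^ m *s x = 0" by blast
  from bchoice[OF this] obtain e where e: "\<forall>q\<in>Sb. \<forall>x\<in>primary_part scale q. q ^ e q *s x = 0" ..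
  have "\<forall>q\<in>Sb. \<exists>f. \<forall>\<sigma>\<in>dual scale. \<forall>x\<in>primary_part scale q. b \<sigma> x = \<sigma> (f *s x)"
  proof
    fix q assume q: "q \<in> Sb"
    show "\<exists>f. \<forall>\<sigma>\<in>dual scale. \<forall>x\<in>primary_part scale q. b \<sigma> x = \<sigma> (f *s x)"
      using e q by (intro central_on_bounded_primary[OF b prime_poly_irreducible[OF prime[OF q]], of "e q"]) blast
  qed
  from bchoice[OF this] obtain f
    where f: "\<forall>q\<in>Sb. \<forall>\<sigma>\<in>dual scale. \<forall>x\<in>primary_part scale q. b \<sigma> x = \<sigma> (f q *s x)" ..
  have bounded: "Sb \<subseteq> bounded_primes scale"
  proof
    fix q assume q: "q \<in> Sb"
    have "primary_part scale q \<noteq> {0}"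
    proof
      assume "primary_part scale q = {0}"
      moreover have "h \<sigma> 0 = 0" if "\<sigma> \<in> dual scale" for \<sigma> by (rule dual_zero[OF dual_hom_mem[OF hh that]])
      ultimately show False using q unfolding Sb_def by auto
    qed
    moreover have "scale (q ^ e q) ` primary_part scale q = {0}"
    proof
      show "scale (q ^ e q) ` primary_part scale q \<subseteq> {0}" using e q by blast
      show "{0} \<subseteq> scale (q ^ e q) ` primary_part scale q"
        using imageI[OF primary_zero, of "scale (q ^ e q)" q] by simp
    qed
    ultimately show "q \<in> bounded_primes scale"
      unfolding bounded_primes_def Q_T_def using prime[OF q] not_PW[OF q] by blast
  qed
  define N where "N = v * (\<Prod>q\<in>Sb. q ^ e q)"
  have N0: "N \<noteq> 0" unfolding N_def using v0 finS prime_poly_nonzero[OF prime] by simp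
  obtain M where M: "N = v * M" unfolding N_def by blast
  have kill: "N *s x = 0" if q: "q \<in> Sb" and x: "x \<in> primary_part scale q" for q x
  proof -
    have "q ^ e q dvd (\<Prod>q\<in>Sb. q ^ e q)" using finS q by (rule dvd_prodI)
    then have "q ^ e q dvd N" unfolding N_def by (rule dvd_mult)
    then obtain c where "N = c * q ^ e q" by (metis dvdE mult.commute)
    then have "N *s x = c *s q ^ e q *s x" by simp
    then show ?thesis using e q x by simp
  qed
  \<comment> \<open>where \<open>h\<close> vanishes, \<open>v b = u\<close>; an element killed by \<open>v\<close> is then killed by the coprime \<open>u\<close>\<close>
  have denominator: "q \<in> Sb" if q: "prime_poly q" "q dvd v" and nontrivial: "primary_part scale q \<noteq> {0}" for q
  proof (rule ccontr)
    assume out: "q \<notin> Sb"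
    obtain x where x: "x \<in> primary_part scale q" "x \<noteq> 0" using nontrivial primary_zero by blast
    obtain k where k: "q ^ k *s x \<noteq> 0" "q ^ Suc k *s x = 0"
      using primary_exact_order[OF x(1), of 0] x(2) by auto
    define y where "y = q ^ k *s x"
    have y: "y \<in> primary_part scale q" "y \<noteq> 0" "q *s y = 0"
      unfolding y_def using primary_scale[OF x(1)] k by simp_all
    obtain w where w: "v = w * q" using q(2) by (metis dvdE mult.commute)
    have "v *s y = w *s q *s y" unfolding w by simp
    then have vy: "v *s y = 0" using y(3) by simp
    have "\<sigma> (u *s y) = \<sigma> 0" if \<sigma>: "\<sigma> \<in> dual scale" for \<sigma>
    proof -
      have "b \<sigma> (v *s y) - \<sigma> (u *s y) = 0" using outside[OF q(1) out \<sigma> y(1)] unfolding h_def by simp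
      then show ?thesis unfolding vy using dual_zero[OF dual_hom_mem[OF bh \<sigma>]] dual_zero[OF \<sigma>] by simp
    qed
    then have uy: "u *s y = 0" by (rule functionals_separate_points)
    obtain s t where "s * u + t * v = 1" using poly_coprime_bezout[OF uv] by blast
    then have "y = (s * u + t * v) *s y" by simp
    also have "\<dots> = s *s u *s y + t *s v *s y" by (simp add: scale_left_distrib)
    finally show False using uy vy y(2) by simp
  qed
  have prime_factor: "q dvd v \<or> q \<in> Sb" if q: "prime_poly q" "q dvd N" for q
  proof -
    have irr: "irreducible q" by (rule prime_poly_irreducible[OF q(1)])
    have prod: "q \<in> A" if "finite A" "A \<subseteq> Sb" "q dvd (\<Prod>i\<in>A. i ^ e i)" for A
      using that
    proof (induction A rule: finite_induct)
      case empty
      then show ?case using irreducible_not_unit[OF irr] by simp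
    next
      case (insert i A)
      have "q dvd i ^ e i * (\<Prod>i\<in>A. i ^ e i)" using insert.prems(2) insert.hyps by simp
      then consider "q dvd i ^ e i" | "q dvd (\<Prod>i\<in>A. i ^ e i)" using irreducible_dvd_mult_iff_poly[OF irr] by blast
      then show ?case
      proof cases
        case 1
        then have "q dvd i" by (rule irreducible_dvd_power_poly[OF irr])
        then show ?thesis using prime_poly_dvd_imp_eq[OF q(1) prime[of i]] insert.prems(1) by simp
      next
        case 2
        then show ?thesis using insert by simp
      qed
    qed
    have "q dvd v \<or> q dvd (\<Prod>i\<in>Sb. i ^ e i)" using q(2) irreducible_dvd_mult_iff_poly[OF irr] unfolding N_def by blast
    then show ?thesis using prod[OF finS] by blast
  qed
  have support: "q \<in> Sb" if "prime_poly q" "q dvd N" "primary_part scale q \<noteq> {0}" for q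
    using prime_factor[OF that(1,2)] denominator[OF that(1) _ that(3)] by blast
  have decompose: "\<exists>g. (\<forall>q\<in>Sb. g q \<in> primary_part scale q) \<and> x = sum g Sb"
    if "P \<noteq> 0" "P *s x = 0" "\<And>q. prime_poly q \<Longrightarrow> q dvd P \<Longrightarrow> q dvd N" for P x
  proof (rule primary_decomposition[OF that(1) finS prime _ that(2)])
    fix q assume q: "prime_poly q" "q dvd P" "primary_part scale q \<noteq> {0}"
    show "q \<in> Sb" by (rule support[OF q(1) that(3)[OF q(1,2)] q(3)])
  qed
  have kill_sum: "N *s sum g Sb = 0" if "\<forall>q\<in>Sb. g q \<in> primary_part scale q" for g
    unfolding scale_sum_right using that kill by (intro sum.neutral) blast
  have stable: "N *s x = 0" if NNx: "N *s N *s x = 0" for x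
  proof -
    have "\<exists>g. (\<forall>q\<in>Sb. g q \<in> primary_part scale q) \<and> x = sum g Sb"
    proof (rule decompose)
      show "N * N \<noteq> 0" using N0 by simp
      show "(N * N) *s x = 0" using NNx by simp
      show "q dvd N" if "prime_poly q" "q dvd N * N" for q
        using that irreducible_dvd_mult_iff_poly[OF prime_poly_irreducible[OF that(1)]] by blast
    qed
    then show ?thesis using kill_sum by blast
  qed
  have "q \<notin> P_W scale" if "prime_poly q" "q dvd N" for q
    using prime_factor[OF that] not_PW P_W_not_dvd_denominator[OF bh uv v0 rational] by blast
  then have surj: "\<exists>y. x - N *s y \<in> torsion scale" for x by (rule P_W_free_surjective[OF N0])
  define Tb where "Tb = {x. N *s x = 0}"
  define Wb where "Wb = range (scale N)"
  have memW: "N *s x \<in> Wb" for x unfolding Wb_def by (rule rangeI)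
  have subspaceW: "subspace Wb" unfolding Wb_def by (rule subspace_range_scale)
  have disjoint: "x = 0" if x: "x \<in> Tb" "x \<in> Wb" for x
  proof -
    obtain y where y: "x = N *s y" using x(2) unfolding Wb_def by blast
    then have "N *s N *s y = 0" using x(1) unfolding Tb_def by simp
    then show ?thesis unfolding y by (rule stable)
  qed
  have splits: "\<exists>k\<in>Tb. \<exists>w\<in>Wb. x = k + w" for x
    using kernel_image_complement[OF stable surj, of x] memW unfolding Tb_def by blast
  have vW: "\<exists>w'\<in>Wb. w = v *s w'" if w: "w \<in> Wb" for w
  proof -
    obtain x where x: "w = N *s x" using w unfolding Wb_def by blast
    obtain k y where ky: "x = k + N *s y" "N *s k = 0" using kernel_image_complement[OF stable surj, of x] by blast
    have "w = v *s (N *s M *s y)" unfolding x ky(1) using ky(2) by (simp add: M scale_right_distrib mult_ac)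
    then show ?thesis using memW by blast
  qed
  have vW_inj: "w = 0" if w: "w \<in> Wb" "v *s w = 0" for w
  proof -
    have "N *s w = M *s v *s w" by (simp add: M mult.commute)
    then have "w \<in> Tb" using w(2) unfolding Tb_def by simp
    then show ?thesis using disjoint w(1) by blast
  qed
  \<comment> \<open>\<open>h (N \<odot> \<sigma>)\<close> vanishes on the torsion, so the retraction \<open>\<pi>\<close> onto the dual of \<open>W\<close> fixes it; but \<open>\<pi> h = h \<pi> = 0\<close>\<close>
  have hW: "h \<sigma> w = 0" if \<sigma>: "\<sigma> \<in> dual scale" and w: "w \<in> Wb" for \<sigma> w
  proof -
    obtain x where x: "w = N *s x" using w unfolding Wb_def by blast
    have N\<sigma>: "N \<odot> \<sigma> \<in> dual scale" by (rule dual.act_mem[OF \<sigma>])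
    have "h (N \<odot> \<sigma>) y = 0" if q: "prime_poly q" and y: "y \<in> primary_part scale q" for q y
    proof (cases "q \<in> Sb")
      case True
      have "(N \<odot> \<sigma>) x = 0" if "x \<in> primary_part scale q" for x using kill[OF True that] dual_zero[OF \<sigma>] by simp
      then show ?thesis by (rule dual_hom_local_primary[OF hh N\<sigma> prime_poly_nonzero[OF q] _ y])
    next
      case False
      then show ?thesis by (rule outside[OF q _ N\<sigma> y])
    qed
    then have ann: "h (N \<odot> \<sigma>) \<in> torsion_annihilator" by (rule torsion_annihilatorI[OF dual_hom_mem[OF hh N\<sigma>]])
    obtain \<pi> where \<pi>: "dual_hom \<pi>" "\<forall>\<rho>\<in>dual scale. \<pi> \<rho> \<in> torsion_annihilator" "\<forall>\<rho>\<in>torsion_annihilator. \<pi> \<rho> = \<rho>"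
      using retraction_to_annihilator by blast
    have "h (N \<odot> \<sigma>) = \<pi> (h (N \<odot> \<sigma>))" using \<pi>(3) ann by simp
    also have "\<dots> = h (\<pi> (N \<odot> \<sigma>))" using dual_central_commute[OF hc \<pi>(1) N\<sigma>] by simp
    also have "\<dots> = 0" using hann \<pi>(2) N\<sigma> by blast
    finally have "(N \<odot> h \<sigma>) x = 0" using dual_hom_act[OF hh \<sigma>] by simp
    then show ?thesis by (simp add: x)
  qed
  have on_W: "b \<sigma> (v *s w) = \<sigma> (u *s w)" if "\<sigma> \<in> dual scale" "w \<in> Wb" for \<sigma> w
    using hW[OF that] unfolding h_def by simp
  have "\<exists>y. \<forall>\<sigma>\<in>dual scale. b \<sigma> x = \<sigma> y" for x
  proof -
    obtain k w where kw: "k \<in> Tb" "w \<in> Wb" "x = k + w" using splits by blast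
    obtain w' where w': "w' \<in> Wb" "w = v *s w'" using vW[OF kw(2)] by blast
    obtain g where g: "\<forall>q\<in>Sb. g q \<in> primary_part scale q" "k = sum g Sb"
      using decompose[OF N0, of k] kw(1) unfolding Tb_def by blast
    have "b \<sigma> x = \<sigma> ((\<Sum>q\<in>Sb. f q *s g q) + u *s w')" if \<sigma>: "\<sigma> \<in> dual scale" for \<sigma>
    proof -
      note b\<sigma> = dual_hom_mem[OF bh \<sigma>]
      have "b \<sigma> x = (\<Sum>q\<in>Sb. b \<sigma> (g q)) + \<sigma> (u *s w')"
        unfolding kw(3) g(2) w'(2) dual_add[OF b\<sigma>] dual_sum[OF b\<sigma>] on_W[OF \<sigma> w'(1)] ..
      also have "(\<Sum>q\<in>Sb. b \<sigma> (g q)) = (\<Sum>q\<in>Sb. \<sigma> (f q *s g q))"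
        using f g(1) \<sigma> by (intro sum.cong) auto
      finally show ?thesis unfolding dual_add[OF \<sigma>] dual_sum[OF \<sigma>] .
    qed
    then show ?thesis by blast
  qed
  then have "\<forall>x. \<exists>y. \<forall>\<sigma>\<in>dual scale. b \<sigma> x = \<sigma> y" by blast
  from choice[OF this] obtain c where c: "\<forall>x. \<forall>\<sigma>\<in>dual scale. b \<sigma> x = \<sigma> (c x)" ..
  have c_eqI: "c x = y" if "\<And>\<sigma>. \<sigma> \<in> dual scale \<Longrightarrow> b \<sigma> x = \<sigma> y" for x y
    using that c by (intro functionals_separate_points) simp
  have c_primary: "c x = f q *s x" if "q \<in> Sb" "x \<in> primary_part scale q" for q x
    using f that by (intro c_eqI) blast
  have c_W: "c (v *s w) = u *s w" if "w \<in> Wb" for w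
    using on_W that by (intro c_eqI) blast
  have "linear_operator scale c"
    unfolding linear_operator_iff
  proof (intro conjI allI)
    show "c (x + y) = c x + c y" for x y
    proof (rule c_eqI)
      fix \<sigma> assume \<sigma>: "\<sigma> \<in> dual scale"
      show "b \<sigma> (x + y) = \<sigma> (c x + c y)"
        unfolding dual_add[OF dual_hom_mem[OF bh \<sigma>]] dual_add[OF \<sigma>] using c \<sigma> by simp
    qed
    show "c ([:a:] *s x) = [:a:] *s c x" for a x
    proof (rule c_eqI)
      fix \<sigma> assume \<sigma>: "\<sigma> \<in> dual scale"
      show "b \<sigma> ([:a:] *s x) = \<sigma> ([:a:] *s c x)"
        unfolding dual_scalar[OF dual_hom_mem[OF bh \<sigma>]] dual_scalar[OF \<sigma>] using c \<sigma> by simp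
    qed
  qed
  moreover have "\<forall>\<sigma>\<in>dual scale. b \<sigma> = \<sigma> \<circ> c" using c by (auto simp: fun_eq_iff)
  moreover have "multiplication_decomposition scale c Sb Tb Wb (Fract u v) f"
    unfolding multiplication_decomposition_def
  proof (intro conjI ballI)
    show "finite Sb" "Sb \<subseteq> bounded_primes scale" by (fact finS, fact bounded)
    show "module.subspace scale Wb" by (rule subspaceW)
    show "direct_sum_family Sb (primary_part scale) Tb"
      unfolding direct_sum_family_def
    proof (intro conjI finS bij_betw_imageI equalityI subsetI)
      show "inj_on (\<lambda>x. \<Sum>i\<in>Sb. x i) (\<Pi>\<^sub>E i\<in>Sb. primary_part scale i)"
      proof (rule inj_onI)
        fix x y assume x: "x \<in> (\<Pi>\<^sub>E i\<in>Sb. primary_part scale i)" and y: "y \<in> (\<Pi>\<^sub>E i\<in>Sb. primary_part scale i)"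
          and eq: "(\<Sum>i\<in>Sb. x i) = (\<Sum>i\<in>Sb. y i)"
        have mem: "x i - y i \<in> primary_part scale i" if "i \<in> Sb" for i
          by (intro primary_diff PiE_mem[OF x that] PiE_mem[OF y that])
        have "(\<Sum>i\<in>Sb. x i - y i) = 0" using eq by (simp add: sum_subtractf)
        then have "x i - y i = 0" if "i \<in> Sb" for i
          using primary_parts_independent[OF finS prime mem _ that] by simp
        then show "x = y" by (intro PiE_ext[OF x y]) simp
      qed
      fix t assume "t \<in> (\<lambda>x. \<Sum>i\<in>Sb. x i) ` (\<Pi>\<^sub>E i\<in>Sb. primary_part scale i)"
      then obtain g where g: "g \<in> (\<Pi>\<^sub>E i\<in>Sb. primary_part scale i)" "t = sum g Sb" by blast
      have "\<forall>q\<in>Sb. g q \<in> primary_part scale q" using PiE_mem[OF g(1)] by blast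
      then show "t \<in> Tb" unfolding Tb_def g(2) using kill_sum by simp
    next
      fix t assume "t \<in> Tb"
      then obtain g where g: "\<forall>q\<in>Sb. g q \<in> primary_part scale q" "t = sum g Sb"
        using decompose[OF N0, of t] unfolding Tb_def by blast
      have "restrict g Sb \<in> (\<Pi>\<^sub>E i\<in>Sb. primary_part scale i)" using g(1) by auto
      moreover have "t = (\<Sum>i\<in>Sb. restrict g Sb i)" unfolding g(2) by simp
      ultimately show "t \<in> (\<lambda>x. \<Sum>i\<in>Sb. x i) ` (\<Pi>\<^sub>E i\<in>Sb. primary_part scale i)" by blast
    qed
    show "direct_sum Tb Wb UNIV"
      unfolding direct_sum_def
    proof (rule bij_betw_imageI)
      show "inj_on (\<lambda>(x, y). x + y) (Tb \<times> Wb)"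
      proof (rule inj_onI, clarify)
        fix k w k' w' assume mem: "k \<in> Tb" "w \<in> Wb" "k' \<in> Tb" "w' \<in> Wb" and eq: "k + w = k' + w'"
        have "k - k' \<in> Tb" using mem unfolding Tb_def by (simp add: scale_right_diff_distrib)
        moreover have diff: "k - k' = w' - w" using eq by (simp add: algebra_simps)
        moreover have "w' - w \<in> Wb" by (rule subspace_diff[OF subspaceW mem(4,2)])
        ultimately have "k - k' = 0" unfolding diff by (intro disjoint)
        then show "k = k' \<and> w = w'" using eq by simp
      qed
      show "(\<lambda>(x, y). x + y) ` (Tb \<times> Wb) = UNIV"
      proof (intro equalityI subsetI UNIV_I)
        fix x
        obtain k w where "k \<in> Tb" "w \<in> Wb" "x = k + w" using splits by blast
        then show "x \<in> (\<lambda>(x, y). x + y) ` (Tb \<times> Wb)" by (intro image_eqI[of _ _ "(k, w)"]) auto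
      qed
    qed
    note scaleW = subspace_scale[OF subspaceW]
    have inj: "inj_on (scale v) Wb"
    proof (rule inj_onI)
      fix w w' assume w: "w \<in> Wb" "w' \<in> Wb" and eq: "v *s w = v *s w'"
      have "v *s (w - w') = 0" using eq by (simp add: scale_right_diff_distrib)
      then show "w = w'" using vW_inj[OF subspace_diff[OF subspaceW w]] by simp
    qed
    show "acts_as_rational scale c Wb (Fract u v)"
      unfolding acts_as_rational_def
    proof (rule conjI, goal_cases range formula)
      case range
      show "c ` Wb \<subseteq> Wb"
      proof (rule image_subsetI)
        fix w assume "w \<in> Wb"
        then obtain w' where w': "w' \<in> Wb" "w = v *s w'" using vW by blast
        show "c w \<in> Wb" unfolding w'(2) c_W[OF w'(1)] by (rule scaleW[OF w'(1)])
      qed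
    next
      case formula
      have "scale v ` Wb = Wb"
      proof
        show "scale v ` Wb \<subseteq> Wb" using scaleW by blast
        show "Wb \<subseteq> scale v ` Wb" using vW by blast
      qed
      then have "bij_betw (scale v) Wb Wb" by (rule bij_betw_imageI[OF inj])
      moreover have "c w = the_inv_into Wb (scale v) (u *s w)" if w: "w \<in> Wb" for w
      proof -
        obtain w' where w': "w' \<in> Wb" "w = v *s w'" using vW[OF w] by blast
        have "u *s w = v *s u *s w'" unfolding w'(2) by (rule scale_left_commute)
        then show ?thesis
          using the_inv_into_f_f[OF inj scaleW[OF w'(1), of u]] c_W[OF w'(1)] w'(2) by simp
      qed
      ultimately show ?case using v0 uv by blast
    qed
    show "acts_as_poly scale c (primary_part scale q) (f q)" if q: "q \<in> Sb" for q
      unfolding acts_as_poly_def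
    proof (intro conjI ballI image_subsetI)
      fix x assume x: "x \<in> primary_part scale q"
      show "c x = f q *s x" by (rule c_primary[OF q x])
      show "c x \<in> primary_part scale q" unfolding c_primary[OF q x] by (rule primary_scale[OF x])
    qed
  qed
  ultimately show ?thesis by blast
qed

section \<open>Operators given by a decomposition are central\<close>

text \<open>
  On a primary part, \<open>c\<close> is multiplication by a polynomial, and endomorphisms of \<open>V\<close> and of the dual
  respect primary parts. On \<open>Wb\<close> the point is that \<open>Wb\<close> is also respected. The primes in \<open>Sb\<close> are
  outside of \<open>P_W\<close>, so \<open>Wb = N Wb\<close> for a polynomial \<open>N\<close> that kills \<open>Tb\<close>, and \<open>Wb\<close> is the image of \<open>N\<close>
  in \<open>V\<close>. Dually, a functional that vanishes on \<open>Wb\<close> is killed by \<open>N\<close>, hence so is its image under an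
  endomorphism, which therefore vanishes on \<open>N Wb = Wb\<close>.
\<close>

lemma multiplication_decomposition_endo:
  assumes c: "linear_operator scale c"
    and decomposition: "multiplication_decomposition scale c Sb Tb Wb r f"
  shows "module_hom scale scale c"
    and "\<And>e x. module_hom scale scale e \<Longrightarrow> c (e x) = e (c x)"
    and "\<And>g \<sigma> x. dual_hom g \<Longrightarrow> \<sigma> \<in> dual scale \<Longrightarrow> g (\<sigma> \<circ> c) x = g \<sigma> (c x)"
proof -
  have c_add: "c (x + y) = c x + c y" and c_scalar: "c ([:a:] *s x) = [:a:] *s c x" for x y a
    using c unfolding linear_operator_iff by blast+
  have finS: "finite Sb" and bounded: "Sb \<subseteq> bounded_primes scale" and subspace: "subspace Wb"
    and family: "direct_sum_family Sb (primary_part scale) Tb" and sum: "direct_sum Tb Wb UNIV"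
    and rational: "acts_as_rational scale c Wb r"
    and poly: "\<And>q. q \<in> Sb \<Longrightarrow> acts_as_poly scale c (primary_part scale q) (f q)"
    using decomposition unfolding multiplication_decomposition_def by blast+
  have prime: "prime_poly q" and not_PW: "q \<notin> P_W scale"
    and exponent: "\<exists>m. scale (q ^ m) ` primary_part scale q = {0}" if "q \<in> Sb" for q
    using bounded that unfolding bounded_primes_def Q_T_def by blast+
  have c_primary: "c x = f q *s x" if "q \<in> Sb" "x \<in> primary_part scale q" for q x
    using poly[OF that(1)] that(2) unfolding acts_as_poly_def by blast
  have W_scale: "p *s w \<in> Wb" if "w \<in> Wb" for p w using subspace_scale[OF subspace that] .
  have W_add: "w + w' \<in> Wb" if "w \<in> Wb" "w' \<in> Wb" for w w' using subspace_add[OF subspace that] .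
  have W_zero: "0 \<in> Wb" by (rule subspace_0[OF subspace])
  have Tb_eq: "Tb = (\<lambda>x. \<Sum>i\<in>Sb. x i) ` (\<Pi>\<^sub>E i\<in>Sb. primary_part scale i)"
    using family unfolding direct_sum_family_def bij_betw_def by simp
  have Tb_elim: "\<exists>g. (\<forall>q\<in>Sb. g q \<in> primary_part scale q) \<and> t = sum g Sb" if t: "t \<in> Tb" for t
  proof -
    obtain g where g: "g \<in> (\<Pi>\<^sub>E i\<in>Sb. primary_part scale i)" "t = sum g Sb" using t unfolding Tb_eq by blast
    have "\<forall>q\<in>Sb. g q \<in> primary_part scale q" using PiE_mem[OF g(1)] by blast
    then show ?thesis using g(2) by blast
  qed
  have Tb_intro: "sum g Sb \<in> Tb" if g: "\<And>q. q \<in> Sb \<Longrightarrow> g q \<in> primary_part scale q" for g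
  proof -
    have "restrict g Sb \<in> (\<Pi>\<^sub>E i\<in>Sb. primary_part scale i)" using g by auto
    moreover have "sum g Sb = (\<Sum>i\<in>Sb. restrict g Sb i)" by simp
    ultimately show ?thesis unfolding Tb_eq by blast
  qed
  have Tb_zero: "0 \<in> Tb" using Tb_intro[of "\<lambda>_. 0"] primary_zero by simp
  have primary_Tb: "x \<in> Tb" if q: "q \<in> Sb" and x: "x \<in> primary_part scale q" for q x
    using Tb_intro[of "\<lambda>i. if i = q then x else 0"] q x primary_zero finS by simp
  have splits: "\<exists>t\<in>Tb. \<exists>w\<in>Wb. x = t + w" for x
  proof -
    have "x \<in> (\<lambda>(x, y). x + y) ` (Tb \<times> Wb)" using sum unfolding direct_sum_def bij_betw_def by simp
    then show ?thesis by auto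
  qed
  have disjoint: "x = 0" if "x \<in> Tb" "x \<in> Wb" for x
  proof -
    have "inj_on (\<lambda>(x, y). x + y) (Tb \<times> Wb)" using sum unfolding direct_sum_def bij_betw_def by simp
    then have "(x, 0) = (0, x)" by (rule inj_onD) (use that Tb_zero W_zero in auto)
    then show ?thesis by simp
  qed
  \<comment> \<open>additive maps are compared on the summands of the decomposition\<close>
  have agree: "A x = B x"
    if add: "\<And>x y. A (x + y) = A x + A y" "\<And>x y. B (x + y) = B x + B y"
      and primary: "\<And>q x. q \<in> Sb \<Longrightarrow> x \<in> primary_part scale q \<Longrightarrow> A x = B x"
      and onW: "\<And>w. w \<in> Wb \<Longrightarrow> A w = B w" for A B :: "'v \<Rightarrow> 'x::ab_group_add" and x
  proof -
    obtain t w where tw: "t \<in> Tb" "w \<in> Wb" "x = t + w" using splits by blast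
    obtain g where g: "\<forall>q\<in>Sb. g q \<in> primary_part scale q" "t = sum g Sb" using Tb_elim[OF tw(1)] by blast
    have A: "A (sum g Sb) = (\<Sum>q\<in>Sb. A (g q))" using additive.sum[of A] add(1) by (simp add: additive_def)
    have B: "B (sum g Sb) = (\<Sum>q\<in>Sb. B (g q))" using additive.sum[of B] add(2) by (simp add: additive_def)
    have "(\<Sum>q\<in>Sb. A (g q)) = (\<Sum>q\<in>Sb. B (g q))" using g(1) primary by (intro sum.cong) auto
    then show ?thesis unfolding tw(3) add g(2) A B using onW[OF tw(2)] by simp
  qed
  \<comment> \<open>up to a multiple of \<open>q\<close>, an element of \<open>Wb\<close> is a torsion element \<open>s\<close> of \<open>Wb\<close>, and \<open>s\<close> has no \<open>q\<close>-part\<close>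
  have divisible: "\<exists>w'\<in>Wb. w = q *s w'" if q: "q \<in> Sb" and w: "w \<in> Wb" for q w
  proof -
    note irr = prime_poly_irreducible[OF prime[OF q]]
    obtain y where y: "w - q *s y \<in> torsion scale" using not_PW[OF q] P_W_iff[OF prime[OF q]] by blast
    obtain t w' where tw: "t \<in> Tb" "w' \<in> Wb" "y = t + w'" using splits by blast
    obtain g where g: "\<forall>q\<in>Sb. g q \<in> primary_part scale q" "t = sum g Sb" using Tb_elim[OF tw(1)] by blast
    have t_torsion: "t \<in> torsion scale"
    proof -
      have "sum g A \<in> torsion scale" if "A \<subseteq> Sb" for A
        using finite_subset[OF that finS] that
        by (induction A rule: finite_induct) (use g(1) torsion_zero torsion_add in \<open>auto simp: primary_part_def\<close>)
      then show ?thesis unfolding g(2) by blast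
    qed
    define s where "s = w - q *s w'"
    have sW: "s \<in> Wb" unfolding s_def using subspace_diff[OF subspace w W_scale[OF tw(2)]] .
    have "s = (w - q *s y) + q *s t" unfolding s_def tw(3) by (simp add: scale_right_distrib)
    then have "s \<in> torsion scale" using torsion_add[OF y torsion_scale[OF t_torsion, of q]] by simp
    then obtain p where p: "p \<noteq> 0" "p *s s = 0" by (auto simp: mem_torsion_iff)
    obtain k p' where p': "p = q ^ k * p'" "\<not> q dvd p'" using poly_split_power[OF irr p(1)] by blast
    have "q ^ k *s p' *s s = 0" using p(2) p'(1) by simp
    then have "p' *s s \<in> primary_part scale q" using mem_primary_iff[OF prime_poly_nonzero[OF prime[OF q]]] by blast
    then have ps: "p' *s s = 0" using disjoint[OF primary_Tb[OF q] W_scale[OF sW]] by blast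
    obtain a d where "a * p' + d * q ^ 1 = 1" using irreducible_bezout_power[OF irr p'(2)] by blast
    then have "s = (a * p' + d * q) *s s" by simp
    then have "s = a *s p' *s s + q *s d *s s" by (simp add: scale_left_distrib mult.commute)
    then have s_eq: "s = q *s d *s s" unfolding ps by simp
    have "w = s + q *s w'" unfolding s_def by simp
    also have "\<dots> = q *s d *s s + q *s w'" by (simp only: s_eq[symmetric])
    also have "\<dots> = q *s (d *s s + w')" by (simp only: scale_right_distrib)
    finally have "w = q *s (d *s s + w')" .
    then show ?thesis using W_add[OF W_scale[OF sW] tw(2)] by blast
  qed
  have "\<forall>q\<in>Sb. \<exists>m. scale (q ^ m) ` primary_part scale q = {0}" using exponent by blast
  from bchoice[OF this] obtain e where e: "\<forall>q\<in>Sb. scale (q ^ e q) ` primary_part scale q = {0}" ..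
  define N where "N = (\<Prod>q\<in>Sb. q ^ e q)"
  have kill: "N *s x = 0" if q: "q \<in> Sb" and x: "x \<in> primary_part scale q" for q x
  proof -
    have "q ^ e q dvd N" unfolding N_def using finS q by (rule dvd_prodI)
    then obtain d where "N = d * q ^ e q" by (metis dvdE mult.commute)
    then have "N *s x = d *s q ^ e q *s x" by simp
    moreover have "q ^ e q *s x = 0" using e q x by blast
    ultimately show ?thesis by simp
  qed
  have NT: "N *s t = 0" if t: "t \<in> Tb" for t
  proof -
    obtain g where g: "\<forall>q\<in>Sb. g q \<in> primary_part scale q" "t = sum g Sb" using Tb_elim[OF t] by blast
    show ?thesis unfolding g(2) scale_sum_right using g(1) kill by (intro sum.neutral) blast
  qed
  have NW: "\<exists>w'\<in>Wb. w = N *s w'" if w: "w \<in> Wb" for w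
  proof -
    have power: "\<exists>w'\<in>Wb. w = q ^ k *s w'" if q: "q \<in> Sb" and w: "w \<in> Wb" for q k w
    proof (induction k)
      case 0
      show ?case using w by (intro bexI[of _ w]) simp_all
    next
      case (Suc k)
      then obtain w' where w': "w' \<in> Wb" "w = q ^ k *s w'" by blast
      obtain w'' where "w'' \<in> Wb" "w' = q *s w''" using divisible[OF q w'(1)] by blast
      then show ?case using w'(2) by (intro bexI[of _ w'']) (simp_all add: mult.commute)
    qed
    have "\<exists>w'\<in>Wb. w = (\<Prod>q\<in>A. q ^ e q) *s w'" if "finite A" "A \<subseteq> Sb" for A
      using that
    proof (induction A rule: finite_induct)
      case empty
      show ?case using w by (intro bexI[of _ w]) simp_all
    next
      case (insert q A)
      then obtain w' where w': "w' \<in> Wb" "w = (\<Prod>q\<in>A. q ^ e q) *s w'" by auto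
      obtain w'' where "w'' \<in> Wb" "w' = q ^ e q *s w''" using power[of q w' "e q"] w'(1) insert.prems by auto
      then show ?case using w'(2) insert.hyps by (intro bexI[of _ w'']) (simp_all add: mult.commute)
    qed
    then show ?thesis unfolding N_def using finS by blast
  qed
  have range_N: "N *s x \<in> Wb" for x
  proof -
    obtain t w where tw: "t \<in> Tb" "w \<in> Wb" "x = t + w" using splits by blast
    have "N *s x = N *s w" unfolding tw(3) scale_right_distrib NT[OF tw(1)] by simp
    then show ?thesis using W_scale[OF tw(2)] by simp
  qed
  obtain u v where bij: "bij_betw (scale v) Wb Wb"
    and c_inv: "\<And>x. x \<in> Wb \<Longrightarrow> c x = the_inv_into Wb (scale v) (u *s x)"
    using rational unfolding acts_as_rational_def by blast
  have inj: "inj_on (scale v) Wb" using bij by (rule bij_betw_imp_inj_on)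
  have vW: "\<exists>w'\<in>Wb. w = v *s w'" if "w \<in> Wb" for w using bij_betw_imp_surj_on[OF bij] that by blast
  have c_W: "c (v *s w) = u *s w" if w: "w \<in> Wb" for w
  proof -
    have "c (v *s w) = the_inv_into Wb (scale v) (v *s u *s w)"
      unfolding c_inv[OF W_scale[OF w]] by (simp add: mult.commute)
    then show ?thesis using the_inv_into_f_f[OF inj W_scale[OF w]] by simp
  qed

  have c_act: "c (p *s x) = p *s c x" for p x
  proof (rule agree[of "\<lambda>x. c (p *s x)" "\<lambda>x. p *s c x"])
    show "c (p *s x) = p *s c x" if "q \<in> Sb" "x \<in> primary_part scale q" for q x
      unfolding c_primary[OF that] c_primary[OF that(1) primary_scale[OF that(2)]] by (rule scale_left_commute)
    show "c (p *s w) = p *s c w" if w: "w \<in> Wb" for w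
    proof -
      obtain w' where w': "w' \<in> Wb" "w = v *s w'" using vW[OF w] by blast
      have "p *s w = v *s p *s w'" unfolding w'(2) by (rule scale_left_commute)
      then have "c (p *s w) = u *s p *s w'" using c_W[OF W_scale[OF w'(1)]] by simp
      then show ?thesis unfolding w'(2) c_W[OF w'(1)] by (simp add: mult.commute)
    qed
  qed (simp_all add: c_add scale_right_distrib)
  have "module scale" ..
  then show "module_hom scale scale c" unfolding module_hom_iff using c_add c_act by blast

  show "c (e x) = e (c x)" if e: "module_hom scale scale e" for e x
  proof -
    have e_add: "e (x + y) = e x + e y" and e_act: "e (p *s x) = p *s e x" for x y p
      using e unfolding module_hom_iff by blast+
    have e_zero: "e 0 = 0" using e_act[of 0 0] by simp
    have e_W: "e w \<in> Wb" if w: "w \<in> Wb" for w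
    proof -
      obtain w' where "w = N *s w'" using NW[OF w] by blast
      then show ?thesis using range_N e_act by simp
    qed
    show ?thesis
    proof (rule agree[of "\<lambda>x. c (e x)" "\<lambda>x. e (c x)"])
      show "c (e x) = e (c x)" if q: "q \<in> Sb" and x: "x \<in> primary_part scale q" for q x
      proof -
        obtain k where "q ^ k *s x = 0" using x by (auto simp: primary_part_def)
        then have "q ^ k *s e x = 0" using e_act[of "q ^ k" x] e_zero by simp
        then have "e x \<in> primary_part scale q" using mem_primary_iff[OF prime_poly_nonzero[OF prime[OF q]]] by blast
        then show ?thesis unfolding c_primary[OF q x] e_act using c_primary[OF q] by blast
      qed
      show "c (e w) = e (c w)" if w: "w \<in> Wb" for w
      proof -
        obtain w' where w': "w' \<in> Wb" "w = v *s w'" using vW[OF w] by blast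
        show ?thesis unfolding w'(2) e_act c_W[OF w'(1)] by (rule c_W[OF e_W[OF w'(1)]])
      qed
    qed (simp_all add: c_add e_add)
  qed

  show "g (\<sigma> \<circ> c) x = g \<sigma> (c x)" if g: "dual_hom g" and \<sigma>: "\<sigma> \<in> dual scale" for g \<sigma> x
  proof -
    have \<sigma>c: "\<sigma> \<circ> c \<in> dual scale"
      using \<sigma> c_add c_scalar by (simp add: mem_dual_iff)
    note g\<sigma> = dual_hom_mem[OF g \<sigma>] and g\<sigma>c = dual_hom_mem[OF g \<sigma>c]
    show ?thesis
    proof (rule agree[of "\<lambda>x. g (\<sigma> \<circ> c) x" "\<lambda>x. g \<sigma> (c x)"])
      show "g (\<sigma> \<circ> c) x = g \<sigma> (c x)" if q: "q \<in> Sb" and x: "x \<in> primary_part scale q" for q x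
      proof -
        have "g (\<sigma> \<circ> c) x = g (f q \<odot> \<sigma>) x"
          using c_primary[OF q]
          by (intro dual_hom_eq_on_primary[OF g \<sigma>c dual.act_mem[OF \<sigma>] prime_poly_nonzero[OF prime[OF q]] _ x]) simp
        then show ?thesis unfolding dual_hom_act[OF g \<sigma>] c_primary[OF q x] by simp
      qed
      show "g (\<sigma> \<circ> c) w = g \<sigma> (c w)" if w: "w \<in> Wb" for w
      proof -
        obtain w' where w': "w' \<in> Wb" "w = v *s w'" using vW[OF w] by blast
        define \<tau> where "\<tau> = v \<odot> (\<sigma> \<circ> c) - u \<odot> \<sigma>"
        have \<tau>: "\<tau> \<in> dual scale" unfolding \<tau>_def by (intro dual_diff_mem dual.act_mem \<sigma> \<sigma>c)
        have \<tau>W: "\<tau> y = 0" if "y \<in> Wb" for y unfolding \<tau>_def using c_W[OF that] by simp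
        have "N \<odot> \<tau> = 0" using \<tau>W[OF range_N] by (simp add: fun_eq_iff)
        then have N\<tau>: "N \<odot> g \<tau> = 0" using dual_hom_act[OF g \<tau>, of N] dual_hom_zero[OF g] by simp
        obtain y where y: "w' = N *s y" using NW[OF w'(1)] by blast
        have "g \<tau> w' = (N \<odot> g \<tau>) y" unfolding y by simp
        then have "g \<tau> w' = 0" unfolding N\<tau> by simp
        moreover have "g \<tau> = v \<odot> g (\<sigma> \<circ> c) - u \<odot> g \<sigma>"
          unfolding \<tau>_def
          by (simp only: dual_hom_diff[OF g dual.act_mem[OF \<sigma>c] dual.act_mem[OF \<sigma>]]
              dual_hom_act[OF g \<sigma>c] dual_hom_act[OF g \<sigma>])
        ultimately show ?thesis unfolding w'(2) c_W[OF w'(1)] by simp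
      qed
    qed (simp_all add: c_add dual_add[OF g\<sigma>] dual_add[OF g\<sigma>c])
  qed
qed

lemma dual_endos_imp_hom:
  assumes "b \<in> dual_endos scale"
  shows "dual_hom b"
proof -
  have "b \<rho> \<in> dual scale" if "\<rho> \<in> dual scale" for \<rho>
    using assms that unfolding dual_endos_def by (auto dest: PiE_mem)
  moreover have "b (\<rho> + \<sigma>) = b \<rho> + b \<sigma>" if "\<rho> \<in> dual scale" "\<sigma> \<in> dual scale" for \<rho> \<sigma>
    using assms that unfolding dual_endos_def plus_fun_def by blast
  moreover have "b (p \<odot> \<rho>) = p \<odot> b \<rho>" if "\<rho> \<in> dual scale" for \<rho> p
    using assms that unfolding dual_endos_def by blast
  ultimately show ?thesis unfolding dual_hom_def by blast
qed

lemma restrict_hom_dual_endos: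
  assumes g: "dual_hom g"
  shows "restrict g (dual scale) \<in> dual_endos scale"
proof -
  have "(\<lambda>\<xi>. \<rho> \<xi> + \<sigma> \<xi>) = \<rho> + \<sigma>" for \<rho> \<sigma> :: "'v \<Rightarrow> 'a" by (simp add: fun_eq_iff)
  then show ?thesis
    unfolding dual_endos_def
    using dual_hom_mem[OF g] dual_hom_add[OF g] dual_hom_act[OF g] dual.add_mem dual.act_mem by simp
qed

text \<open>
  Passes from extensional maps composed with \<^const>\<open>compose\<close> to maps that are only evaluated on the dual.
\<close>

lemma dual_endos_center_imp_central:
  assumes b: "b \<in> dual_endos_center scale"
  shows "dual_central b"
proof -
  have endo: "b \<in> dual_endos scale"
    and commute: "\<And>a. a \<in> dual_endos scale \<Longrightarrow> compose (dual scale) b a = compose (dual scale) a b"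
    using b unfolding dual_endos_center_def center_def by blast+
  have hom: "dual_hom b" by (rule dual_endos_imp_hom[OF endo])
  have "b (g \<rho>) = g (b \<rho>)" if g: "dual_hom g" and \<rho>: "\<rho> \<in> dual scale" for g \<rho>
    using fun_cong[OF commute[OF restrict_hom_dual_endos[OF g]], of \<rho>] \<rho> dual_hom_mem[OF hom \<rho>]
    by (simp add: compose_eq)
  then show ?thesis using hom unfolding dual_central_def by blast
qed

lemma adjoint_in_dual_endos_center:
  assumes c: "module_hom scale scale c"
    and commute: "\<And>g \<sigma> x. dual_hom g \<Longrightarrow> \<sigma> \<in> dual scale \<Longrightarrow> g (\<sigma> \<circ> c) x = g \<sigma> (c x)"
  shows "adjoint_op scale c \<in> dual_endos_center scale"
proof -
  have c_add: "c (x + y) = c x + c y" and c_act: "c (p *s x) = p *s c x" for x y p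
    using c unfolding module_hom_iff by blast+
  have mem: "\<sigma> \<circ> c \<in> dual scale" if "\<sigma> \<in> dual scale" for \<sigma>
    using that c_add c_act by (simp add: mem_dual_iff)
  have "dual_hom (\<lambda>\<sigma>. \<sigma> \<circ> c)"
    unfolding dual_hom_def using mem c_act by (auto simp: fun_eq_iff)
  then have endo: "adjoint_op scale c \<in> dual_endos scale"
    unfolding adjoint_op_def by (rule restrict_hom_dual_endos)
  have "compose (dual scale) (adjoint_op scale c) a = compose (dual scale) a (adjoint_op scale c)"
    if a: "a \<in> dual_endos scale" for a
  proof (rule extensionalityI[of _ "dual scale"])
    note hom = dual_endos_imp_hom[OF a]
    fix \<rho> assume \<rho>: "\<rho> \<in> dual scale"
    have "a (\<rho> \<circ> c) = a \<rho> \<circ> c" using commute[OF hom \<rho>] by (simp add: fun_eq_iff)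
    then show "compose (dual scale) (adjoint_op scale c) a \<rho> = compose (dual scale) a (adjoint_op scale c) \<rho>"
      using \<rho> dual_hom_mem[OF hom \<rho>] by (simp add: compose_eq adjoint_op_def)
  qed (simp_all add: compose_extensional)
  then show ?thesis using endo unfolding dual_endos_center_def center_def by blast
qed

lemma dual_endos_center_adjoint:
  assumes b: "b \<in> dual_endos_center scale" and eq: "\<forall>\<sigma>\<in>dual scale. b \<sigma> = \<sigma> \<circ> c"
  shows "b = adjoint_op scale c"
proof (rule extensionalityI[of _ "dual scale"])
  have "b \<in> dual scale \<rightarrow>\<^sub>E dual scale"
    using b unfolding dual_endos_center_def center_def dual_endos_def by blast
  then show "b \<in> extensional (dual scale)" by (simp add: PiE_def)
qed (simp_all add: adjoint_op_def eq)

lemma torsion_quotient_trivial: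
  assumes "torsion scale = UNIV"
  shows "torsion_quotient scale = {torsion scale}"
proof -
  have "torsion_coset scale x = torsion scale" for x
    using torsion_coset_eq_iff[of x 0] assms by (simp add: torsion_coset_def)
  then show ?thesis unfolding torsion_quotient_def by auto
qed

end

theorem theorem3p12:
  fixes scale :: "'a::field poly \<Rightarrow> 'v::ab_group_add \<Rightarrow> 'v"
  assumes "module scale"
    and "torsion_quotient scale \<noteq> {torsion scale}"
  shows "(\<forall>b \<in> dual_endos_center scale.
            \<exists>c Sb Tb Wb r f. linear_operator scale c \<and> b = adjoint_op scale c \<and>
              multiplication_decomposition scale c Sb Tb Wb r f) \<and>
         (\<forall>c. linear_operator scale c \<and>
            (\<exists>Sb Tb Wb r f. multiplication_decomposition scale c Sb Tb Wb r f) \<longrightarrow>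
              adjoint_op scale c \<in> dual_endos_center scale \<and> c \<in> endos_center scale)"
proof (intro conjI ballI allI impI)
  interpret poly_module scale using assms(1) by (simp add: poly_module_def)
  obtain z where z: "z \<notin> torsion scale" using assms(2) torsion_quotient_trivial by blast
  show "\<exists>c Sb Tb Wb r f. linear_operator scale c \<and> b = adjoint_op scale c \<and>
          multiplication_decomposition scale c Sb Tb Wb r f" if b: "b \<in> dual_endos_center scale" for b
  proof -
    obtain c Sb Tb Wb r f where c: "linear_operator scale c" "\<forall>\<sigma>\<in>dual scale. b \<sigma> = \<sigma> \<circ> c"
      "multiplication_decomposition scale c Sb Tb Wb r f"
      using central_decomposition[OF dual_endos_center_imp_central[OF b] z] by blast
    have "b = adjoint_op scale c" by (rule dual_endos_center_adjoint[OF b c(2)])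
    then show ?thesis using c(1,3) by blast
  qed
  fix c assume "linear_operator scale c \<and> (\<exists>Sb Tb Wb r f. multiplication_decomposition scale c Sb Tb Wb r f)"
  then obtain Sb Tb Wb r f where c: "linear_operator scale c"
    and decomposition: "multiplication_decomposition scale c Sb Tb Wb r f" by blast
  note endo = multiplication_decomposition_endo[OF c decomposition]
  show "adjoint_op scale c \<in> dual_endos_center scale"
    by (rule adjoint_in_dual_endos_center[OF endo(1) endo(3)])
  show "c \<in> endos_center scale"
    unfolding endos_center_def center_def endos_def using endo(1,2) by (auto simp: fun_eq_iff)
qed

end
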